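(* Let $(\mathcal W,\mathcal S)$ be a Coxeter system with length function $l$ and Bruhat order $\le$, and let $\mathcal B(x)$, $x\in\mathcal W$, be the intersection cohomology sheaves on its labelled Bruhat graph. Fix a surjective homomorphism of graded algebras $\rho\colon S\to\mathbb R[T]$ ($T$ in degree $2$) with $\rho(\alpha_t)\ne 0$ for all reflections $t\in\mathcal T$, and write $M_T=M\otimes_S\mathbb R[T]$ for an $S$-module $M$. Assume that for all $x,y\in\mathcal W$ with $y<x$ the module $\mathcal B(x)^y$ is generated in degrees $\le l(x)-l(y)$. Then the following two statements are equivalent: (1) For all $x,y\in\mathcal W$ with $y<x$ and all integers $m\ge 1$, multiplication by $T$ induces an isomorphism $$ T^m\colon \mathcal B(x)^{\delta y}_{T,\{l(x)-l(y)-m\}}\xrightarrow{\ \sim\ }\mathcal B(x)^{\delta y}_{T,\{l(x)-l(y)+m\}} . $$ (2) For all $x,y\in\mathcal W$ with $y<x$ the graded $\mathbb R[T]$-module $\mathcal B(x)^{\delta y}_T$ is isomorphic to a direct sum of modules of the form $(\mathbb R[T]/T^{n+1})\{-(l(x)-l(y))+n\}$ with $n\ge 0$.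
   Context: Coxeter data. $(\mathcal W,\mathcal S)$ is a Coxeter system with $\mathcal S$ finite. $V$ is its geometric representation: the real vector space with basis $(e_s)_{s\in\mathcal S}$, symmetric bilinear form $(e_s,e_t)=-\cos(\pi/m_{st})$ (equal to $-1$ if $st$ has infinite order), and action $s(v)=v-2(e_s,v)e_s$. $\mathcal T$ is the set of reflections, i.e. of all conjugates of elements of $\mathcal S$. For $t\in\mathcal T$, $\alpha_t\in V$ is a non-zero vector with $t(\alpha_t)=-\alpha_t$ (unique up to scalar). Bruhat graph. The labelled Bruhat graph $\mathcal G$ has vertex set $\mathcal W$. The vertices $x,y$ are joined by an edge $E$ if $x=ty$ for some $t\in\mathcal T$; the edge is labelled by the line $\mathbb R\alpha_t$ and directed towards $y$ if $x<y$ in the Bruhat order; write $E\colon x\xrightarrow{\alpha_t}y$ (it originates at $x$ and ends at $y$). Graded modules. $S$ is the real symmetric algebra of $V$, graded so that $V$ is in degree $2$. All modules are $\mathbb Z$-graded and morphisms of modules have degree $0$. $M_{\{k\}}$ is the homogeneous part of degree $k$ (and $M_{T,\{k\}}$ is the degree-$k$ part of $M_T$), the shift $M\{j\}$ is defined by $M\{j\}_{\{k\}}=M_{\{j+k\}}$; $M$ is generated in degrees $\le k$ if $M=\sum_{j\le k}S\cdot M_{\{j\}}$. A homomorphism $\rho$ as in the claim corresponds to the choice of a line in $V^\ast$ not contained in any reflection hyperplane. The sheaf $\mathcal B(x)$. For $x\in\mathcal W$ it consists of $S$-modules $\mathcal B(x)^y$ for each vertex $y$, $S$-modules $\mathcal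 B(x)^E$ for each edge $E$, and maps $\rho_{y,E}\colon\mathcal B(x)^y\to\mathcal B(x)^E$ for each vertex $y$ of $E$, built by descending induction in the Bruhat order. Put $\mathcal B(x)^y=0$ if $y\not\le x$ and $\mathcal B(x)^x=S$. If $\mathcal B(x)^y$ is constructed and $E\colon y'\xrightarrow{\alpha}y$ ends at $y$, put $\mathcal B(x)^E=\mathcal B(x)^y/\alpha\mathcal B(x)^y$ with $\rho_{y,E}$ the quotient map. If $\mathcal B(x)$ is constructed on the full subgraph with vertices $\{w>y\}$ (where $y<x$), let $\Gamma(\{>y\},\mathcal B(x))$ be the module of tuples $(m_w)\in\prod_{w>y}\mathcal B(x)^w$ with $\rho_{w,E}(m_w)=\rho_{w',E}(m_{w'})$ for every edge $E$ joining vertices $w,w'>y$. Let $\mathcal E^{\delta y}$ be the set of edges originating at $y$, and let $\mathcal B(x)^{\delta y}$ be the image of $\Gamma(\{>y\},\mathcal B(x))\to\bigoplus_{E\in\mathcal E^{\delta y}}\mathcal B(x)^E$, $(m_w)\mapsto(\rho_{w,E}(m_w))_{E\colon y\to w}$. Then $\mathcal B(x)^y$ is a projective cover of $\mathcal B(x)^{\delta y}$ in the category of graded $S$-modules (a graded free module surjecting onto it with kernel contained in $S_{>0}\cdot\mathcal B(x)^y$), and the $\rho_{y,E}$, $E\in\mathcal E^{\delta y}$, are the components of the covering map $\mathcal B(x)^y\to\mathcal B(x)^{\delta y}$. *)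

theory Defs
  imports
    Complex_Main
    "HOL-Library.Poly_Mapping"
    "HOL-Computational_Algebra.Polynomial"
    "HOL-Algebra.Module"
    "HOL-Algebra.AbelCoset"
    "HOL-Algebra.Multiplicative_Group"
    "HOL-Algebra.Free_Abelian_Groups"
begin

section \<open>Coxeter systems\<close>

definition word_prod :: "('w, 'b) monoid_scheme \<Rightarrow> 'w list \<Rightarrow> 'w" where
  "word_prod W ss = foldr (\<lambda>s w. s \<otimes>\<^bsub>W\<^esub> w) ss \<one>\<^bsub>W\<^esub>"

text \<open>\<open>cox_order W s t\<close> is $m_{st}$; the library's order of an element is \<open>0\<close> when the
  element has infinite order.\<close>

definition cox_order :: "('w, 'b) monoid_scheme \<Rightarrow> 'w \<Rightarrow> 'w \<Rightarrow> nat" where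
  "cox_order W s t = group.ord W (s \<otimes>\<^bsub>W\<^esub> t)"

text \<open>The congruence on words generated by $(st)^{m_{st}} = 1$. The relations for $s = t$ say
  $s^2 = 1$, so the monoid presented by them is the group presented by them.\<close>

inductive cox_cong :: "('w, 'b) monoid_scheme \<Rightarrow> 'w set \<Rightarrow> 'w list \<Rightarrow> 'w list \<Rightarrow> bool"
  for W :: "('w, 'b) monoid_scheme" and S :: "'w set" where
  relator: "\<lbrakk>s \<in> S; t \<in> S; cox_order W s t \<noteq> 0; u \<in> lists S; v \<in> lists S\<rbrakk> \<Longrightarrow>
      cox_cong W S (u @ concat (replicate (cox_order W s t) [s, t]) @ v) (u @ v)"
| refl: "u \<in> lists S \<Longrightarrow> cox_cong W S u u"
| sym: "cox_cong W S u v \<Longrightarrow> cox_cong W S v u"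
| trans: "\<lbrakk>cox_cong W S u v; cox_cong W S v w\<rbrakk> \<Longrightarrow> cox_cong W S u w"

definition coxeter_system :: "('w, 'b) monoid_scheme \<Rightarrow> 'w set \<Rightarrow> bool" where
  "coxeter_system W S \<longleftrightarrow>
     group W \<and> S \<subseteq> carrier W \<and>
     (\<forall>s\<in>S. s \<noteq> \<one>\<^bsub>W\<^esub> \<and> s \<otimes>\<^bsub>W\<^esub> s = \<one>\<^bsub>W\<^esub>) \<and>
     generate W S = carrier W \<and>
     (\<forall>u\<in>lists S. \<forall>v\<in>lists S. word_prod W u = word_prod W v \<longrightarrow> cox_cong W S u v)"

definition reflections :: "('w, 'b) monoid_scheme \<Rightarrow> 'w set \<Rightarrow> 'w set" where
  "reflections W S = {w \<otimes>\<^bsub>W\<^esub> s \<otimes>\<^bsub>W\<^esub> inv\<^bsub>W\<^esub> w | w s. w \<in> carrier W \<and> s \<in> S}"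

definition cox_length :: "('w, 'b) monoid_scheme \<Rightarrow> 'w set \<Rightarrow> 'w \<Rightarrow> nat" where
  "cox_length W S w = (LEAST n. \<exists>ss\<in>lists S. length ss = n \<and> word_prod W ss = w)"

text \<open>The Bruhat order is the transitive closure of: $y < ty$ if $t$ is a reflection and
  $l(y) < l(ty)$.\<close>

definition bruhat_step :: "('w, 'b) monoid_scheme \<Rightarrow> 'w set \<Rightarrow> 'w \<Rightarrow> 'w \<Rightarrow> bool" where
  "bruhat_step W S y w \<longleftrightarrow>
     y \<in> carrier W \<and> (\<exists>t\<in>reflections W S. w = t \<otimes>\<^bsub>W\<^esub> y) \<and> cox_length W S y < cox_length W S w"

definition bruhat_less :: "('w, 'b) monoid_scheme \<Rightarrow> 'w set \<Rightarrow> 'w \<Rightarrow> 'w \<Rightarrow> bool" where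
  "bruhat_less W S = (bruhat_step W S)\<^sup>+\<^sup>+"

definition bruhat_le :: "('w, 'b) monoid_scheme \<Rightarrow> 'w set \<Rightarrow> 'w \<Rightarrow> 'w \<Rightarrow> bool" where
  "bruhat_le W S y x \<longleftrightarrow> y = x \<or> bruhat_less W S y x"


section \<open>The geometric representation\<close>

text \<open>Vectors of $V$ are given by their coordinates with respect to the basis $(e_s)_{s \in S}$,
  extended by zero outside $S$.\<close>

definition geom_space :: "'w set \<Rightarrow> ('w \<Rightarrow> real) set" where
  "geom_space S = {v. \<forall>w. w \<notin> S \<longrightarrow> v w = 0}"

definition geom_basis :: "'w \<Rightarrow> 'w \<Rightarrow> real" where
  "geom_basis s = (\<lambda>w. if w = s then 1 else 0)"

definition geom_form ::
  "('w, 'b) monoid_scheme \<Rightarrow> 'w set \<Rightarrow> ('w \<Rightarrow> real) \<Rightarrow> ('w \<Rightarrow> real) \<Rightarrow> real" where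
  "geom_form W S u v =
     (\<Sum>s\<in>S. \<Sum>t\<in>S. u s * v t *
        (if cox_order W s t = 0 then - 1 else - cos (pi / real (cox_order W s t))))"

definition simple_act ::
  "('w, 'b) monoid_scheme \<Rightarrow> 'w set \<Rightarrow> 'w \<Rightarrow> ('w \<Rightarrow> real) \<Rightarrow> ('w \<Rightarrow> real)" where
  "simple_act W S s v = (\<lambda>w. v w - 2 * geom_form W S (geom_basis s) v * geom_basis s w)"

text \<open>The action of a general element, through any word representing it.\<close>

definition geom_act ::
  "('w, 'b) monoid_scheme \<Rightarrow> 'w set \<Rightarrow> 'w \<Rightarrow> ('w \<Rightarrow> real) \<Rightarrow> ('w \<Rightarrow> real)" where
  "geom_act W S w v =
     (THE u. \<exists>ss\<in>lists S. word_prod W ss = w \<and> u = foldr (simple_act W S) ss v)"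

definition is_root_of ::
  "('w, 'b) monoid_scheme \<Rightarrow> 'w set \<Rightarrow> 'w \<Rightarrow> ('w \<Rightarrow> real) \<Rightarrow> bool" where
  "is_root_of W S t v \<longleftrightarrow>
     v \<in> geom_space S \<and> v \<noteq> (\<lambda>_. 0) \<and> geom_act W S t v = (\<lambda>w. - v w)"


section \<open>Graded rings and graded modules\<close>

record 'a gring = "'a ring" +
  rpart :: "int \<Rightarrow> 'a set"

record ('a, 'm) gmodule = "('a, 'm) module" +
  mpart :: "int \<Rightarrow> 'm set"

text \<open>The \<open>mult\<close> and \<open>one\<close> fields that the library's module record inherits from rings play no
  role and are left \<open>undefined\<close> below.\<close>

definition graded_module ::
  "('a, 'r) ring_scheme \<Rightarrow> (int \<Rightarrow> 'a set) \<Rightarrow> ('a, 'm, 'x) gmodule_scheme \<Rightarrow> bool" where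
  "graded_module R D M \<longleftrightarrow>
     module R M \<and>
     (\<forall>k. additive_subgroup (mpart M k) M) \<and>
     (\<forall>x\<in>carrier M. \<exists>!f. (\<forall>k. f k \<in> mpart M k) \<and> finite {k. f k \<noteq> \<zero>\<^bsub>M\<^esub>} \<and>
        x = (\<Oplus>\<^bsub>M\<^esub>k\<in>{k. f k \<noteq> \<zero>\<^bsub>M\<^esub>}. f k)) \<and>
     (\<forall>i j. \<forall>r\<in>D i. \<forall>m\<in>mpart M j. r \<odot>\<^bsub>M\<^esub> m \<in> mpart M (i + j))"

definition graded_hom ::
  "('a, 'r) ring_scheme \<Rightarrow> ('a, 'm, 'x) gmodule_scheme \<Rightarrow> ('a, 'n, 'y) gmodule_scheme \<Rightarrow>
     ('m \<Rightarrow> 'n) \<Rightarrow> bool" where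
  "graded_hom R M N h \<longleftrightarrow>
     h \<in> carrier M \<rightarrow> carrier N \<and>
     (\<forall>x\<in>carrier M. \<forall>y\<in>carrier M. h (x \<oplus>\<^bsub>M\<^esub> y) = h x \<oplus>\<^bsub>N\<^esub> h y) \<and>
     (\<forall>r\<in>carrier R. \<forall>x\<in>carrier M. h (r \<odot>\<^bsub>M\<^esub> x) = r \<odot>\<^bsub>N\<^esub> h x) \<and>
     (\<forall>k. h ` mpart M k \<subseteq> mpart N k)"

definition graded_iso ::
  "('a, 'r) ring_scheme \<Rightarrow> ('a, 'm, 'x) gmodule_scheme \<Rightarrow> ('a, 'n, 'y) gmodule_scheme \<Rightarrow> bool" where
  "graded_iso R M N \<longleftrightarrow>
     (\<exists>h. graded_hom R M N h \<and> bij_betw h (carrier M) (carrier N) \<and>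
        (\<forall>k. h ` mpart M k = mpart N k))"

definition mod_span ::
  "('a, 'r) ring_scheme \<Rightarrow> ('a, 'm, 'x) module_scheme \<Rightarrow> 'm set \<Rightarrow> 'm set" where
  "mod_span R M X = \<Inter>{N. submodule N R M \<and> X \<subseteq> N}"

definition generated_in_degrees_le ::
  "('a, 'r) ring_scheme \<Rightarrow> ('a, 'm, 'x) gmodule_scheme \<Rightarrow> int \<Rightarrow> bool" where
  "generated_in_degrees_le R M k \<longleftrightarrow> carrier M = mod_span R M (\<Union>j\<in>{..k}. mpart M j)"

text \<open>$R_{>0} \cdot M$\<close>

definition positive_part_span ::
  "('a, 'r) ring_scheme \<Rightarrow> (int \<Rightarrow> 'a set) \<Rightarrow> ('a, 'm, 'x) module_scheme \<Rightarrow> 'm set" where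
  "positive_part_span R D M =
     mod_span R M {r \<odot>\<^bsub>M\<^esub> m | r m k. 0 < k \<and> r \<in> D k \<and> m \<in> carrier M}"

text \<open>Graded free modules: there is a basis consisting of homogeneous elements.\<close>

definition graded_free ::
  "('a, 'r) ring_scheme \<Rightarrow> (int \<Rightarrow> 'a set) \<Rightarrow> ('a, 'm, 'x) gmodule_scheme \<Rightarrow> bool" where
  "graded_free R D M \<longleftrightarrow>
     graded_module R D M \<and>
     (\<exists>X \<subseteq> (\<Union>k. mpart M k). \<forall>x\<in>carrier M. \<exists>!c.
        (\<forall>b\<in>X. c b \<in> carrier R) \<and> (\<forall>b. b \<notin> X \<longrightarrow> c b = \<zero>\<^bsub>R\<^esub>) \<and> finite {b. c b \<noteq> \<zero>\<^bsub>R\<^esub>} \<and>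
        x = (\<Oplus>\<^bsub>M\<^esub>b\<in>{b. c b \<noteq> \<zero>\<^bsub>R\<^esub>}. c b \<odot>\<^bsub>M\<^esub> b))"

definition projective_cover ::
  "('a, 'r) ring_scheme \<Rightarrow> (int \<Rightarrow> 'a set) \<Rightarrow> ('a, 'm, 'x) gmodule_scheme \<Rightarrow>
     ('a, 'n, 'y) gmodule_scheme \<Rightarrow> ('m \<Rightarrow> 'n) \<Rightarrow> bool" where
  "projective_cover R D P M p \<longleftrightarrow>
     graded_free R D P \<and> graded_hom R P M p \<and> p ` carrier P = carrier M \<and>
     a_kernel P M p \<subseteq> positive_part_span R D P"

definition regular_module :: "('a, 'x) gring_scheme \<Rightarrow> ('a, 'a) gmodule" where
  "regular_module R =
     \<lparr>carrier = carrier R, mult = undefined, one = undefined,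
      ring.zero = \<zero>\<^bsub>R\<^esub>, add = add R, smult = mult R, mpart = rpart R\<rparr>"

definition shift :: "('a, 'm) gmodule \<Rightarrow> int \<Rightarrow> ('a, 'm) gmodule" where
  "shift M j = M\<lparr>mpart := \<lambda>k. mpart M (j + k)\<rparr>"

definition graded_quot :: "('a, 'm, 'x) gmodule_scheme \<Rightarrow> 'm set \<Rightarrow> ('a, 'm set) gmodule" where
  "graded_quot M N =
     \<lparr>carrier = a_rcosets\<^bsub>M\<^esub> N, mult = undefined, one = undefined,
      ring.zero = N, add = set_add M,
      smult = (\<lambda>r X. \<Union>x\<in>X. N +>\<^bsub>M\<^esub> (r \<odot>\<^bsub>M\<^esub> x)),
      mpart = (\<lambda>k. (\<lambda>m. N +>\<^bsub>M\<^esub> m) ` mpart M k)\<rparr>"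

definition smult_image :: "'a \<Rightarrow> ('a, 'm, 'x) module_scheme \<Rightarrow> 'm set" where
  "smult_image r M = (\<lambda>m. r \<odot>\<^bsub>M\<^esub> m) ` carrier M"

definition direct_sum :: "'i set \<Rightarrow> ('i \<Rightarrow> ('a, 'm) gmodule) \<Rightarrow> ('a, 'i \<Rightarrow> 'm) gmodule" where
  "direct_sum I M =
     (let C = {f \<in> \<Pi>\<^sub>E i\<in>I. carrier (M i). finite {i \<in> I. f i \<noteq> \<zero>\<^bsub>M i\<^esub>}} in
     \<lparr>carrier = C, mult = undefined, one = undefined,
      ring.zero = (\<lambda>i\<in>I. \<zero>\<^bsub>M i\<^esub>), add = (\<lambda>f g. \<lambda>i\<in>I. f i \<oplus>\<^bsub>M i\<^esub> g i),
      smult = (\<lambda>r f. \<lambda>i\<in>I. r \<odot>\<^bsub>M i\<^esub> f i),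
      mpart = (\<lambda>k. {f \<in> C. \<forall>i\<in>I. f i \<in> mpart (M i) k})\<rparr>)"

definition restrict_module :: "('a, 'm) gmodule \<Rightarrow> 'm set \<Rightarrow> ('a, 'm) gmodule" where
  "restrict_module M N = M\<lparr>carrier := N, mpart := \<lambda>k. mpart M k \<inter> N\<rparr>"


subsection \<open>Extension of scalars\<close>

text \<open>$M \otimes_R A$ for a ring homomorphism $f : R \to A$: the free abelian group on
  $M \times A$ modulo the bilinearity relations, with $A$ acting on the second factor and
  $m \otimes a$ of degree $i + j$ if $m$, $a$ have degrees $i$, $j$.\<close>

definition tensor_relations ::
  "('a, 'r) ring_scheme \<Rightarrow> ('c, 'z) ring_scheme \<Rightarrow> ('a \<Rightarrow> 'c) \<Rightarrow> ('a, 'm, 'x) module_scheme \<Rightarrow>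
     (('m \<times> 'c) \<Rightarrow>\<^sub>0 int) set" where
  "tensor_relations R A f M =
     {frag_of (m \<oplus>\<^bsub>M\<^esub> m', a) - frag_of (m, a) - frag_of (m', a) | m m' a.
        m \<in> carrier M \<and> m' \<in> carrier M \<and> a \<in> carrier A} \<union>
     {frag_of (m, a \<oplus>\<^bsub>A\<^esub> a') - frag_of (m, a) - frag_of (m, a') | m a a'.
        m \<in> carrier M \<and> a \<in> carrier A \<and> a' \<in> carrier A} \<union>
     {frag_of (r \<odot>\<^bsub>M\<^esub> m, a) - frag_of (m, f r \<otimes>\<^bsub>A\<^esub> a) | r m a.
        r \<in> carrier R \<and> m \<in> carrier M \<and> a \<in> carrier A}"

definition base_change ::
  "('a, 'r) ring_scheme \<Rightarrow> ('c, 'z) gring_scheme \<Rightarrow> ('a \<Rightarrow> 'c) \<Rightarrow> ('a, 'm, 'x) gmodule_scheme \<Rightarrow>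
     ('c, (('m \<times> 'c) \<Rightarrow>\<^sub>0 int) set) gmodule" where
  "base_change R A f M =
     (let F = free_Abelian_group (carrier M \<times> carrier A);
          K = generate F (tensor_relations R A f M);
          Q = F Mod K in
     \<lparr>carrier = carrier Q, mult = undefined, one = undefined,
      ring.zero = \<one>\<^bsub>Q\<^esub>, add = mult Q,
      smult = (\<lambda>b X. \<Union>z\<in>X. K #>\<^bsub>F\<^esub> frag_extend (\<lambda>(m, a). frag_of (m, b \<otimes>\<^bsub>A\<^esub> a)) z),
      mpart = (\<lambda>k. generate Q {K #>\<^bsub>F\<^esub> frag_of (m, a) | m a i j.
                  m \<in> mpart M i \<and> a \<in> rpart A j \<and> i + j = k})\<rparr>)"


section \<open>The algebras $S$ and $\mathbb{R}[T]$\<close>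

text \<open>The symmetric algebra of $V$ is the polynomial ring in the basis vectors $e_s$, $s \in S$.
  Each $e_s$ has degree 2.\<close>

definition sym_carrier :: "'w set \<Rightarrow> (('w \<Rightarrow>\<^sub>0 nat) \<Rightarrow>\<^sub>0 real) set" where
  "sym_carrier S = {p. \<forall>m\<in>Poly_Mapping.keys p. Poly_Mapping.keys m \<subseteq> S}"

definition sym_alg :: "'w set \<Rightarrow> (('w \<Rightarrow>\<^sub>0 nat) \<Rightarrow>\<^sub>0 real) gring" where
  "sym_alg S =
     \<lparr>carrier = sym_carrier S, mult = (*), one = 1, ring.zero = 0, add = (+),
      rpart = (\<lambda>k. {p \<in> sym_carrier S. \<forall>m\<in>Poly_Mapping.keys p.
                 2 * int (\<Sum>s\<in>Poly_Mapping.keys m. Poly_Mapping.lookup m s) = k})\<rparr>"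

definition sym_const :: "real \<Rightarrow> ('w \<Rightarrow>\<^sub>0 nat) \<Rightarrow>\<^sub>0 real" where
  "sym_const c = Poly_Mapping.single 0 c"

text \<open>The inclusion of $V$ into $S$.\<close>

definition sym_vec :: "'w set \<Rightarrow> ('w \<Rightarrow> real) \<Rightarrow> ('w \<Rightarrow>\<^sub>0 nat) \<Rightarrow>\<^sub>0 real" where
  "sym_vec S v = (\<Sum>s\<in>S. Poly_Mapping.single (Poly_Mapping.single s 1) (v s))"

definition RT :: "real poly gring" where
  "RT = \<lparr>carrier = UNIV, mult = (*), one = 1, ring.zero = 0, add = (+),
         rpart = (\<lambda>k. {p. \<forall>i. Polynomial.coeff p i \<noteq> 0 \<longrightarrow> 2 * int i = k})\<rparr>"

definition T_pow :: "nat \<Rightarrow> real poly" where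
  "T_pow n = Polynomial.monom 1 n"

definition graded_alg_hom ::
  "'w set \<Rightarrow> ((('w \<Rightarrow>\<^sub>0 nat) \<Rightarrow>\<^sub>0 real) \<Rightarrow> real poly) \<Rightarrow> bool" where
  "graded_alg_hom S \<rho> \<longleftrightarrow>
     \<rho> \<in> ring_hom (sym_alg S) RT \<and> (\<forall>c. \<rho> (sym_const c) = [:c:]) \<and>
     (\<forall>k. \<rho> ` rpart (sym_alg S) k \<subseteq> rpart RT k)"

definition extend_to_RT ::
  "'w set \<Rightarrow> ((('w \<Rightarrow>\<^sub>0 nat) \<Rightarrow>\<^sub>0 real) \<Rightarrow> real poly) \<Rightarrow> (('w \<Rightarrow>\<^sub>0 nat) \<Rightarrow>\<^sub>0 real, 'm) gmodule \<Rightarrow>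
     (real poly, (('m \<times> real poly) \<Rightarrow>\<^sub>0 int) set) gmodule" where
  "extend_to_RT S \<rho> M = base_change (sym_alg S) RT \<rho> M"

text \<open>$(\mathbb{R}[T]/T^{n+1})\{-d+n\}$\<close>

definition string_module :: "int \<Rightarrow> nat \<Rightarrow> (real poly, real poly set) gmodule" where
  "string_module d n =
     shift (graded_quot (regular_module RT) (smult_image (T_pow (n + 1)) (regular_module RT)))
       (- d + int n)"

text \<open>Non-zero direct summands of \<open>M\<close> can be indexed by non-zero elements of \<open>M\<close>, so letting the
  index set range over the sets of elements of the type of \<open>M\<close> does not restrict the direct
  sums considered.\<close>

definition is_sum_of_strings :: "int \<Rightarrow> (real poly, 'e) gmodule \<Rightarrow> bool" where
  "is_sum_of_strings d M \<longleftrightarrow>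
     (\<exists>(I :: 'e set) (n :: 'e \<Rightarrow> nat). graded_iso RT M (direct_sum I (\<lambda>i. string_module d (n i))))"


section \<open>Intersection cohomology sheaves on the Bruhat graph\<close>

text \<open>An edge is the pair of its origin and its end; the label of $y \to w$ is the line spanned
  by \<open>\<alpha> t\<close> for the reflection $t = w y^{-1}$.\<close>

definition bruhat_edges :: "('w, 'b) monoid_scheme \<Rightarrow> 'w set \<Rightarrow> ('w \<times> 'w) set" where
  "bruhat_edges W S =
     {(y, w). y \<in> carrier W \<and> w \<in> carrier W \<and> (\<exists>t\<in>reflections W S. w = t \<otimes>\<^bsub>W\<^esub> y) \<and>
        bruhat_less W S y w}"

definition edge_label ::
  "('w, 'b) monoid_scheme \<Rightarrow> 'w set \<Rightarrow> ('w \<Rightarrow> 'w \<Rightarrow> real) \<Rightarrow> 'w \<times> 'w \<Rightarrow> ('w \<Rightarrow>\<^sub>0 nat) \<Rightarrow>\<^sub>0 real" where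
  "edge_label W S \<alpha> E = sym_vec S (\<alpha> (snd E \<otimes>\<^bsub>W\<^esub> inv\<^bsub>W\<^esub> (fst E)))"

definition edges_from :: "('w, 'b) monoid_scheme \<Rightarrow> 'w set \<Rightarrow> 'w \<Rightarrow> ('w \<times> 'w) set" where
  "edges_from W S y = {E \<in> bruhat_edges W S. fst E = y}"

text \<open>Edge modules are quotients of stalks, so their elements are sets of elements of stalks.
  \<open>rest B y E\<close> is $\rho_{y,E}$.\<close>

record ('w, 'm) bruhat_sheaf =
  stalk :: "'w \<Rightarrow> (('w \<Rightarrow>\<^sub>0 nat) \<Rightarrow>\<^sub>0 real, 'm) gmodule"
  emod :: "'w \<times> 'w \<Rightarrow> (('w \<Rightarrow>\<^sub>0 nat) \<Rightarrow>\<^sub>0 real, 'm set) gmodule"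
  rest :: "'w \<Rightarrow> 'w \<times> 'w \<Rightarrow> 'm \<Rightarrow> 'm set"

text \<open>$\Gamma(\{>y\}, B)$\<close>

definition sections_above ::
  "('w, 'b) monoid_scheme \<Rightarrow> 'w set \<Rightarrow> ('w, 'm) bruhat_sheaf \<Rightarrow> 'w \<Rightarrow> ('w \<Rightarrow> 'm) set" where
  "sections_above W S B y =
     {m \<in> \<Pi>\<^sub>E w\<in>{w. bruhat_less W S y w}. carrier (stalk B w).
        \<forall>w w'. (w, w') \<in> bruhat_edges W S \<and> bruhat_less W S y w \<and> bruhat_less W S y w' \<longrightarrow>
          rest B w (w, w') (m w) = rest B w' (w, w') (m w')}"

text \<open>$B^{\delta y}$\<close>

definition delta_module ::
  "('w, 'b) monoid_scheme \<Rightarrow> 'w set \<Rightarrow> ('w, 'm) bruhat_sheaf \<Rightarrow> 'w \<Rightarrow>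
     (('w \<Rightarrow>\<^sub>0 nat) \<Rightarrow>\<^sub>0 real, 'w \<times> 'w \<Rightarrow> 'm set) gmodule" where
  "delta_module W S B y =
     restrict_module (direct_sum (edges_from W S y) (emod B))
       ((\<lambda>m. \<lambda>E\<in>edges_from W S y. rest B (snd E) E (m (snd E))) ` sections_above W S B y)"

text \<open>\<open>ic_sheaf W S \<alpha> x B\<close>: the sheaf \<open>B\<close> is obtained by the inductive construction of
  $\mathcal{B}(x)$. The construction involves the choice of a projective cover at each vertex, so
  this is a predicate and not a function of $x$; it determines \<open>B\<close> up to isomorphism.\<close>

definition ic_sheaf ::
  "('w, 'b) monoid_scheme \<Rightarrow> 'w set \<Rightarrow> ('w \<Rightarrow> 'w \<Rightarrow> real) \<Rightarrow> 'w \<Rightarrow> ('w, 'm) bruhat_sheaf \<Rightarrow> bool" where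
  "ic_sheaf W S \<alpha> x B \<longleftrightarrow>
     (let R = sym_alg S; D = rpart (sym_alg S) in
      (\<forall>y\<in>carrier W. graded_module R D (stalk B y)) \<and>
      (\<forall>y\<in>carrier W. \<not> bruhat_le W S y x \<longrightarrow> carrier (stalk B y) = {\<zero>\<^bsub>stalk B y\<^esub>}) \<and>
      graded_iso R (stalk B x) (regular_module R) \<and>
      (\<forall>E\<in>bruhat_edges W S.
         let N = smult_image (edge_label W S \<alpha> E) (stalk B (snd E)) in
         emod B E = graded_quot (stalk B (snd E)) N \<and>
         (\<forall>m\<in>carrier (stalk B (snd E)). rest B (snd E) E m = N +>\<^bsub>stalk B (snd E)\<^esub> m) \<and>
         graded_hom R (stalk B (fst E)) (emod B E) (rest B (fst E) E)) \<and>
      (\<forall>y\<in>carrier W. bruhat_less W S y x \<longrightarrow>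
         projective_cover R D (stalk B y) (delta_module W S B y)
           (\<lambda>m. \<lambda>E\<in>edges_from W S y. rest B y E m)))"

end

theory Submission
  imports Defs
begin

text \<open>
  The equivalence holds for each pair $y < x$ separately, and it is the linear algebra behind the
  Lefschetz decomposition. A string $(\mathbb{R}[T]/T^{n+1})\{-d+n\}$ has one basis vector in each of the
  degrees $d-n, d-n+2, \dots, d+n$, and $T$ moves each of them to the next, so $T^m$ maps degree $d-m$
  isomorphically to degree $d+m$. This passes to direct sums and gives one implication
  (\<open>sum_of_strings_lefschetz\<close>).

  Conversely, let $A$ be a graded $\mathbb{R}[T]$-module with these isomorphisms. Call $u$ in degree $d-n$
  primitive if $T^{n+1}u = 0$. A non-zero primitive $u$ generates a string, since $T^n$ is injective in
  degree $d-n$. Zorn's lemma provides a maximal set of primitive elements whose strings have a direct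
  sum. This sum contains all primitive elements (\<open>primitive_in_span\<close>), and an induction on the degree
  shows that it is all of $A$ (\<open>carrier_in_span\<close>): an element $u$ of degree $d-n$ becomes primitive after
  subtracting some $Tv$ with $v$ in degree $d-n-2$.
  The induction needs a lowest degree.

  It remains to see that $A = \mathcal{B}(x)^{\delta y}_T$ is a graded module which vanishes in negative
  degrees (\<open>delta_extension_graded\<close>). The grading comes from the stalk $\mathcal{B}(x)^y$, which surjects
  onto $\mathcal{B}(x)^{\delta y}$ and then onto $A$ by $m \mapsto m \otimes 1$; both surjections have homogeneous
  kernels (\<open>delta_module_graded\<close>, \<open>graded_module_base_change\<close>). For the second one, \<open>\<rho>\<close> is split by
  $T \mapsto v$ with some $v$ of degree $2$, which turns the tensor product into a quotient. The bound
  on the degrees is proved by descending induction in the Bruhat order (\<open>stalk_nonnegative\<close>): the stalk at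
  $x$ is the symmetric algebra, and a projective cover starts in the same degree as the module it covers.
\<close>

section \<open>Components of elements of graded modules\<close>

text \<open>The conditions are those of the definition of a graded module, so in such a module the definite
  description picks the unique decomposition.\<close>

definition component :: "('a, 'm, 'x) gmodule_scheme \<Rightarrow> int \<Rightarrow> 'm \<Rightarrow> 'm" where
  "component M k x = (THE f. (\<forall>k. f k \<in> mpart M k) \<and> finite {k. f k \<noteq> \<zero>\<^bsub>M\<^esub>} \<and>
      x = (\<Oplus>\<^bsub>M\<^esub>k\<in>{k. f k \<noteq> \<zero>\<^bsub>M\<^esub>}. f k)) k"

locale graded_mod = module R M
  for R :: "('a, 'r) ring_scheme" (structure) and D :: "int \<Rightarrow> 'a set"
    and M :: "('a, 'm, 'x) gmodule_scheme" (structure) +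
  assumes graded: "graded_module R D M" and degree_parts: "D i \<subseteq> carrier R"

lemma (in abelian_group) eq_if_diff_zero:
  assumes "x \<in> carrier G" "y \<in> carrier G" "x \<ominus> y = \<zero>"
  shows "x = y"
proof -
  have "\<ominus> (\<ominus> y) = x" using assms by (intro minus_equality) (simp_all add: a_minus_def)
  then show ?thesis using assms by simp
qed

lemma graded_modI:
  "graded_module R D M \<Longrightarrow> (\<And>i. D i \<subseteq> carrier R) \<Longrightarrow> graded_mod R D M"
  by (simp add: graded_mod_def graded_mod_axioms_def graded_module_def)

context graded_mod
begin

lemma part_subgroup: "additive_subgroup (mpart M k) M"
  using graded unfolding graded_module_def by blast

lemma part_closed: "u \<in> mpart M k \<Longrightarrow> u \<in> carrier M"
  using additive_subgroup.a_subset[OF part_subgroup] by blast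

lemma zero_in_part: "\<zero>\<^bsub>M\<^esub> \<in> mpart M k"
  by (rule additive_subgroup.zero_closed[OF part_subgroup])

lemma add_in_part: "u \<in> mpart M k \<Longrightarrow> v \<in> mpart M k \<Longrightarrow> u \<oplus>\<^bsub>M\<^esub> v \<in> mpart M k"
  by (rule additive_subgroup.a_closed[OF part_subgroup])

lemma neg_in_part: "u \<in> mpart M k \<Longrightarrow> \<ominus>\<^bsub>M\<^esub> u \<in> mpart M k"
  by (rule additive_subgroup.a_inv_closed[OF part_subgroup])

lemma diff_in_part: "u \<in> mpart M k \<Longrightarrow> v \<in> mpart M k \<Longrightarrow> u \<ominus>\<^bsub>M\<^esub> v \<in> mpart M k"
  by (simp add: a_minus_def add_in_part neg_in_part)

lemma smult_in_part: "r \<in> D i \<Longrightarrow> u \<in> mpart M j \<Longrightarrow> r \<odot>\<^bsub>M\<^esub> u \<in> mpart M (i + j)"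
  using graded unfolding graded_module_def by blast

lemma component_family:
  assumes "x \<in> carrier M"
  shows "(\<forall>k. component M k x \<in> mpart M k) \<and> finite {k. component M k x \<noteq> \<zero>\<^bsub>M\<^esub>} \<and>
    x = (\<Oplus>\<^bsub>M\<^esub>k\<in>{k. component M k x \<noteq> \<zero>\<^bsub>M\<^esub>}. component M k x)"
proof -
  have "\<exists>!f. (\<forall>k. f k \<in> mpart M k) \<and> finite {k. f k \<noteq> \<zero>\<^bsub>M\<^esub>} \<and>
      x = (\<Oplus>\<^bsub>M\<^esub>k\<in>{k. f k \<noteq> \<zero>\<^bsub>M\<^esub>}. f k)"
    using graded assms unfolding graded_module_def by blast
  from theI'[OF this] show ?thesis unfolding component_def .
qed

lemma component_in_part: "x \<in> carrier M \<Longrightarrow> component M k x \<in> mpart M k"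
  using component_family by blast

lemma component_closed [simp]: "x \<in> carrier M \<Longrightarrow> component M k x \<in> carrier M"
  using component_in_part part_closed by blast

lemma finite_support_component: "x \<in> carrier M \<Longrightarrow> finite {k. component M k x \<noteq> \<zero>\<^bsub>M\<^esub>}"
  using component_family by blast

lemma sum_components:
  "x \<in> carrier M \<Longrightarrow> (\<Oplus>\<^bsub>M\<^esub>k\<in>{k. component M k x \<noteq> \<zero>\<^bsub>M\<^esub>}. component M k x) = x"
  using component_family by metis

text \<open>Computing a component by exhibiting a decomposition over any finite set of degrees, which may
  contain degrees where the summand vanishes, is how all formulas for components are obtained.\<close>

lemma component_unique:
  assumes f: "\<And>k. f k \<in> mpart M k" and A: "finite A" "\<And>k. k \<notin> A \<Longrightarrow> f k = \<zero>\<^bsub>M\<^esub>"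
    and x: "x = (\<Oplus>\<^bsub>M\<^esub>k\<in>A. f k)"
  shows "component M j x = f j"
proof -
  have fC: "f k \<in> carrier M" for k using f part_closed by blast
  let ?F = "\<lambda>f. (\<forall>k. f k \<in> mpart M k) \<and> finite {k. f k \<noteq> \<zero>\<^bsub>M\<^esub>} \<and>
      x = (\<Oplus>\<^bsub>M\<^esub>k\<in>{k. f k \<noteq> \<zero>\<^bsub>M\<^esub>}. f k)"
  have sub: "{k. f k \<noteq> \<zero>\<^bsub>M\<^esub>} \<subseteq> A" using A(2) by blast
  have xC: "x \<in> carrier M" unfolding x by (simp add: fC Pi_def)
  have "(\<Oplus>\<^bsub>M\<^esub>k\<in>A. f k) = (\<Oplus>\<^bsub>M\<^esub>k\<in>{k. f k \<noteq> \<zero>\<^bsub>M\<^esub>}. f k)"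
    using A(1) sub by (intro M.add.finprod_mono_neutral_cong_right) (auto simp: fC)
  then have F: "?F f" using f x finite_subset[OF sub A(1)] by simp
  have ex: "\<exists>!f. ?F f"
    using graded xC unfolding graded_module_def by blast
  have "(THE f. ?F f) = f" by (rule the1_equality[where P = ?F, OF ex F])
  then show ?thesis unfolding component_def by simp
qed

lemma component_homogeneous:
  assumes "u \<in> mpart M k"
  shows "component M j u = (if j = k then u else \<zero>\<^bsub>M\<^esub>)"
proof (rule component_unique[where A = "{k}"])
  show "(if i = k then u else \<zero>\<^bsub>M\<^esub>) \<in> mpart M i" for i
    using assms zero_in_part by auto
qed (use assms part_closed in auto)

lemma component_zero [simp]: "component M k \<zero>\<^bsub>M\<^esub> = \<zero>\<^bsub>M\<^esub>"
  using component_homogeneous[OF zero_in_part[of k]] by simp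

lemma component_add:
  assumes x: "x \<in> carrier M" and y: "y \<in> carrier M"
  shows "component M k (x \<oplus>\<^bsub>M\<^esub> y) = component M k x \<oplus>\<^bsub>M\<^esub> component M k y"
proof (rule component_unique)
  let ?S = "\<lambda>x. {k. component M k x \<noteq> \<zero>\<^bsub>M\<^esub>}"
  let ?A = "?S x \<union> ?S y"
  show "component M k x \<oplus>\<^bsub>M\<^esub> component M k y \<in> mpart M k" for k
    by (simp add: x y component_in_part add_in_part)
  show fin: "finite ?A" using x y by (simp add: finite_support_component)
  show "component M k x \<oplus>\<^bsub>M\<^esub> component M k y = \<zero>\<^bsub>M\<^esub>" if "k \<notin> ?A" for k
    using that by simp
  have "(\<Oplus>\<^bsub>M\<^esub>k\<in>?A. component M k z) = z" if "z \<in> carrier M" "?S z \<subseteq> ?A" for z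
    using that fin
    by (subst (2) sum_components[OF that(1), symmetric])
      (intro M.add.finprod_mono_neutral_cong_right, auto)
  then show "x \<oplus>\<^bsub>M\<^esub> y = (\<Oplus>\<^bsub>M\<^esub>k\<in>?A. component M k x \<oplus>\<^bsub>M\<^esub> component M k y)"
    using x y by (subst M.finsum_addf) auto
qed

lemma component_neg:
  assumes "x \<in> carrier M"
  shows "component M k (\<ominus>\<^bsub>M\<^esub> x) = \<ominus>\<^bsub>M\<^esub> component M k x"
proof -
  have "component M k (\<ominus>\<^bsub>M\<^esub> x) \<oplus>\<^bsub>M\<^esub> component M k x = \<zero>\<^bsub>M\<^esub>"
    using assms by (simp add: component_add[symmetric] M.l_neg)
  then show ?thesis using assms by (simp add: M.minus_equality)
qed

lemma component_diff:
  "x \<in> carrier M \<Longrightarrow> y \<in> carrier M \<Longrightarrow>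
    component M k (x \<ominus>\<^bsub>M\<^esub> y) = component M k x \<ominus>\<^bsub>M\<^esub> component M k y"
  by (simp add: a_minus_def component_add component_neg)

lemma component_finsum:
  assumes "finite F" "f \<in> F \<rightarrow> carrier M"
  shows "component M k (\<Oplus>\<^bsub>M\<^esub>i\<in>F. f i) = (\<Oplus>\<^bsub>M\<^esub>i\<in>F. component M k (f i))"
  using assms by (induction F) (auto simp: component_add Pi_def)

lemma homogeneous_induct [consumes 1, case_names homogeneous add]:
  assumes x: "x \<in> carrier M"
    and hom: "\<And>k u. u \<in> mpart M k \<Longrightarrow> P u"
    and add: "\<And>u v. \<lbrakk>u \<in> carrier M; v \<in> carrier M; P u; P v\<rbrakk> \<Longrightarrow> P (u \<oplus>\<^bsub>M\<^esub> v)"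
  shows "P x"
proof -
  have "P (\<Oplus>\<^bsub>M\<^esub>k\<in>F. component M k x)" if "finite F" for F
    using that
  proof induction
    case empty
    then show ?case using hom[OF zero_in_part[of 0]] by simp
  next
    case (insert k F)
    then show ?case
      using x by (simp add: Pi_def) (intro add, auto intro: hom component_in_part)
  qed
  from this[OF finite_support_component[OF x]] show ?thesis by (simp add: sum_components[OF x])
qed

lemma finsum_in_part:
  assumes "\<And>i. i \<in> F \<Longrightarrow> f i \<in> mpart M k"
  shows "(\<Oplus>\<^bsub>M\<^esub>i\<in>F. f i) \<in> mpart M k"
  using assms
proof (induction F rule: infinite_finite_induct)
  case (infinite F)
  then show ?case using zero_in_part by simp
next
  case empty
  then show ?case using zero_in_part by simp
next
  case (insert i F)
  then have "f \<in> F \<rightarrow> carrier M" "f i \<in> carrier M" by (auto intro!: part_closed[of _ k])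
  then show ?case using insert add_in_part by simp
qed

lemma component_smult:
  assumes r: "r \<in> D i" and x: "x \<in> carrier M"
  shows "component M (i + k) (r \<odot>\<^bsub>M\<^esub> x) = r \<odot>\<^bsub>M\<^esub> component M k x"
  using x
proof (induction rule: homogeneous_induct)
  case (homogeneous j u)
  have "r \<in> carrier R" using r degree_parts by blast
  then show ?case
    using component_homogeneous[OF homogeneous, of k]
      component_homogeneous[OF smult_in_part[OF r homogeneous], of "i + k"]
    by simp
next
  case (add u v)
  have "r \<in> carrier R" using r degree_parts by blast
  with add show ?case by (simp add: smult_r_distr component_add)
qed

end

text \<open>The records that arise as quotients and tensor products are not known to be modules in advance.
  Group and module laws are equations, so they hold in any surjective image of a structure that
  satisfies them.\<close>

lemma image_abelian_group:
  assumes M: "abelian_group M" and surj: "\<psi> ` carrier M = carrier Q"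
    and add: "\<And>u v. \<lbrakk>u \<in> carrier M; v \<in> carrier M\<rbrakk> \<Longrightarrow> \<psi> (u \<oplus>\<^bsub>M\<^esub> v) = \<psi> u \<oplus>\<^bsub>Q\<^esub> \<psi> v"
    and zero: "\<psi> \<zero>\<^bsub>M\<^esub> = \<zero>\<^bsub>Q\<^esub>"
  shows "abelian_group Q"
proof -
  interpret M: abelian_group M by (rule M)
  have cl: "\<psi> u \<in> carrier Q" if "u \<in> carrier M" for u using that surj by blast
  have pre: "\<exists>u\<in>carrier M. x = \<psi> u" if "x \<in> carrier Q" for x using that surj by blast
  show ?thesis
  proof (rule abelian_groupI)
    fix x y z assume "x \<in> carrier Q" "y \<in> carrier Q" "z \<in> carrier Q"
    then obtain u v w where "u \<in> carrier M" "v \<in> carrier M" "w \<in> carrier M"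
      "x = \<psi> u" "y = \<psi> v" "z = \<psi> w" using pre by meson
    then show "x \<oplus>\<^bsub>Q\<^esub> y \<oplus>\<^bsub>Q\<^esub> z = x \<oplus>\<^bsub>Q\<^esub> (y \<oplus>\<^bsub>Q\<^esub> z)"
      by (simp add: add[symmetric] M.a_assoc)
  next
    fix x y assume "x \<in> carrier Q" "y \<in> carrier Q"
    then obtain u v where *: "u \<in> carrier M" "v \<in> carrier M" "x = \<psi> u" "y = \<psi> v"
      using pre by meson
    show "x \<oplus>\<^bsub>Q\<^esub> y \<in> carrier Q" using * cl[of "u \<oplus>\<^bsub>M\<^esub> v"] by (simp add: add)
    show "x \<oplus>\<^bsub>Q\<^esub> y = y \<oplus>\<^bsub>Q\<^esub> x" using * by (simp add: add[symmetric] M.a_comm)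
  next
    show "\<zero>\<^bsub>Q\<^esub> \<in> carrier Q" using cl[of "\<zero>\<^bsub>M\<^esub>"] zero by simp
  next
    fix x assume "x \<in> carrier Q"
    then obtain u where *: "u \<in> carrier M" "x = \<psi> u" using pre by meson
    show "\<zero>\<^bsub>Q\<^esub> \<oplus>\<^bsub>Q\<^esub> x = x" using * add[of "\<zero>\<^bsub>M\<^esub>" u] zero by simp
    show "\<exists>y\<in>carrier Q. y \<oplus>\<^bsub>Q\<^esub> x = \<zero>\<^bsub>Q\<^esub>"
      using * add[of "\<ominus>\<^bsub>M\<^esub> u" u] zero cl by (intro bexI[of _ "\<psi> (\<ominus>\<^bsub>M\<^esub> u)"]) (auto simp: M.l_neg)
  qed
qed

text \<open>A quotient by a homogeneous submodule inherits the grading: a decomposition in the image lifts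
  degree by degree, and two lifts of an element differ by a kernel element, whose components are
  again in the kernel. The ring may change along \<open>\<sigma>\<close>, so that an $\mathbb{R}[T]$-module can be obtained from
  a module over the symmetric algebra.\<close>

lemma (in graded_mod) graded_module_image:
  fixes Q :: "('c, 'n, 'y) gmodule_scheme"
  assumes R': "cring R'" and \<sigma>: "\<sigma> \<in> ring_hom R' R" and \<sigma>D: "\<And>i a. a \<in> D' i \<Longrightarrow> \<sigma> a \<in> D i"
    and surj: "\<psi> ` carrier M = carrier Q"
    and add: "\<And>u v. \<lbrakk>u \<in> carrier M; v \<in> carrier M\<rbrakk> \<Longrightarrow> \<psi> (u \<oplus>\<^bsub>M\<^esub> v) = \<psi> u \<oplus>\<^bsub>Q\<^esub> \<psi> v"
    and zero: "\<psi> \<zero>\<^bsub>M\<^esub> = \<zero>\<^bsub>Q\<^esub>"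
    and smult: "\<And>a u. \<lbrakk>a \<in> carrier R'; u \<in> carrier M\<rbrakk> \<Longrightarrow> \<psi> (\<sigma> a \<odot>\<^bsub>M\<^esub> u) = a \<odot>\<^bsub>Q\<^esub> \<psi> u"
    and D': "\<And>i. D' i \<subseteq> carrier R'"
    and parts: "\<And>k. mpart Q k = \<psi> ` mpart M k"
    and ker: "\<And>u k. \<lbrakk>u \<in> carrier M; \<psi> u = \<zero>\<^bsub>Q\<^esub>\<rbrakk> \<Longrightarrow> \<psi> (component M k u) = \<zero>\<^bsub>Q\<^esub>"
  shows "graded_module R' D' Q"
proof -
  interpret R': cring R' by (rule R')
  interpret Q: abelian_group Q
    by (rule image_abelian_group[OF M.abelian_group_axioms surj add zero])
  have cl: "\<psi> u \<in> carrier Q" if "u \<in> carrier M" for u using that surj by blast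
  have pre: "\<exists>u\<in>carrier M. x = \<psi> u" if "x \<in> carrier Q" for x using that surj by blast
  have \<sigma>C: "\<sigma> a \<in> carrier R" if "a \<in> carrier R'" for a using ring_hom_closed[OF \<sigma> that] .
  have neg: "\<psi> (\<ominus>\<^bsub>M\<^esub> u) = \<ominus>\<^bsub>Q\<^esub> \<psi> u" if "u \<in> carrier M" for u
    using that add[of "\<ominus>\<^bsub>M\<^esub> u" u] zero cl by (auto simp: M.l_neg Q.minus_equality)
  have sum: "\<psi> (\<Oplus>\<^bsub>M\<^esub>i\<in>F. f i) = (\<Oplus>\<^bsub>Q\<^esub>i\<in>F. \<psi> (f i))"
    if "finite F" "f \<in> F \<rightarrow> carrier M" for F and f :: "int \<Rightarrow> 'm"
    using that by (induction F) (auto simp: zero add Pi_def cl)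
  have "module R' Q"
  proof (rule moduleI[OF R' Q.abelian_group_axioms])
    fix a b x y assume a: "a \<in> carrier R'" and b: "b \<in> carrier R'"
      and "x \<in> carrier Q" "y \<in> carrier Q"
    then obtain u v where u: "u \<in> carrier M" "x = \<psi> u" and v: "v \<in> carrier M" "y = \<psi> v"
      using pre by meson
    show "a \<odot>\<^bsub>Q\<^esub> x \<in> carrier Q"
      using a u cl[of "\<sigma> a \<odot>\<^bsub>M\<^esub> u"] by (simp add: smult \<sigma>C)
    show "(a \<oplus>\<^bsub>R'\<^esub> b) \<odot>\<^bsub>Q\<^esub> x = a \<odot>\<^bsub>Q\<^esub> x \<oplus>\<^bsub>Q\<^esub> b \<odot>\<^bsub>Q\<^esub> x"
      using a b u
      by (simp add: smult[symmetric] ring_hom_add[OF \<sigma>] \<sigma>C add[symmetric] smult_l_distr)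
    show "a \<odot>\<^bsub>Q\<^esub> (x \<oplus>\<^bsub>Q\<^esub> y) = a \<odot>\<^bsub>Q\<^esub> x \<oplus>\<^bsub>Q\<^esub> a \<odot>\<^bsub>Q\<^esub> y"
      using a u v by (simp add: smult[symmetric] \<sigma>C add[symmetric] smult_r_distr)
    show "(a \<otimes>\<^bsub>R'\<^esub> b) \<odot>\<^bsub>Q\<^esub> x = a \<odot>\<^bsub>Q\<^esub> (b \<odot>\<^bsub>Q\<^esub> x)"
      using a b u by (simp add: smult[symmetric] ring_hom_mult[OF \<sigma>] \<sigma>C smult_assoc1)
  next
    fix x assume "x \<in> carrier Q"
    then obtain u where "u \<in> carrier M" "x = \<psi> u" using pre by blast
    then show "\<one>\<^bsub>R'\<^esub> \<odot>\<^bsub>Q\<^esub> x = x"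
      by (simp add: smult[symmetric] ring_hom_one[OF \<sigma>])
  qed
  moreover have "additive_subgroup (mpart Q k) Q" for k
  proof (rule additive_subgroupI, rule group.subgroupI[OF Q.a_group])
    show "mpart Q k \<subseteq> carrier (add_monoid Q)" using cl part_closed parts by auto
    show "mpart Q k \<noteq> {}" using zero_in_part parts by blast
    fix a b assume "a \<in> mpart Q k" "b \<in> mpart Q k"
    then obtain u v where u: "u \<in> mpart M k" "a = \<psi> u" and v: "v \<in> mpart M k" "b = \<psi> v"
      using parts by auto
    show "inv\<^bsub>add_monoid Q\<^esub> a \<in> mpart Q k"
      using u neg_in_part[OF u(1)] neg[OF part_closed[OF u(1)]] parts by (metis a_inv_def image_eqI)
    show "a \<otimes>\<^bsub>add_monoid Q\<^esub> b \<in> mpart Q k"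
      using u v add_in_part[OF u(1) v(1)] add[OF part_closed[OF u(1)] part_closed[OF v(1)]] parts
        image_eqI[of "\<psi> (u \<oplus>\<^bsub>M\<^esub> v)" \<psi> "u \<oplus>\<^bsub>M\<^esub> v" "mpart M k"]
      by simp
  qed
  moreover have "a \<odot>\<^bsub>Q\<^esub> x \<in> mpart Q (i + j)" if a: "a \<in> D' i" and x: "x \<in> mpart Q j" for a x i j
  proof -
    obtain u where u: "u \<in> mpart M j" "x = \<psi> u" using x parts by auto
    have "\<psi> (\<sigma> a \<odot>\<^bsub>M\<^esub> u) = a \<odot>\<^bsub>Q\<^esub> x" using u a D' smult part_closed by blast
    then show ?thesis using smult_in_part[OF \<sigma>D[OF a] u(1)] parts by (metis image_eqI)
  qed
  moreover have "\<exists>!f. (\<forall>k. f k \<in> mpart Q k) \<and> finite {k. f k \<noteq> \<zero>\<^bsub>Q\<^esub>} \<and>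
        x = (\<Oplus>\<^bsub>Q\<^esub>k\<in>{k. f k \<noteq> \<zero>\<^bsub>Q\<^esub>}. f k)" if x: "x \<in> carrier Q" for x
  proof -
    obtain u where u: "u \<in> carrier M" "x = \<psi> u" using pre x by blast
    let ?g = "\<lambda>k. \<psi> (component M k u)"
    let ?A = "{k. component M k u \<noteq> \<zero>\<^bsub>M\<^esub>}"
    show ?thesis
    proof (rule ex1I[of _ ?g], intro conjI allI)
      show "?g k \<in> mpart Q k" for k using u component_in_part parts by blast
      have sub: "{k. ?g k \<noteq> \<zero>\<^bsub>Q\<^esub>} \<subseteq> ?A" using zero by auto
      have fin: "finite ?A" using u finite_support_component by blast
      show "finite {k. ?g k \<noteq> \<zero>\<^bsub>Q\<^esub>}" using finite_subset[OF sub fin] .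
      have "x = (\<Oplus>\<^bsub>Q\<^esub>k\<in>?A. ?g k)"
        using u sum_components[OF u(1)] sum[OF fin, of "\<lambda>k. component M k u"] by auto
      also have "\<dots> = (\<Oplus>\<^bsub>Q\<^esub>k\<in>{k. ?g k \<noteq> \<zero>\<^bsub>Q\<^esub>}. ?g k)"
        using sub fin u cl by (intro Q.add.finprod_mono_neutral_cong_right) auto
      finally show "x = (\<Oplus>\<^bsub>Q\<^esub>k\<in>{k. ?g k \<noteq> \<zero>\<^bsub>Q\<^esub>}. ?g k)" .
    next
      fix f assume f: "(\<forall>k. f k \<in> mpart Q k) \<and> finite {k. f k \<noteq> \<zero>\<^bsub>Q\<^esub>} \<and>
        x = (\<Oplus>\<^bsub>Q\<^esub>k\<in>{k. f k \<noteq> \<zero>\<^bsub>Q\<^esub>}. f k)"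
      let ?B = "{k. f k \<noteq> \<zero>\<^bsub>Q\<^esub>}"
      have "\<exists>v\<in>mpart M k. f k = \<psi> v \<and> (f k = \<zero>\<^bsub>Q\<^esub> \<longrightarrow> v = \<zero>\<^bsub>M\<^esub>)" for k
        using f parts zero zero_in_part by (cases "f k = \<zero>\<^bsub>Q\<^esub>") (metis, blast)
      then obtain v where v: "\<And>k. v k \<in> mpart M k" "\<And>k. f k = \<psi> (v k)"
        "\<And>k. f k = \<zero>\<^bsub>Q\<^esub> \<Longrightarrow> v k = \<zero>\<^bsub>M\<^esub>" by metis
      have vC: "v k \<in> carrier M" for k using v part_closed by blast
      define w where "w = (\<Oplus>\<^bsub>M\<^esub>k\<in>?B. v k)"
      have wC: "w \<in> carrier M" unfolding w_def using vC by simp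
      have comp_w: "component M k w = v k" for k
        by (rule component_unique[where A = ?B]) (use f v in \<open>auto simp: w_def\<close>)
      have "\<psi> w = x" unfolding w_def using f sum[of ?B v] vC v(2) by auto
      then have "\<psi> (u \<ominus>\<^bsub>M\<^esub> w) = \<zero>\<^bsub>Q\<^esub>"
        using u wC x by (simp add: a_minus_def add neg Q.r_neg)
      then have 0: "\<psi> (component M k (u \<ominus>\<^bsub>M\<^esub> w)) = \<zero>\<^bsub>Q\<^esub>" for k
        by (rule ker[OF M.minus_closed[OF u(1) wC]])
      have "?g k = f k" for k
      proof (rule Q.eq_if_diff_zero)
        show "?g k \<in> carrier Q" "f k \<in> carrier Q" unfolding v(2) using u vC by (auto intro: cl)
        have "?g k \<ominus>\<^bsub>Q\<^esub> f k = \<psi> (component M k u \<ominus>\<^bsub>M\<^esub> v k)"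
          unfolding v(2) using component_closed[OF u(1)] vC by (simp add: a_minus_def add neg)
        also have "\<dots> = \<psi> (component M k (u \<ominus>\<^bsub>M\<^esub> w))"
          by (simp only: component_diff[OF u(1) wC] comp_w)
        finally show "?g k \<ominus>\<^bsub>Q\<^esub> f k = \<zero>\<^bsub>Q\<^esub>" using 0 by simp
      qed
      then show "f = ?g" by auto
    qed
  qed
  ultimately show ?thesis unfolding graded_module_def by blast
qed

section \<open>Polynomials in T and string modules\<close>

lemma RT_sel [simp]:
  "carrier RT = UNIV" "x \<otimes>\<^bsub>RT\<^esub> y = x * y" "\<one>\<^bsub>RT\<^esub> = 1" "\<zero>\<^bsub>RT\<^esub> = 0" "x \<oplus>\<^bsub>RT\<^esub> y = x + y"
  by (simp_all add: RT_def)

lemma cring_RT: "cring RT"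
proof (rule cringI)
  show "abelian_group RT"
  proof (rule abelian_groupI)
    show "\<exists>y\<in>carrier RT. y \<oplus>\<^bsub>RT\<^esub> x = \<zero>\<^bsub>RT\<^esub>" for x by (auto intro: exI[of _ "- x"])
  qed auto
  show "Group.comm_monoid RT" by (rule comm_monoidI) (auto simp: algebra_simps)
qed (auto simp: algebra_simps)

lemma rpart_RT: "p \<in> rpart RT k \<longleftrightarrow> (\<forall>i. Polynomial.coeff p i \<noteq> 0 \<longrightarrow> 2 * int i = k)"
  by (simp add: RT_def)

lemma T_pow_mult: "T_pow m * T_pow n = T_pow (m + n)"
  by (simp add: T_pow_def mult_monom)

lemma T_pow_0 [simp]: "T_pow 0 = 1"
  by (simp add: T_pow_def)

lemma coeff_T_pow_mult: "Polynomial.coeff (T_pow m * p) k = (if k < m then 0 else Polynomial.coeff p (k - m))"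
  by (simp add: T_pow_def coeff_monom_mult)

lemma T_pow_dvd_iff: "T_pow n dvd p \<longleftrightarrow> (\<forall>k<n. Polynomial.coeff p k = 0)"
  by (simp add: T_pow_def monom_1_dvd_iff')

lemma T_pow_in_rpart: "T_pow m \<in> rpart RT (2 * int m)"
  by (simp add: rpart_RT T_pow_def)

lemma const_in_rpart: "[:c:] \<in> rpart RT 0"
  by (simp add: rpart_RT coeff_pCons split: nat.splits)

lemma zero_in_rpart: "0 \<in> rpart RT k"
  by (simp add: rpart_RT)

lemma add_in_rpart: "p \<in> rpart RT k \<Longrightarrow> q \<in> rpart RT k \<Longrightarrow> p + q \<in> rpart RT k"
  unfolding rpart_RT by (metis add.right_neutral coeff_add)

lemma diff_in_rpart: "p \<in> rpart RT k \<Longrightarrow> q \<in> rpart RT k \<Longrightarrow> p - q \<in> rpart RT k"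
  unfolding rpart_RT by (metis diff_self coeff_diff)

lemma T_pow_mult_in_rpart:
  assumes "p \<in> rpart RT k"
  shows "T_pow m * p \<in> rpart RT (2 * int m + k)"
  unfolding rpart_RT
proof (intro allI impI)
  fix i assume *: "Polynomial.coeff (T_pow m * p) i \<noteq> 0"
  then have "m \<le> i" "Polynomial.coeff p (i - m) \<noteq> 0" by (auto simp: coeff_T_pow_mult split: if_splits)
  then have "2 * int (i - m) = k" using assms unfolding rpart_RT by blast
  then show "2 * int i = 2 * int m + k" using \<open>m \<le> i\<close> by simp
qed

text \<open>Every non-zero ideal of $\mathbb{R}[T]/T^{n+1}$ contains the socle, which is spanned by $T^n$: if
  $T^j$ is the lowest power in $p$, then multiplying $p$ by a multiple of $T^{n-j}$ leaves only $T^n$.\<close>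

lemma multiple_eq_T_pow_mod:
  assumes "\<not> T_pow (Suc n) dvd p"
  shows "\<exists>r s. T_pow n = r * p + T_pow (Suc n) * s"
proof -
  define j where "j = (LEAST k. Polynomial.coeff p k \<noteq> 0)"
  obtain k where k: "k < Suc n" "Polynomial.coeff p k \<noteq> 0" using assms by (auto simp: T_pow_dvd_iff)
  have c: "Polynomial.coeff p j \<noteq> 0" unfolding j_def by (rule LeastI) (rule k(2))
  have "j \<le> k" unfolding j_def by (rule Least_le) (rule k(2))
  then have jn: "j \<le> n" using k by simp
  have below: "Polynomial.coeff p i = 0" if "i < j" for i using not_less_Least[of i "\<lambda>k. Polynomial.coeff p k \<noteq> 0"] that
    by (auto simp: j_def)
  let ?r = "Polynomial.smult (1 / Polynomial.coeff p j) (T_pow (n - j))"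
  have "T_pow (Suc n) dvd T_pow n - ?r * p"
    unfolding T_pow_dvd_iff
  proof (intro allI impI)
    fix i assume i: "i < Suc n"
    show "Polynomial.coeff (T_pow n - ?r * p) i = 0"
    proof (cases "i = n")
      case True
      then show ?thesis using c jn by (simp add: coeff_T_pow_mult, simp add: T_pow_def)
    next
      case False
      then show ?thesis using i jn below[of "i - (n - j)"]
        by (simp add: coeff_T_pow_mult, simp add: T_pow_def)
    qed
  qed
  then obtain s where "T_pow n - ?r * p = T_pow (Suc n) * s" by (rule dvdE)
  then show ?thesis by (metis add.commute diff_add_cancel)
qed

text \<open>The class of $p$ in $\mathbb{R}[T]/T^{n+1}$; the coset notation of the quotient construction is
  replaced by divisibility.\<close>

definition string_class :: "nat \<Rightarrow> real poly \<Rightarrow> real poly set" where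
  "string_class n p = {x. T_pow (Suc n) dvd x - p}"

lemma regular_RT_sel [simp]:
  "carrier (regular_module RT) = UNIV" "x \<oplus>\<^bsub>regular_module RT\<^esub> y = x + y"
  "r \<odot>\<^bsub>regular_module RT\<^esub> x = r * x" "mpart (regular_module RT) = rpart RT"
  by (auto simp: regular_module_def RT_def)

lemma coset_eq_string_class:
  "smult_image (T_pow (n + 1)) (regular_module RT) +>\<^bsub>regular_module RT\<^esub> p = string_class n p"
proof -
  have "(\<exists>q. x = T_pow (Suc n) * q + p) \<longleftrightarrow> T_pow (Suc n) dvd x - p" for x
    by (metis add_diff_cancel diff_add_cancel dvd_def)
  then show ?thesis
    by (auto simp: a_r_coset_def' smult_image_def string_class_def)
qed

lemma string_class_eq_iff: "string_class n p = string_class n q \<longleftrightarrow> T_pow (Suc n) dvd p - q"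
proof
  assume "string_class n p = string_class n q"
  then have "p \<in> string_class n q" by (auto simp: string_class_def)
  then show "T_pow (Suc n) dvd p - q" by (simp add: string_class_def)
next
  assume pq: "T_pow (Suc n) dvd p - q"
  have "T_pow (Suc n) dvd x - p \<longleftrightarrow> T_pow (Suc n) dvd x - q" for x
    using dvd_add_left_iff[OF pq, of "x - p"] by simp
  then show "string_class n p = string_class n q" by (auto simp: string_class_def)
qed

lemma string_class_add:
  "string_class n p <+>\<^bsub>regular_module RT\<^esub> string_class n q = string_class n (p + q)"
proof -
  have "(\<exists>a b. T_pow (Suc n) dvd a - p \<and> T_pow (Suc n) dvd b - q \<and> x = a + b) \<longleftrightarrow>
      T_pow (Suc n) dvd x - (p + q)" for x
  proof
    assume "\<exists>a b. T_pow (Suc n) dvd a - p \<and> T_pow (Suc n) dvd b - q \<and> x = a + b"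
    then obtain a b where "T_pow (Suc n) dvd a - p" "T_pow (Suc n) dvd b - q" "x = a + b" by blast
    then have "T_pow (Suc n) dvd (a - p) + (b - q)" by (intro dvd_add)
    then show "T_pow (Suc n) dvd x - (p + q)" using \<open>x = a + b\<close> by (simp add: algebra_simps)
  next
    assume "T_pow (Suc n) dvd x - (p + q)"
    then show "\<exists>a b. T_pow (Suc n) dvd a - p \<and> T_pow (Suc n) dvd b - q \<and> x = a + b"
      by (intro exI[of _ "x - q"] exI[of _ q]) (simp add: algebra_simps)
  qed
  then show ?thesis by (auto simp: set_add_def' string_class_def)
qed

lemma string_module_sel:
  "carrier (string_module d n) = range (string_class n)"
  "\<zero>\<^bsub>string_module d n\<^esub> = string_class n 0"
  "string_class n p \<oplus>\<^bsub>string_module d n\<^esub> string_class n q = string_class n (p + q)"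
  "r \<odot>\<^bsub>string_module d n\<^esub> string_class n p = string_class n (r * p)"
  "mpart (string_module d n) k = string_class n ` rpart RT (k - d + int n)"
proof -
  let ?N = "smult_image (T_pow (n + 1)) (regular_module RT)"
  note c = coset_eq_string_class[of n]
  show "carrier (string_module d n) = range (string_class n)"
    using c by (auto simp: string_module_def shift_def graded_quot_def A_RCOSETS_def')
  have "?N = string_class n 0"
    by (auto simp: smult_image_def string_class_def dvd_def)
  then show "\<zero>\<^bsub>string_module d n\<^esub> = string_class n 0"
    by (simp add: string_module_def shift_def graded_quot_def)
  show "string_class n p \<oplus>\<^bsub>string_module d n\<^esub> string_class n q = string_class n (p + q)"
    by (simp add: string_module_def shift_def graded_quot_def string_class_add)
  have "string_class n (r * x) = string_class n (r * p)" if "x \<in> string_class n p" for x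
    using that unfolding string_class_eq_iff
    by (simp add: string_class_def right_diff_distrib[symmetric])
  moreover have "p \<in> string_class n p" by (simp add: string_class_def)
  ultimately have "(\<Union>x\<in>string_class n p. string_class n (r * x)) = string_class n (r * p)" by blast
  then show "r \<odot>\<^bsub>string_module d n\<^esub> string_class n p = string_class n (r * p)"
    using c by (simp add: string_module_def shift_def graded_quot_def)
  show "mpart (string_module d n) k = string_class n ` rpart RT (k - d + int n)"
    using c by (simp add: string_module_def shift_def graded_quot_def algebra_simps)
qed

text \<open>A monomial of degree $n+m$ either is divisible by $T^m$, or it is $T^k$ with $k < m$; the latter
  forces $2k = n + m$ and hence $k > n$, so that it vanishes modulo $T^{n+1}$.\<close>

lemma exists_T_pow_quotient_mod:
  assumes q: "q \<in> rpart RT (int n + int m)"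
  shows "\<exists>p \<in> rpart RT (int n - int m). T_pow (Suc n) dvd T_pow m * p - q"
proof (cases "\<exists>i::nat. 2 * int i = int n - int m")
  case True
  then obtain i where i: "2 * int i = int n - int m" by blast
  let ?p = "Polynomial.monom (Polynomial.coeff q (i + m)) i"
  have "Polynomial.coeff (T_pow m * ?p) k = Polynomial.coeff q k" for k
  proof (cases "k = i + m")
    case False
    then have "Polynomial.coeff q k = 0" using q i by (auto simp: rpart_RT)
    then show ?thesis using False by (auto simp: coeff_T_pow_mult)
  qed (simp add: coeff_T_pow_mult)
  then have "T_pow m * ?p = q" by (rule poly_eqI)
  moreover have "?p \<in> rpart RT (int n - int m)" using i by (simp add: rpart_RT)
  ultimately show ?thesis by force
next
  case False
  have "T_pow (Suc n) dvd q"
    unfolding T_pow_dvd_iff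
  proof (intro allI impI, rule ccontr)
    fix k assume k: "k < Suc n" "Polynomial.coeff q k \<noteq> 0"
    then have "2 * int k = int n + int m" using q by (simp add: rpart_RT)
    then have "2 * int (k - m) = int n - int m" using k(1) by linarith
    then show False using False by blast
  qed
  then show ?thesis by (intro bexI[of _ 0]) (auto simp: zero_in_rpart)
qed

text \<open>The string lives in the degrees $d-n, d-n+2, \dots, d+n$, one dimension in each, symmetrically about
  $d$; multiplication by $T$ moves each basis vector to the next.\<close>

lemma string_module_lefschetz:
  "bij_betw (\<lambda>u. T_pow m \<odot>\<^bsub>string_module d n\<^esub> u)
     (mpart (string_module d n) (d - int m)) (mpart (string_module d n) (d + int m))"
  unfolding bij_betw_def
proof
  let ?S = "string_module d n"
  have parts: "mpart ?S (d - int m) = string_class n ` rpart RT (int n - int m)"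
    "mpart ?S (d + int m) = string_class n ` rpart RT (int n + int m)"
    by (simp_all add: string_module_sel algebra_simps)
  show "inj_on (\<lambda>u. T_pow m \<odot>\<^bsub>?S\<^esub> u) (mpart ?S (d - int m))"
  proof (rule inj_onI)
    fix x y assume xy: "x \<in> mpart ?S (d - int m)" "y \<in> mpart ?S (d - int m)"
      and eq: "T_pow m \<odot>\<^bsub>?S\<^esub> x = T_pow m \<odot>\<^bsub>?S\<^esub> y"
    from xy obtain p q where p: "x = string_class n p" "p \<in> rpart RT (int n - int m)"
      and q: "y = string_class n q" "q \<in> rpart RT (int n - int m)"
      unfolding parts by blast
    let ?r = "p - q"
    have r: "?r \<in> rpart RT (int n - int m)" using p q by (simp add: diff_in_rpart)
    have dvd: "T_pow (Suc n) dvd T_pow m * ?r"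
      using eq unfolding p q string_module_sel string_class_eq_iff by (simp add: right_diff_distrib)
    have "T_pow (Suc n) dvd ?r"
      unfolding T_pow_dvd_iff
    proof (intro allI impI, rule ccontr)
      fix i assume i: "i < Suc n" "Polynomial.coeff ?r i \<noteq> 0"
      then have "2 * int i = int n - int m" using r by (simp add: rpart_RT del: coeff_diff)
      then have "i + m < Suc n" by linarith
      then have "Polynomial.coeff (T_pow m * ?r) (i + m) = 0" using dvd unfolding T_pow_dvd_iff by blast
      then show False using i(2) unfolding coeff_T_pow_mult by simp
    qed
    then show "x = y" unfolding p q string_class_eq_iff .
  qed
  show "(\<lambda>u. T_pow m \<odot>\<^bsub>?S\<^esub> u) ` mpart ?S (d - int m) = mpart ?S (d + int m)"
  proof (rule antisym; rule subsetI)
    fix y assume "y \<in> (\<lambda>u. T_pow m \<odot>\<^bsub>?S\<^esub> u) ` mpart ?S (d - int m)"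
    then obtain p where p: "y = string_class n (T_pow m * p)" "p \<in> rpart RT (int n - int m)"
      unfolding parts by (auto simp: string_module_sel)
    then show "y \<in> mpart ?S (d + int m)"
      using T_pow_mult_in_rpart[OF p(2), of m] unfolding parts p(1) by (simp add: add.commute)
  next
    fix y assume "y \<in> mpart ?S (d + int m)"
    then obtain q where q: "y = string_class n q" "q \<in> rpart RT (int n + int m)"
      unfolding parts by blast
    from exists_T_pow_quotient_mod[OF q(2)]
    obtain p where "p \<in> rpart RT (int n - int m)" "string_class n (T_pow m * p) = y"
      unfolding q(1) string_class_eq_iff by blast
    then show "y \<in> (\<lambda>u. T_pow m \<odot>\<^bsub>?S\<^esub> u) ` mpart ?S (d - int m)"
      unfolding parts by (auto simp: string_module_sel image_image intro!: image_eqI)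
  qed
qed

text \<open>A family of preimages has finite support because zero is the only preimage of zero.\<close>

lemma direct_sum_smult_bij:
  assumes bij: "\<And>i. i \<in> I \<Longrightarrow> bij_betw (\<lambda>u. r \<odot>\<^bsub>M i\<^esub> u) (mpart (M i) j) (mpart (M i) k)"
    and zero: "\<And>i. i \<in> I \<Longrightarrow> \<zero>\<^bsub>M i\<^esub> \<in> mpart (M i) j" "\<And>i. i \<in> I \<Longrightarrow> r \<odot>\<^bsub>M i\<^esub> \<zero>\<^bsub>M i\<^esub> = \<zero>\<^bsub>M i\<^esub>"
    and sub: "\<And>i l. i \<in> I \<Longrightarrow> mpart (M i) l \<subseteq> carrier (M i)"
  shows "bij_betw (\<lambda>u. r \<odot>\<^bsub>direct_sum I M\<^esub> u) (mpart (direct_sum I M) j) (mpart (direct_sum I M) k)"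
proof -
  have eq0: "r \<odot>\<^bsub>M i\<^esub> u = \<zero>\<^bsub>M i\<^esub> \<longleftrightarrow> u = \<zero>\<^bsub>M i\<^esub>" if "i \<in> I" "u \<in> mpart (M i) j" for i u
    using bij_betw_imp_inj_on[OF bij[OF that(1)]] zero[OF that(1)] that(2) by (metis inj_onD)
  have parts: "mpart (direct_sum I M) l =
      {f \<in> \<Pi>\<^sub>E i\<in>I. mpart (M i) l. finite {i \<in> I. f i \<noteq> \<zero>\<^bsub>M i\<^esub>}}" for l
    using sub by (auto simp: direct_sum_def Let_def PiE_iff subset_iff)
  have sm: "r \<odot>\<^bsub>direct_sum I M\<^esub> f = (\<lambda>i\<in>I. r \<odot>\<^bsub>M i\<^esub> f i)" for f
    by (simp add: direct_sum_def Let_def)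
  show ?thesis
    unfolding parts sm bij_betw_def
  proof
    show "inj_on (\<lambda>f. \<lambda>i\<in>I. r \<odot>\<^bsub>M i\<^esub> f i)
        {f \<in> \<Pi>\<^sub>E i\<in>I. mpart (M i) j. finite {i \<in> I. f i \<noteq> \<zero>\<^bsub>M i\<^esub>}}"
    proof (rule inj_onI, clarsimp)
      fix f g assume f: "f \<in> (\<Pi>\<^sub>E i\<in>I. mpart (M i) j)" and g: "g \<in> (\<Pi>\<^sub>E i\<in>I. mpart (M i) j)"
        and eq: "(\<lambda>i\<in>I. r \<odot>\<^bsub>M i\<^esub> f i) = (\<lambda>i\<in>I. r \<odot>\<^bsub>M i\<^esub> g i)"
      show "f = g"
      proof (rule PiE_ext[OF f g])
        fix i assume i: "i \<in> I"
        then show "f i = g i"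
          using fun_cong[OF eq, of i] bij_betw_imp_inj_on[OF bij[OF i]] f g
          by (auto dest: inj_onD)
      qed
    qed
    show "(\<lambda>f. \<lambda>i\<in>I. r \<odot>\<^bsub>M i\<^esub> f i) ` {f \<in> \<Pi>\<^sub>E i\<in>I. mpart (M i) j. finite {i \<in> I. f i \<noteq> \<zero>\<^bsub>M i\<^esub>}}
        = {f \<in> \<Pi>\<^sub>E i\<in>I. mpart (M i) k. finite {i \<in> I. f i \<noteq> \<zero>\<^bsub>M i\<^esub>}}" (is "?L = ?R")
    proof
      show "?L \<subseteq> ?R"
      proof
        fix g assume "g \<in> ?L"
        then obtain f where f: "f \<in> (\<Pi>\<^sub>E i\<in>I. mpart (M i) j)"
          and fin: "finite {i \<in> I. f i \<noteq> \<zero>\<^bsub>M i\<^esub>}" and g: "g = (\<lambda>i\<in>I. r \<odot>\<^bsub>M i\<^esub> f i)" by blast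
        have "{i \<in> I. g i \<noteq> \<zero>\<^bsub>M i\<^esub>} = {i \<in> I. f i \<noteq> \<zero>\<^bsub>M i\<^esub>}" using eq0 f by (auto simp: g)
        moreover have "r \<odot>\<^bsub>M i\<^esub> f i \<in> mpart (M i) k" if "i \<in> I" for i
          using bij_betw_imp_surj_on[OF bij[OF that]] f that by blast
        ultimately show "g \<in> ?R" using fin by (auto simp: g)
      qed
      show "?R \<subseteq> ?L"
      proof
        fix g assume "g \<in> ?R"
        then have g: "g \<in> (\<Pi>\<^sub>E i\<in>I. mpart (M i) k)" and fin: "finite {i \<in> I. g i \<noteq> \<zero>\<^bsub>M i\<^esub>}" by auto
        define f where "f = (\<lambda>i\<in>I. inv_into (mpart (M i) j) (\<lambda>u. r \<odot>\<^bsub>M i\<^esub> u) (g i))"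
        have fE: "f \<in> extensional I" by (simp add: f_def)
        have f: "f i \<in> mpart (M i) j" "r \<odot>\<^bsub>M i\<^esub> f i = g i" if i: "i \<in> I" for i
        proof -
          have "g i \<in> (\<lambda>u. r \<odot>\<^bsub>M i\<^esub> u) ` mpart (M i) j"
            using bij_betw_imp_surj_on[OF bij[OF i]] g i by auto
          then show "f i \<in> mpart (M i) j" "r \<odot>\<^bsub>M i\<^esub> f i = g i"
            using i by (auto simp: f_def inv_into_into f_inv_into_f)
        qed
        have "f i = \<zero>\<^bsub>M i\<^esub> \<longleftrightarrow> g i = \<zero>\<^bsub>M i\<^esub>" if "i \<in> I" for i
          using eq0[OF that f(1)[OF that]] f(2)[OF that] by simp
        then have "{i \<in> I. f i \<noteq> \<zero>\<^bsub>M i\<^esub>} = {i \<in> I. g i \<noteq> \<zero>\<^bsub>M i\<^esub>}" by blast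
        then have fin': "finite {i \<in> I. f i \<noteq> \<zero>\<^bsub>M i\<^esub>}" using fin by (rule ssubst)
        have "f \<in> (\<Pi>\<^sub>E i\<in>I. mpart (M i) j)" using f(1) fE unfolding PiE_iff by blast
        with fin' have "f \<in> {f \<in> \<Pi>\<^sub>E i\<in>I. mpart (M i) j. finite {i \<in> I. f i \<noteq> \<zero>\<^bsub>M i\<^esub>}}"
          by blast
        moreover have "g = (\<lambda>i\<in>I. r \<odot>\<^bsub>M i\<^esub> f i)"
          using PiE_arb[OF g] f(2) by (intro ext) (simp add: restrict_def)
        ultimately show "g \<in> ?L" by blast
      qed
    qed
  qed
qed

lemma sum_of_strings_lefschetz:
  fixes A :: "(real poly, 'e) gmodule"
  assumes A: "graded_module RT (rpart RT) A" and strings: "is_sum_of_strings d A"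
  shows "bij_betw (\<lambda>u. T_pow m \<odot>\<^bsub>A\<^esub> u) (mpart A (d - int m)) (mpart A (d + int m))"
proof -
  interpret graded_mod RT "rpart RT" A by (rule graded_modI[OF A]) simp
  obtain I :: "'e set" and n h where iso: "graded_hom RT A (direct_sum I (\<lambda>i. string_module d (n i))) h \<and>
      bij_betw h (carrier A) (carrier (direct_sum I (\<lambda>i. string_module d (n i)))) \<and>
      (\<forall>k. h ` mpart A k = mpart (direct_sum I (\<lambda>i. string_module d (n i))) k)"
    using strings unfolding is_sum_of_strings_def graded_iso_def by (elim exE)
  let ?N = "direct_sum I (\<lambda>i. string_module d (n i))"
  have hb: "bij_betw h (mpart A k) (mpart ?N k)" for k
    using iso part_closed by (auto simp: bij_betw_def intro: inj_on_subset)
  have T: "bij_betw (\<lambda>u. T_pow m \<odot>\<^bsub>?N\<^esub> u) (mpart ?N (d - int m)) (mpart ?N (d + int m))"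
    by (rule direct_sum_smult_bij[OF string_module_lefschetz])
      (auto simp: string_module_sel zero_in_rpart)
  have lin: "h (T_pow m \<odot>\<^bsub>A\<^esub> u) = T_pow m \<odot>\<^bsub>?N\<^esub> h u" if "u \<in> carrier A" for u
    using iso that by (simp add: graded_hom_def)
  have "bij_betw (h \<circ> (\<lambda>u. T_pow m \<odot>\<^bsub>A\<^esub> u)) (mpart A (d - int m)) (mpart ?N (d + int m))"
    using bij_betw_trans[OF hb T] by (rule bij_betw_cong[THEN iffD1, rotated]) (simp add: lin part_closed)
  moreover have "(\<lambda>u. T_pow m \<odot>\<^bsub>A\<^esub> u) ` mpart A (d - int m) \<subseteq> mpart A (d + int m)"
    using smult_in_part[OF T_pow_in_rpart[of m], of _ "d - int m"] by (auto simp: algebra_simps)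
  ultimately show ?thesis by (subst bij_betw_comp_iff2[OF hb])
qed

section \<open>Lefschetz modules are direct sums of strings\<close>

text \<open>Without a lower bound on the degrees the decomposition fails: on $\mathbb{R}[T,T^{-1}]$ all powers of
  $T$ are isomorphisms, but no non-zero element is annihilated by a power of $T$.\<close>

locale lefschetz_mod = graded_mod RT "rpart RT" A
  for A :: "(real poly, 'e) gmodule" +
  fixes d :: int
  assumes bounded_below: "k < 0 \<Longrightarrow> mpart A k \<subseteq> {\<zero>\<^bsub>A\<^esub>}"
    and lefschetz: "m \<ge> 1 \<Longrightarrow>
      bij_betw (\<lambda>u. T_pow m \<odot>\<^bsub>A\<^esub> u) (mpart A (d - int m)) (mpart A (d + int m))"
begin

lemma RT_smult:
  assumes "u \<in> carrier A"
  shows "p \<odot>\<^bsub>A\<^esub> u \<in> carrier A" "(p * q) \<odot>\<^bsub>A\<^esub> u = p \<odot>\<^bsub>A\<^esub> (q \<odot>\<^bsub>A\<^esub> u)"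
    "(p + q) \<odot>\<^bsub>A\<^esub> u = p \<odot>\<^bsub>A\<^esub> u \<oplus>\<^bsub>A\<^esub> q \<odot>\<^bsub>A\<^esub> u" "0 \<odot>\<^bsub>A\<^esub> u = \<zero>\<^bsub>A\<^esub>" "1 \<odot>\<^bsub>A\<^esub> u = u"
    "(- 1) \<odot>\<^bsub>A\<^esub> u = \<ominus>\<^bsub>A\<^esub> u" "p \<odot>\<^bsub>A\<^esub> \<zero>\<^bsub>A\<^esub> = \<zero>\<^bsub>A\<^esub>"
proof -
  show cl: "p \<odot>\<^bsub>A\<^esub> u \<in> carrier A" for p using assms smult_closed[of p u] by simp
  show "(p * q) \<odot>\<^bsub>A\<^esub> u = p \<odot>\<^bsub>A\<^esub> (q \<odot>\<^bsub>A\<^esub> u)" using assms smult_assoc1[of p q u] by simp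
  show add: "(p + q) \<odot>\<^bsub>A\<^esub> u = p \<odot>\<^bsub>A\<^esub> u \<oplus>\<^bsub>A\<^esub> q \<odot>\<^bsub>A\<^esub> u" for p q
    using assms smult_l_distr[of p q u] by simp
  show zero: "0 \<odot>\<^bsub>A\<^esub> u = \<zero>\<^bsub>A\<^esub>" using assms smult_l_null[of u] by simp
  show one: "1 \<odot>\<^bsub>A\<^esub> u = u" using assms smult_one[of u] by simp
  have "(- 1) \<odot>\<^bsub>A\<^esub> u \<oplus>\<^bsub>A\<^esub> u = \<zero>\<^bsub>A\<^esub>" using add[of "- 1" 1] zero one by simp
  then show "(- 1) \<odot>\<^bsub>A\<^esub> u = \<ominus>\<^bsub>A\<^esub> u" using assms cl by (simp add: M.minus_equality)
  show "p \<odot>\<^bsub>A\<^esub> \<zero>\<^bsub>A\<^esub> = \<zero>\<^bsub>A\<^esub>" using smult_r_null[of p] by simp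
qed

lemma T_pow_in_part: "u \<in> mpart A k \<Longrightarrow> T_pow m \<odot>\<^bsub>A\<^esub> u \<in> mpart A (k + 2 * int m)"
  using smult_in_part[OF T_pow_in_rpart[of m], of u k] by (simp add: add.commute)

lemma T_pow_inject:
  assumes "u \<in> mpart A (d - int n)" "v \<in> mpart A (d - int n)"
    and "T_pow n \<odot>\<^bsub>A\<^esub> u = T_pow n \<odot>\<^bsub>A\<^esub> v"
  shows "u = v"
proof (cases n)
  case 0
  then show ?thesis using assms part_closed RT_smult(5) by simp
next
  case (Suc k)
  then have "inj_on (\<lambda>u. T_pow n \<odot>\<^bsub>A\<^esub> u) (mpart A (d - int n))"
    using lefschetz[of n] by (simp add: bij_betw_def)
  then show ?thesis using assms by (auto dest: inj_onD)
qed

text \<open>These are the elements that can be the lowest vector of a string of length $n+1$. They play the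
  role of the primitive classes in the Lefschetz decomposition.\<close>

definition primitive :: "nat \<Rightarrow> 'e set" where
  "primitive n = {u \<in> mpart A (d - int n). T_pow (Suc n) \<odot>\<^bsub>A\<^esub> u = \<zero>\<^bsub>A\<^esub>}"

definition primitives :: "'e set" where
  "primitives = (\<Union>n. primitive n) - {\<zero>\<^bsub>A\<^esub>}"

text \<open>For a non-zero primitive element this is the index of the string that it generates.\<close>

definition height :: "'e \<Rightarrow> nat" where
  "height u = (SOME n. u \<in> primitive n)"

lemma primitive_height: "u \<in> primitives \<Longrightarrow> u \<in> primitive (height u)"
  unfolding primitives_def height_def by (auto intro: someI)

lemma primitives_part: "u \<in> primitives \<Longrightarrow> u \<in> mpart A (d - int (height u))"
  using primitive_height by (auto simp: primitive_def)

lemma primitives_closed: "u \<in> primitives \<Longrightarrow> u \<in> carrier A"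
  using primitives_part part_closed by blast

lemma T_pow_dvd_annihilates:
  assumes u: "u \<in> primitive n" and "T_pow (Suc n) dvd p"
  shows "p \<odot>\<^bsub>A\<^esub> u = \<zero>\<^bsub>A\<^esub>"
proof -
  from assms(2) obtain q where "p = q * T_pow (Suc n)" by (metis dvdE mult.commute)
  moreover have "u \<in> carrier A" using u part_closed by (auto simp: primitive_def)
  ultimately show ?thesis using u by (simp add: primitive_def RT_smult)
qed

lemma T_pow_multiple_of_nonzero:
  assumes u: "u \<in> primitive n" and p: "\<not> T_pow (Suc n) dvd p"
  shows "\<exists>r. T_pow n \<odot>\<^bsub>A\<^esub> u = r \<odot>\<^bsub>A\<^esub> (p \<odot>\<^bsub>A\<^esub> u)"
proof -
  obtain r s where rs: "T_pow n = r * p + T_pow (Suc n) * s"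
    using multiple_eq_T_pow_mod[OF p] by blast
  have uC: "u \<in> carrier A" using u part_closed by (auto simp: primitive_def)
  have "T_pow n \<odot>\<^bsub>A\<^esub> u = (r * p) \<odot>\<^bsub>A\<^esub> u"
    using T_pow_dvd_annihilates[OF u, of "T_pow (Suc n) * s"] uC
    unfolding rs RT_smult(3)[OF uC] by (simp add: RT_smult(1)[OF uC])
  then show ?thesis using RT_smult(2)[OF uC] by auto
qed

text \<open>Primitivity bounds the annihilator from below, and injectivity of $T^n$ in degree $d-n$ bounds it
  from above, so the submodule generated by a non-zero primitive element is exactly a string.\<close>

lemma annihilator_of_primitive:
  assumes u: "u \<in> primitive n" "u \<noteq> \<zero>\<^bsub>A\<^esub>" and "p \<odot>\<^bsub>A\<^esub> u = \<zero>\<^bsub>A\<^esub>"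
  shows "T_pow (Suc n) dvd p"
proof (rule ccontr)
  assume "\<not> T_pow (Suc n) dvd p"
  then obtain r where "T_pow n \<odot>\<^bsub>A\<^esub> u = r \<odot>\<^bsub>A\<^esub> (p \<odot>\<^bsub>A\<^esub> u)"
    using T_pow_multiple_of_nonzero[OF u(1)] by blast
  then have "T_pow n \<odot>\<^bsub>A\<^esub> u = T_pow n \<odot>\<^bsub>A\<^esub> \<zero>\<^bsub>A\<^esub>"
    using assms(3) RT_smult(7)[OF M.zero_closed] by simp
  then have "u = \<zero>\<^bsub>A\<^esub>"
    using T_pow_inject[of u n "\<zero>\<^bsub>A\<^esub>"] u(1) zero_in_part by (simp add: primitive_def)
  then show False using u(2) by blast
qed

text \<open>Coefficients are polynomials, not real numbers, and they are total functions vanishing off a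
  finite subset of the index set, so that combinations over different supports can be added
  pointwise.\<close>

definition combination :: "'e set \<Rightarrow> 'e \<Rightarrow> ('e \<Rightarrow> real poly) \<Rightarrow> bool" where
  "combination I u p \<longleftrightarrow> (\<exists>F. finite F \<and> F \<subseteq> I \<and> (\<forall>i. i \<notin> F \<longrightarrow> p i = 0) \<and>
     u = (\<Oplus>\<^bsub>A\<^esub>i\<in>F. p i \<odot>\<^bsub>A\<^esub> i))"

definition span :: "'e set \<Rightarrow> 'e set" where
  "span I = {u. \<exists>p. combination I u p}"

text \<open>The sum of the cyclic submodules generated by the elements is direct. The elements are torsion, so
  the summands vanish rather than the coefficients.\<close>

definition independent :: "'e set \<Rightarrow> bool" where
  "independent I \<longleftrightarrow> I \<subseteq> primitives \<and>
     (\<forall>p. combination I \<zero>\<^bsub>A\<^esub> p \<longrightarrow> (\<forall>i\<in>I. p i \<odot>\<^bsub>A\<^esub> i = \<zero>\<^bsub>A\<^esub>))"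

lemma combination_eq_sum:
  assumes u: "combination I u p" and I: "I \<subseteq> primitives"
    and G: "finite G" "G \<subseteq> primitives" "\<And>i. i \<notin> G \<Longrightarrow> p i = 0"
  shows "u = (\<Oplus>\<^bsub>A\<^esub>i\<in>G. p i \<odot>\<^bsub>A\<^esub> i)"
proof -
  obtain F where F: "finite F" "F \<subseteq> I" "\<And>i. i \<notin> F \<Longrightarrow> p i = 0"
    and uF: "u = (\<Oplus>\<^bsub>A\<^esub>i\<in>F. p i \<odot>\<^bsub>A\<^esub> i)" using u unfolding combination_def by blast
  have cl: "i \<in> carrier A" if "i \<in> F \<union> G" for i using that F G I primitives_closed by blast
  have "(\<Oplus>\<^bsub>A\<^esub>i\<in>F. p i \<odot>\<^bsub>A\<^esub> i) = (\<Oplus>\<^bsub>A\<^esub>i\<in>G. p i \<odot>\<^bsub>A\<^esub> i)"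
    by (rule M.add.finprod_mono_neutral_cong) (use F G cl RT_smult in auto)
  then show ?thesis using uF by simp
qed

lemma combination_closed:
  assumes "combination I u p" "I \<subseteq> primitives"
  shows "u \<in> carrier A"
proof -
  obtain F where "F \<subseteq> I" "u = (\<Oplus>\<^bsub>A\<^esub>i\<in>F. p i \<odot>\<^bsub>A\<^esub> i)" using assms unfolding combination_def by blast
  moreover from this assms(2) have "i \<in> carrier A" if "i \<in> F" for i
    using that primitives_closed by blast
  ultimately show ?thesis by (auto intro!: M.finsum_closed RT_smult(1))
qed

lemma combination_add:
  assumes I: "I \<subseteq> primitives" and u: "combination I u p" and v: "combination I v q"
  shows "combination I (u \<oplus>\<^bsub>A\<^esub> v) (\<lambda>i. p i + q i)"
proof -
  obtain F where F: "finite F" "F \<subseteq> I" "\<And>i. i \<notin> F \<Longrightarrow> p i = 0" using u unfolding combination_def by blast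
  obtain G where G: "finite G" "G \<subseteq> I" "\<And>i. i \<notin> G \<Longrightarrow> q i = 0" using v unfolding combination_def by blast
  let ?H = "F \<union> G"
  have cl: "i \<in> carrier A" if "i \<in> ?H" for i using that F G I primitives_closed by blast
  have H: "finite ?H" "?H \<subseteq> primitives" using F G I by auto
  have "u = (\<Oplus>\<^bsub>A\<^esub>i\<in>?H. p i \<odot>\<^bsub>A\<^esub> i)" "v = (\<Oplus>\<^bsub>A\<^esub>i\<in>?H. q i \<odot>\<^bsub>A\<^esub> i)"
    using combination_eq_sum[OF u I H] combination_eq_sum[OF v I H] F G by auto
  then have "u \<oplus>\<^bsub>A\<^esub> v = (\<Oplus>\<^bsub>A\<^esub>i\<in>?H. p i \<odot>\<^bsub>A\<^esub> i \<oplus>\<^bsub>A\<^esub> q i \<odot>\<^bsub>A\<^esub> i)"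
    using M.finsum_addf[of "\<lambda>i. p i \<odot>\<^bsub>A\<^esub> i" ?H "\<lambda>i. q i \<odot>\<^bsub>A\<^esub> i"] cl RT_smult(1) by (simp add: Pi_def)
  also have "\<dots> = (\<Oplus>\<^bsub>A\<^esub>i\<in>?H. (p i + q i) \<odot>\<^bsub>A\<^esub> i)"
    using cl RT_smult by (intro M.finsum_cong') auto
  finally show ?thesis
    unfolding combination_def using F G by (intro exI[of _ ?H]) auto
qed

lemma combination_smult:
  assumes I: "I \<subseteq> primitives" and u: "combination I u p"
  shows "combination I (a \<odot>\<^bsub>A\<^esub> u) (\<lambda>i. a * p i)"
proof -
  obtain F where F: "finite F" "F \<subseteq> I" "\<And>i. i \<notin> F \<Longrightarrow> p i = 0"
    and uF: "u = (\<Oplus>\<^bsub>A\<^esub>i\<in>F. p i \<odot>\<^bsub>A\<^esub> i)" using u unfolding combination_def by blast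
  have cl: "i \<in> carrier A" if "i \<in> F" for i using that F I primitives_closed by blast
  have "a \<odot>\<^bsub>A\<^esub> u = (\<Oplus>\<^bsub>A\<^esub>i\<in>F. a \<odot>\<^bsub>A\<^esub> (p i \<odot>\<^bsub>A\<^esub> i))"
    unfolding uF using F cl RT_smult(1) by (intro finsum_smult_ldistr) auto
  also have "\<dots> = (\<Oplus>\<^bsub>A\<^esub>i\<in>F. (a * p i) \<odot>\<^bsub>A\<^esub> i)"
    using cl RT_smult by (intro M.finsum_cong') auto
  finally show ?thesis unfolding combination_def using F by (intro exI[of _ F]) auto
qed

lemma combination_single:
  assumes "i \<in> I" "I \<subseteq> primitives"
  shows "combination I (p \<odot>\<^bsub>A\<^esub> i) (\<lambda>j. if j = i then p else 0)"
  unfolding combination_def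
  using assms primitives_closed RT_smult(1) by (intro exI[of _ "{i}"]) auto

text \<open>The submodule generated by homogeneous elements is graded: taking components replaces each
  coefficient by one of its monomials.\<close>

lemma combination_component:
  assumes I: "I \<subseteq> primitives" and u: "combination I u p"
  shows "\<exists>q. combination I (component A k u) q \<and>
    (\<forall>i. q i \<in> rpart RT (k - (d - int (height i))))"
proof -
  have hom: "\<exists>q \<in> rpart RT j. component A (e + j) (p \<odot>\<^bsub>A\<^esub> v) = q \<odot>\<^bsub>A\<^esub> v"
    if v: "v \<in> mpart A e" for v e j p
  proof (induction p arbitrary: j)
    case 0
    then show ?case using part_closed[OF v] zero_in_rpart[of j] RT_smult(4)
      by (intro bexI[of _ 0]) auto
  next
    case (pCons a p)
    have vC: "v \<in> carrier A" using part_closed[OF v] .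
    have T: "T_pow 1 \<in> rpart RT 2" using T_pow_in_rpart[of 1] by simp
    have "[:a:] \<odot>\<^bsub>A\<^esub> v \<in> mpart A e" using smult_in_part[OF const_in_rpart v, of a] by simp
    note c = component_homogeneous[OF this, of "e + j"]
    have 1: "\<exists>q \<in> rpart RT j. component A (e + j) ([:a:] \<odot>\<^bsub>A\<^esub> v) = q \<odot>\<^bsub>A\<^esub> v"
    proof (cases "j = 0")
      case True
      then show ?thesis using c const_in_rpart[of a] by auto
    next
      case False
      then show ?thesis using c zero_in_rpart[of j] RT_smult(4)[OF vC] by (intro bexI[of _ 0]) auto
    qed
    obtain q where q: "q \<in> rpart RT (j - 2)" "component A (e + (j - 2)) (p \<odot>\<^bsub>A\<^esub> v) = q \<odot>\<^bsub>A\<^esub> v"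
      using pCons.IH by blast
    have "component A (e + j) (T_pow 1 \<odot>\<^bsub>A\<^esub> (p \<odot>\<^bsub>A\<^esub> v)) = T_pow 1 \<odot>\<^bsub>A\<^esub> (q \<odot>\<^bsub>A\<^esub> v)"
      using component_smult[OF T RT_smult(1)[OF vC], of "e + (j - 2)"] q(2)
      by (simp add: algebra_simps)
    then have 2: "component A (e + j) (T_pow 1 \<odot>\<^bsub>A\<^esub> (p \<odot>\<^bsub>A\<^esub> v)) = (T_pow 1 * q) \<odot>\<^bsub>A\<^esub> v"
      using RT_smult(2)[OF vC] by simp
    have 3: "T_pow 1 * q \<in> rpart RT j" using T_pow_mult_in_rpart[OF q(1), of 1] by simp
    have "pCons a p = [:a:] + T_pow 1 * p" by (simp add: T_pow_def monom_Suc)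
    then have "pCons a p \<odot>\<^bsub>A\<^esub> v = [:a:] \<odot>\<^bsub>A\<^esub> v \<oplus>\<^bsub>A\<^esub> T_pow 1 \<odot>\<^bsub>A\<^esub> (p \<odot>\<^bsub>A\<^esub> v)"
      using RT_smult(2,3)[OF vC] by metis
    then have "component A (e + j) (pCons a p \<odot>\<^bsub>A\<^esub> v) =
        component A (e + j) ([:a:] \<odot>\<^bsub>A\<^esub> v) \<oplus>\<^bsub>A\<^esub> component A (e + j) (T_pow 1 \<odot>\<^bsub>A\<^esub> (p \<odot>\<^bsub>A\<^esub> v))"
      using RT_smult(1) vC by (simp add: component_add)
    then show ?case using 1 2 3 add_in_rpart RT_smult(3)[OF vC] by metis
  qed
  obtain F where F: "finite F" "F \<subseteq> I" "\<And>i. i \<notin> F \<Longrightarrow> p i = 0"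
    and uF: "u = (\<Oplus>\<^bsub>A\<^esub>i\<in>F. p i \<odot>\<^bsub>A\<^esub> i)" using u unfolding combination_def by blast
  have FC: "i \<in> carrier A" if "i \<in> F" for i using that F I primitives_closed by blast
  have "\<exists>q \<in> rpart RT (k - (d - int (height i))).
      (i \<in> F \<longrightarrow> component A k (p i \<odot>\<^bsub>A\<^esub> i) = q \<odot>\<^bsub>A\<^esub> i) \<and> (i \<notin> F \<longrightarrow> q = 0)" for i
  proof (cases "i \<in> F")
    case True
    then have "i \<in> mpart A (d - int (height i))" using F I primitives_part by blast
    from hom[OF this, of "k - (d - int (height i))" "p i"] show ?thesis using True by simp
  qed (auto simp: zero_in_rpart)
  then obtain q where q: "\<And>i. q i \<in> rpart RT (k - (d - int (height i)))"
    "\<And>i. i \<in> F \<Longrightarrow> component A k (p i \<odot>\<^bsub>A\<^esub> i) = q i \<odot>\<^bsub>A\<^esub> i" "\<And>i. i \<notin> F \<Longrightarrow> q i = 0" by metis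
  have "component A k u = (\<Oplus>\<^bsub>A\<^esub>i\<in>F. component A k (p i \<odot>\<^bsub>A\<^esub> i))"
    unfolding uF using F FC RT_smult(1) by (intro component_finsum) auto
  also have "\<dots> = (\<Oplus>\<^bsub>A\<^esub>i\<in>F. q i \<odot>\<^bsub>A\<^esub> i)"
    using FC RT_smult q(2) by (intro M.finsum_cong') auto
  finally have "combination I (component A k u) q"
    unfolding combination_def using F q(3) by blast
  then show ?thesis using q(1) by blast
qed

lemma span_add: "I \<subseteq> primitives \<Longrightarrow> u \<in> span I \<Longrightarrow> v \<in> span I \<Longrightarrow> u \<oplus>\<^bsub>A\<^esub> v \<in> span I"
  unfolding span_def using combination_add by blast

lemma span_smult: "I \<subseteq> primitives \<Longrightarrow> u \<in> span I \<Longrightarrow> a \<odot>\<^bsub>A\<^esub> u \<in> span I"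
  unfolding span_def using combination_smult by blast

lemma span_superset: "I \<subseteq> primitives \<Longrightarrow> i \<in> I \<Longrightarrow> i \<in> span I"
  using combination_single[of i I 1] RT_smult(5)[OF primitives_closed, of i]
  unfolding span_def by (metis (no_types) mem_Collect_eq subsetD)

lemma zero_in_span: "\<zero>\<^bsub>A\<^esub> \<in> span I"
  unfolding span_def combination_def by (auto intro!: exI[of _ "\<lambda>_. 0"] exI[of _ "{}"])

text \<open>Zorn's lemma applies because a relation involves only finitely many elements, and so does not
  escape from the members of a chain.\<close>

lemma exists_maximal_independent:
  "\<exists>I. independent I \<and> (\<forall>J. independent J \<longrightarrow> I \<subseteq> J \<longrightarrow> J = I)"
proof -
  have "\<Union>C \<in> {I. independent I}" if C: "subset.chain {I. independent I} C" for C
  proof -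
    have sub: "\<Union>C \<subseteq> primitives" using C by (auto simp: subset_chain_def independent_def)
    have "p i \<odot>\<^bsub>A\<^esub> i = \<zero>\<^bsub>A\<^esub>" if p: "combination (\<Union>C) \<zero>\<^bsub>A\<^esub> p" and i: "i \<in> \<Union>C" for p i
    proof -
      obtain F where F: "finite F" "F \<subseteq> \<Union>C" "\<And>j. j \<notin> F \<Longrightarrow> p j = 0"
        "\<zero>\<^bsub>A\<^esub> = (\<Oplus>\<^bsub>A\<^esub>j\<in>F. p j \<odot>\<^bsub>A\<^esub> j)" using p unfolding combination_def by blast
      show ?thesis
      proof (cases "i \<in> F")
        case True
        then have "C \<noteq> {}" using F by blast
        then obtain B where B: "B \<in> C" "F \<subseteq> B"
          using finite_subset_Union_chain[OF F(1,2) _ C] by blast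
        then have "combination B \<zero>\<^bsub>A\<^esub> p" unfolding combination_def using F by blast
        moreover have "independent B" using B C by (auto simp: subset_chain_def)
        ultimately show ?thesis using True B unfolding independent_def by blast
      next
        case False
        then show ?thesis using F(3) i sub primitives_closed RT_smult(4) by auto
      qed
    qed
    then show ?thesis using sub unfolding independent_def by blast
  qed
  from subset_Zorn'[OF this] show ?thesis by blast
qed

text \<open>Write $T^n u$ as a homogeneous combination in degree $d+n$. Every string that reaches this degree
  starts in degree at most $d-n$, so its monomial there can be divided by $T^n$, and dividing gives
  a combination in degree $d-n$ which equals $u$ by injectivity of $T^n$.\<close>

lemma span_if_T_pow_in_span:
  assumes I: "I \<subseteq> primitives" and u: "u \<in> mpart A (d - int n)" and T: "T_pow n \<odot>\<^bsub>A\<^esub> u \<in> span I"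
  shows "u \<in> span I"
proof -
  obtain p where p: "combination I (T_pow n \<odot>\<^bsub>A\<^esub> u) p" using T unfolding span_def by blast
  have Tu: "T_pow n \<odot>\<^bsub>A\<^esub> u \<in> mpart A (d + int n)" using T_pow_in_part[OF u, of n] by (simp add: add.commute)
  obtain q where q: "combination I (T_pow n \<odot>\<^bsub>A\<^esub> u) q"
    and q': "\<And>i. q i \<in> rpart RT (d + int n - (d - int (height i)))"
    using combination_component[OF I p, of "d + int n"] component_homogeneous[OF Tu, of "d + int n"] by auto
  obtain F where F: "finite F" "F \<subseteq> I" "\<And>i. i \<notin> F \<Longrightarrow> q i = 0"
    and Fq: "T_pow n \<odot>\<^bsub>A\<^esub> u = (\<Oplus>\<^bsub>A\<^esub>i\<in>F. q i \<odot>\<^bsub>A\<^esub> i)" using q unfolding combination_def by blast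
  have FC: "i \<in> carrier A" if "i \<in> F" for i using that F I primitives_closed by blast
  have "q i \<in> rpart RT (int (height i) + int n)" for i using q'[of i] by (simp add: add.commute)
  then have "\<forall>i. \<exists>r \<in> rpart RT (int (height i) - int n). T_pow (Suc (height i)) dvd T_pow n * r - q i"
    using exists_T_pow_quotient_mod by blast
  then obtain r where r: "\<And>i. r i \<in> rpart RT (int (height i) - int n)"
    "\<And>i. T_pow (Suc (height i)) dvd T_pow n * r i - q i" by metis
  have eq: "T_pow n \<odot>\<^bsub>A\<^esub> (r i \<odot>\<^bsub>A\<^esub> i) = q i \<odot>\<^bsub>A\<^esub> i" if i: "i \<in> F" for i
  proof -
    have "(T_pow n * r i - q i) \<odot>\<^bsub>A\<^esub> i = \<zero>\<^bsub>A\<^esub>"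
      using T_pow_dvd_annihilates[OF primitive_height r(2)] i F I by blast
    moreover have "(T_pow n * r i) \<odot>\<^bsub>A\<^esub> i = (T_pow n * r i - q i) \<odot>\<^bsub>A\<^esub> i \<oplus>\<^bsub>A\<^esub> q i \<odot>\<^bsub>A\<^esub> i"
      using RT_smult(3)[OF FC[OF i], of "T_pow n * r i - q i" "q i"] by simp
    ultimately show ?thesis using RT_smult(1,2)[OF FC[OF i]] by simp
  qed
  define v where "v = (\<Oplus>\<^bsub>A\<^esub>i\<in>F. r i \<odot>\<^bsub>A\<^esub> i)"
  have part: "r i \<odot>\<^bsub>A\<^esub> i \<in> mpart A (d - int n)" if i: "i \<in> F" for i
  proof -
    have "i \<in> mpart A (d - int (height i))" using i F I primitives_part by blast
    from smult_in_part[OF r(1)[of i] this] show ?thesis by simp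
  qed
  have vn: "v \<in> mpart A (d - int n)"
    unfolding v_def by (rule finsum_in_part) (use part in auto)
  have "T_pow n \<odot>\<^bsub>A\<^esub> v = (\<Oplus>\<^bsub>A\<^esub>i\<in>F. T_pow n \<odot>\<^bsub>A\<^esub> (r i \<odot>\<^bsub>A\<^esub> i))"
    unfolding v_def using F FC RT_smult(1) by (intro finsum_smult_ldistr) auto
  also have "\<dots> = T_pow n \<odot>\<^bsub>A\<^esub> u"
    unfolding Fq using FC RT_smult(1) eq by (intro M.finsum_cong') auto
  finally have "u = v" using T_pow_inject[OF u vn] by simp
  moreover have "combination I v (\<lambda>i. if i \<in> F then r i else 0)"
    unfolding combination_def v_def using F FC RT_smult(1)
    by (intro exI[of _ F] conjI M.finsum_cong') auto
  ultimately show ?thesis unfolding span_def by blast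
qed

text \<open>If $u$ cannot be adjoined to a maximal independent set, then some non-zero multiple $pu$ lies in
  the span. This multiple has itself a multiple $T^n u$, which lies in the span, and hence so
  does $u$.\<close>

lemma primitive_in_span:
  assumes I: "independent I" and max: "\<And>J. independent J \<Longrightarrow> I \<subseteq> J \<Longrightarrow> J = I"
    and u: "u \<in> primitive n"
  shows "u \<in> span I"
proof (cases "u = \<zero>\<^bsub>A\<^esub> \<or> u \<in> I")
  case True
  then show ?thesis using zero_in_span span_superset I by (auto simp: independent_def)
next
  case False
  have IP: "I \<subseteq> primitives" using I by (simp add: independent_def)
  have uP: "u \<in> primitives" using u False by (auto simp: primitives_def)
  have uC: "u \<in> carrier A" using uP primitives_closed by blast
  let ?J = "insert u I"
  have JP: "?J \<subseteq> primitives" using IP uP by blast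
  have "\<not> independent ?J" using max[of ?J] False by blast
  then obtain p j where p: "combination ?J \<zero>\<^bsub>A\<^esub> p" and j: "j \<in> ?J" "p j \<odot>\<^bsub>A\<^esub> j \<noteq> \<zero>\<^bsub>A\<^esub>"
    using JP by (auto simp: independent_def)
  obtain F where F: "finite F" "F \<subseteq> ?J" "\<And>i. i \<notin> F \<Longrightarrow> p i = 0"
    using p unfolding combination_def by blast
  let ?G = "F - {u}"
  let ?p = "p(u := 0)"
  define w where "w = (\<Oplus>\<^bsub>A\<^esub>i\<in>?G. ?p i \<odot>\<^bsub>A\<^esub> i)"
  have GC: "i \<in> carrier A" if "i \<in> ?G" for i using that F IP primitives_closed by blast
  have w: "combination I w ?p"
    unfolding combination_def w_def using F by (intro exI[of _ ?G]) auto
  have wC: "w \<in> carrier A" using combination_closed[OF w IP] .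
  have "\<zero>\<^bsub>A\<^esub> = (\<Oplus>\<^bsub>A\<^esub>i\<in>insert u ?G. p i \<odot>\<^bsub>A\<^esub> i)"
    using combination_eq_sum[OF p JP, of "insert u ?G"] F JP by auto
  also have "\<dots> = p u \<odot>\<^bsub>A\<^esub> u \<oplus>\<^bsub>A\<^esub> (\<Oplus>\<^bsub>A\<^esub>i\<in>?G. p i \<odot>\<^bsub>A\<^esub> i)"
    using F(1) GC uC RT_smult(1) by (intro M.finsum_insert) auto
  also have "(\<Oplus>\<^bsub>A\<^esub>i\<in>?G. p i \<odot>\<^bsub>A\<^esub> i) = w"
    unfolding w_def using GC RT_smult(1) by (intro M.finsum_cong') auto
  finally have sum: "p u \<odot>\<^bsub>A\<^esub> u \<oplus>\<^bsub>A\<^esub> w = \<zero>\<^bsub>A\<^esub>" by simp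
  have nz: "p u \<odot>\<^bsub>A\<^esub> u \<noteq> \<zero>\<^bsub>A\<^esub>"
  proof
    assume 0: "p u \<odot>\<^bsub>A\<^esub> u = \<zero>\<^bsub>A\<^esub>"
    then have "w = \<zero>\<^bsub>A\<^esub>" using sum wC by simp
    then have "?p i \<odot>\<^bsub>A\<^esub> i = \<zero>\<^bsub>A\<^esub>" if "i \<in> I" for i using w I that unfolding independent_def by blast
    from this[of j] show False using j 0 by (cases "j = u") auto
  qed
  then have "\<not> T_pow (Suc n) dvd p u" using T_pow_dvd_annihilates[OF u] by blast
  then obtain r where r: "T_pow n \<odot>\<^bsub>A\<^esub> u = r \<odot>\<^bsub>A\<^esub> (p u \<odot>\<^bsub>A\<^esub> u)"
    using T_pow_multiple_of_nonzero[OF u] by blast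
  have "p u \<odot>\<^bsub>A\<^esub> u = \<ominus>\<^bsub>A\<^esub> w" using sum wC RT_smult(1)[OF uC] M.minus_equality by metis
  then have "p u \<odot>\<^bsub>A\<^esub> u = (- 1) \<odot>\<^bsub>A\<^esub> w" using RT_smult(6)[OF wC] by simp
  moreover have "w \<in> span I" using w unfolding span_def by blast
  ultimately have "T_pow n \<odot>\<^bsub>A\<^esub> u \<in> span I" using r span_smult[OF IP] by simp
  then show ?thesis
    using span_if_T_pow_in_span[OF IP] u by (auto simp: primitive_def)
qed

text \<open>Induction on the degree $k$. For $k = d - n$ surjectivity of $T^{n+2}$ onto degree $d+n+2$ yields
  $v$ in degree $k - 2$ with $T^{n+1}u = T^{n+2}v$, so $u - Tv$ is primitive and $v$ is covered by
  induction. Degrees above $d$ are reached from degrees below $d$ by a power of $T$. The induction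
  starts because there is nothing in negative degrees.\<close>

lemma carrier_in_span:
  assumes I: "I \<subseteq> primitives" and prim: "\<And>n. primitive n \<subseteq> span I"
  shows "carrier A \<subseteq> span I"
proof
  have parts: "\<forall>k < int N. mpart A k \<subseteq> span I" for N
  proof (induction N)
    case 0
    then show ?case using bounded_below zero_in_span by (auto dest!: subsetD)
  next
    case (Suc N)
    have "u \<in> span I" if k: "k = int N" and u: "u \<in> mpart A k" for u k
    proof (cases "k \<le> d")
      case True
      define n where "n = nat (d - k)"
      have kn: "k = d - int n" using True by (simp add: n_def)
      have "T_pow (Suc n) \<odot>\<^bsub>A\<^esub> u \<in> mpart A (d + int (n + 2))"
        using T_pow_in_part[OF u, of "Suc n"] kn by (simp add: algebra_simps)
      then obtain v where v: "v \<in> mpart A (d - int (n + 2))"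
        "T_pow (Suc n) \<odot>\<^bsub>A\<^esub> u = T_pow (n + 2) \<odot>\<^bsub>A\<^esub> v"
        using bij_betw_imp_surj_on[OF lefschetz[of "n + 2"]] by auto
      have vC: "v \<in> carrier A" and uC: "u \<in> carrier A" using v u part_closed by auto
      let ?w = "T_pow 1 \<odot>\<^bsub>A\<^esub> v"
      have w: "?w \<in> mpart A (d - int n)"
        using T_pow_in_part[OF v(1), of 1] by (simp add: algebra_simps)
      have wC: "?w \<in> carrier A" using w part_closed by blast
      have "d - int (n + 2) < int N" using k kn by simp
      then have "v \<in> span I" using Suc.IH v(1) by blast
      then have ws: "?w \<in> span I" using span_smult[OF I] by blast
      have "T_pow (Suc n) \<odot>\<^bsub>A\<^esub> ?w = T_pow (Suc n) \<odot>\<^bsub>A\<^esub> u"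
        unfolding v(2) using RT_smult(2)[OF vC, of "T_pow (Suc n)" "T_pow 1"] by (simp add: T_pow_mult)
      then have "T_pow (Suc n) \<odot>\<^bsub>A\<^esub> (u \<ominus>\<^bsub>A\<^esub> ?w) = \<zero>\<^bsub>A\<^esub>"
        using uC wC smult_r_distr[of "T_pow (Suc n)" u "\<ominus>\<^bsub>A\<^esub> ?w"]
          smult_r_minus[of "T_pow (Suc n)" ?w] RT_smult(1)[OF uC]
        by (simp add: a_minus_def M.r_neg)
      then have "u \<ominus>\<^bsub>A\<^esub> ?w \<in> primitive n"
        using diff_in_part[of u "d - int n" ?w] u w kn by (simp add: primitive_def)
      then have "(u \<ominus>\<^bsub>A\<^esub> ?w) \<oplus>\<^bsub>A\<^esub> ?w \<in> span I" using prim ws span_add[OF I] by blast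
      moreover have "(u \<ominus>\<^bsub>A\<^esub> ?w) \<oplus>\<^bsub>A\<^esub> ?w = u" using uC wC by (simp add: a_minus_def M.a_assoc M.l_neg)
      ultimately show ?thesis by simp
    next
      case False
      define m where "m = nat (k - d)"
      have km: "k = d + int m" "m \<ge> 1" using False by (auto simp: m_def)
      then obtain v where v: "v \<in> mpart A (d - int m)" "u = T_pow m \<odot>\<^bsub>A\<^esub> v"
        using bij_betw_imp_surj_on[OF lefschetz[OF km(2)]] u by auto
      have "d - int m < int N" using k km by simp
      then have "v \<in> span I" using Suc.IH v(1) by blast
      then show ?thesis using span_smult[OF I] v(2) by blast
    qed
    then have "mpart A k \<subseteq> span I" if "k < int (Suc N)" for k
      using Suc.IH that by (cases "k = int N") auto
    then show ?case by blast
  qed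
  fix u assume "u \<in> carrier A"
  then show "u \<in> span I"
  proof (induction rule: homogeneous_induct)
    case (homogeneous k u)
    then show ?case using parts[of "nat (k + 1)"] by (cases "0 \<le> k") (auto dest!: spec[of _ k])
  qed (rule span_add[OF I])
qed


lemma T_pow_dvd_combination_diff:
  assumes I: "independent I" and p: "combination I u p" and q: "combination I u q" and i: "i \<in> I"
  shows "T_pow (Suc (height i)) dvd p i - q i"
proof -
  have IP: "I \<subseteq> primitives" using I by (simp add: independent_def)
  have uC: "u \<in> carrier A" using combination_closed[OF p IP] .
  have "combination I (u \<oplus>\<^bsub>A\<^esub> (- 1) \<odot>\<^bsub>A\<^esub> u) (\<lambda>i. p i + (- 1) * q i)"
    using combination_add[OF IP p combination_smult[OF IP q]] .
  then have "combination I \<zero>\<^bsub>A\<^esub> (\<lambda>i. p i - q i)"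
    using uC by (simp add: RT_smult(6) M.r_neg)
  then have "(p i - q i) \<odot>\<^bsub>A\<^esub> i = \<zero>\<^bsub>A\<^esub>" using I i unfolding independent_def by blast
  moreover have "i \<in> primitives" using i IP by blast
  ultimately show ?thesis
    using annihilator_of_primitive[OF primitive_height] by (auto simp: primitives_def)
qed

text \<open>Coordinates with respect to a maximal independent set of primitive elements are determined modulo
  the annihilators of these elements, so they define an isomorphism onto the direct sum of strings
  indexed by this set.\<close>

lemma is_sum_of_strings: "is_sum_of_strings d A"
proof -
  obtain I where I: "independent I" and max: "\<And>J. independent J \<Longrightarrow> I \<subseteq> J \<Longrightarrow> J = I"
    using exists_maximal_independent by blast
  have IP: "I \<subseteq> primitives" using I by (simp add: independent_def)
  have IC: "i \<in> carrier A" if "i \<in> I" for i using that IP primitives_closed by blast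
  have comb: "\<exists>p. combination I u p" if "u \<in> carrier A" for u
    using carrier_in_span[OF IP] primitive_in_span[OF I max] that unfolding span_def by blast
  define coord where "coord u = (SOME p. combination I u p)" for u
  define h where "h u = (\<lambda>i\<in>I. string_class (height i) (coord u i))" for u
  have h: "h u = (\<lambda>i\<in>I. string_class (height i) (p i))" if "combination I u p" for u p
  proof -
    have "combination I u (coord u)" unfolding coord_def using someI[of "combination I u", OF that] .
    then show ?thesis
      unfolding h_def using T_pow_dvd_combination_diff[OF I _ that]
      by (intro restrict_ext) (simp add: string_class_eq_iff)
  qed
  let ?S = "\<lambda>i. string_module d (height i)"
  let ?N = "direct_sum I ?S"
  have carN: "f \<in> carrier ?N \<longleftrightarrow> f \<in> (\<Pi>\<^sub>E i\<in>I. range (string_class (height i))) \<and>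
      finite {i \<in> I. f i \<noteq> string_class (height i) 0}" for f
    by (simp add: direct_sum_def Let_def string_module_sel)
  have partN: "f \<in> mpart ?N k \<longleftrightarrow> f \<in> carrier ?N \<and>
      (\<forall>i\<in>I. f i \<in> string_class (height i) ` rpart RT (k - d + int (height i)))" for f k
    by (simp add: direct_sum_def Let_def string_module_sel)
  have hC: "h u \<in> carrier ?N" if u: "u \<in> carrier A" for u
  proof -
    obtain p where p: "combination I u p" using comb[OF u] by blast
    then obtain F where F: "finite F" "\<And>i. i \<notin> F \<Longrightarrow> p i = 0" unfolding combination_def by blast
    then have "{i \<in> I. h u i \<noteq> string_class (height i) 0} \<subseteq> F" by (auto simp: h[OF p])
    then have "finite {i \<in> I. h u i \<noteq> string_class (height i) 0}" using F(1) by (rule finite_subset)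
    moreover have "h u \<in> (\<Pi>\<^sub>E i\<in>I. range (string_class (height i)))" by (simp add: h[OF p])
    ultimately show ?thesis unfolding carN by blast
  qed
  \<comment> \<open>Choosing the representative zero for the zero class keeps the support finite.\<close>
  have lift: "\<exists>u. combination I u p \<and> h u = f"
    if f: "f \<in> carrier ?N" and p: "\<And>i. i \<in> I \<Longrightarrow> f i = string_class (height i) (p i)"
      "\<And>i. i \<notin> I \<or> f i = string_class (height i) 0 \<Longrightarrow> p i = 0" for f p
  proof -
    let ?F = "{i \<in> I. f i \<noteq> string_class (height i) 0}"
    have c: "combination I (\<Oplus>\<^bsub>A\<^esub>i\<in>?F. p i \<odot>\<^bsub>A\<^esub> i) p"
      unfolding combination_def using f p(2) by (intro exI[of _ ?F]) (auto simp: carN)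
    have "f = (\<lambda>i\<in>I. string_class (height i) (p i))"
      using f p(1) by (intro ext) (auto simp: carN PiE_iff extensional_def)
    with h[OF c] c show ?thesis by (intro exI conjI) (assumption, simp only:)
  qed
  have surj: "\<exists>u\<in>carrier A. h u = f" if f: "f \<in> carrier ?N" for f
  proof -
    have "\<exists>p. (i \<in> I \<longrightarrow> f i = string_class (height i) p) \<and>
        (i \<notin> I \<or> f i = string_class (height i) 0 \<longrightarrow> p = 0)" for i
      using f by (cases "i \<in> I"; cases "f i = string_class (height i) 0") (auto simp: carN PiE_iff)
    then obtain p where "\<And>i. i \<in> I \<Longrightarrow> f i = string_class (height i) (p i)"
      "\<And>i. i \<notin> I \<or> f i = string_class (height i) 0 \<Longrightarrow> p i = 0" by metis
    from lift[OF f this] show ?thesis using combination_closed[OF _ IP] by blast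
  qed
  have "graded_hom RT A ?N h"
    unfolding graded_hom_def
  proof (intro conjI ballI allI)
    show "h \<in> carrier A \<rightarrow> carrier ?N" using hC by blast
  next
    fix u v assume "u \<in> carrier A" "v \<in> carrier A"
    then obtain p q where p: "combination I u p" and q: "combination I v q" using comb by meson
    show "h (u \<oplus>\<^bsub>A\<^esub> v) = h u \<oplus>\<^bsub>?N\<^esub> h v"
      unfolding h[OF p] h[OF q] h[OF combination_add[OF IP p q]]
      by (simp add: direct_sum_def Let_def string_module_sel cong: restrict_cong)
  next
    fix r u assume "u \<in> carrier A"
    then obtain p where p: "combination I u p" using comb by meson
    show "h (r \<odot>\<^bsub>A\<^esub> u) = r \<odot>\<^bsub>?N\<^esub> h u"
      unfolding h[OF p] h[OF combination_smult[OF IP p]]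
      by (simp add: direct_sum_def Let_def string_module_sel cong: restrict_cong)
  next
    fix k show "h ` mpart A k \<subseteq> mpart ?N k"
    proof
      fix f assume "f \<in> h ` mpart A k"
      then obtain u where u: "u \<in> mpart A k" "f = h u" by blast
      then obtain p where "combination I u p" using comb part_closed by blast
      from combination_component[OF IP this, of k] obtain q where q: "combination I u q"
        and q': "\<And>i. q i \<in> rpart RT (k - (d - int (height i)))"
        using component_homogeneous[OF u(1), of k] by auto
      have "q i \<in> rpart RT (k - d + int (height i))" for i
        using q'[of i] by (simp add: algebra_simps)
      then show "f \<in> mpart ?N k"
        using hC[OF part_closed[OF u(1)]] unfolding partN u(2) h[OF q] by auto
    qed
  qed
  moreover have "bij_betw h (carrier A) (carrier ?N)"
    unfolding bij_betw_def
  proof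
    show "inj_on h (carrier A)"
    proof (rule inj_onI)
      fix u v assume "u \<in> carrier A" "v \<in> carrier A" and eq: "h u = h v"
      then obtain p q where p: "combination I u p" and q: "combination I v q" using comb by meson
      obtain F where F: "finite F" "F \<subseteq> I" "\<And>i. i \<notin> F \<Longrightarrow> p i = 0" using p unfolding combination_def by blast
      obtain G where G: "finite G" "G \<subseteq> I" "\<And>i. i \<notin> G \<Longrightarrow> q i = 0" using q unfolding combination_def by blast
      have "p i \<odot>\<^bsub>A\<^esub> i = q i \<odot>\<^bsub>A\<^esub> i" if i: "i \<in> I" for i
      proof -
        have "T_pow (Suc (height i)) dvd p i - q i"
          using fun_cong[OF eq, of i] i unfolding h[OF p] h[OF q] by (simp add: string_class_eq_iff)
        then have "(p i - q i) \<odot>\<^bsub>A\<^esub> i = \<zero>\<^bsub>A\<^esub>"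
          using T_pow_dvd_annihilates[OF primitive_height] i IP by blast
        then show ?thesis
          using RT_smult(3)[OF IC[OF i], of "p i - q i" "q i"] RT_smult(1)[OF IC[OF i]] by simp
      qed
      then have "(\<Oplus>\<^bsub>A\<^esub>i\<in>F \<union> G. p i \<odot>\<^bsub>A\<^esub> i) = (\<Oplus>\<^bsub>A\<^esub>i\<in>F \<union> G. q i \<odot>\<^bsub>A\<^esub> i)"
        using F G IC RT_smult(1) by (intro M.finsum_cong') auto
      moreover have "F \<union> G \<subseteq> primitives" using F G IP by blast
      ultimately show "u = v"
        using combination_eq_sum[OF p IP, of "F \<union> G"] combination_eq_sum[OF q IP, of "F \<union> G"] F G
        by simp
    qed
    show "h ` carrier A = carrier ?N" using hC surj by blast
  qed
  moreover have "mpart ?N k \<subseteq> h ` mpart A k" for k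
  proof
    fix f assume f: "f \<in> mpart ?N k"
    have "\<exists>p \<in> rpart RT (k - (d - int (height i))). (i \<in> I \<longrightarrow> f i = string_class (height i) p) \<and>
        (i \<notin> I \<or> f i = string_class (height i) 0 \<longrightarrow> p = 0)" for i
      using f zero_in_rpart
      by (cases "i \<in> I"; cases "f i = string_class (height i) 0") (auto simp: partN algebra_simps)
    then obtain p where p: "\<And>i. p i \<in> rpart RT (k - (d - int (height i)))"
      "\<And>i. i \<in> I \<Longrightarrow> f i = string_class (height i) (p i)"
      "\<And>i. i \<notin> I \<or> f i = string_class (height i) 0 \<Longrightarrow> p i = 0" by metis
    obtain u where u: "combination I u p" "h u = f"
      using lift[of f p] f p(2,3) by (auto simp: partN)
    then obtain F where F: "F \<subseteq> I" "u = (\<Oplus>\<^bsub>A\<^esub>i\<in>F. p i \<odot>\<^bsub>A\<^esub> i)" unfolding combination_def by blast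
    have "u \<in> mpart A k"
      unfolding F(2)
    proof (rule finsum_in_part)
      fix i assume "i \<in> F"
      then have "i \<in> mpart A (d - int (height i))" using F(1) IP primitives_part by blast
      from smult_in_part[OF p(1)[of i] this] show "p i \<odot>\<^bsub>A\<^esub> i \<in> mpart A k" by simp
    qed
    then show "f \<in> h ` mpart A k" using u(2) by blast
  qed
  moreover have "h ` mpart A k \<subseteq> mpart ?N k" for k
    using \<open>graded_hom RT A ?N h\<close> unfolding graded_hom_def by blast
  ultimately have "graded_iso RT A ?N"
    unfolding graded_iso_def by blast
  then show ?thesis unfolding is_sum_of_strings_def by blast
qed

end

section \<open>Extension of scalars along a split surjection\<close>

text \<open>Extension of scalars along a surjection \<open>f\<close> that is split by a graded ring homomorphism \<open>\<sigma>\<close>. The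
  splitting makes $M$ an $A$-module, and then $M \otimes_R A$ is the quotient of $M$ by the
  submodule that the elements $(r - \sigma(f(r)))m$ generate. The last assumption is the induction
  principle which says that each ring element is a sum of homogeneous ones.\<close>

locale graded_section = graded_mod R D M
  for R :: "('a, 'r) ring_scheme" (structure) and D :: "int \<Rightarrow> 'a set"
    and M :: "('a, 'm, 'x) gmodule_scheme" (structure) +
  fixes A :: "('c, 'z) gring_scheme" and f :: "'a \<Rightarrow> 'c" and \<sigma> :: "'c \<Rightarrow> 'a"
  assumes A_cring: "cring A" and f_hom: "f \<in> ring_hom R A" and \<sigma>_hom: "\<sigma> \<in> ring_hom A R"
    and f_\<sigma>: "a \<in> carrier A \<Longrightarrow> f (\<sigma> a) = a"
    and f_degree: "r \<in> D i \<Longrightarrow> f r \<in> rpart A i"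
    and \<sigma>_degree: "a \<in> rpart A i \<Longrightarrow> \<sigma> a \<in> D i"
    and A_parts: "rpart A i \<subseteq> carrier A" and one_degree: "\<one>\<^bsub>A\<^esub> \<in> rpart A 0"
    and homogeneous_generate: "\<lbrakk>\<And>i. D i \<subseteq> X; \<And>a b. \<lbrakk>a \<in> X; b \<in> X\<rbrakk> \<Longrightarrow> a \<oplus> b \<in> X\<rbrakk> \<Longrightarrow> carrier R \<subseteq> X"
begin

abbreviation F where "F \<equiv> free_Abelian_group (carrier M \<times> carrier A)"
definition K where "K = generate F (tensor_relations R A f M)"

interpretation A: cring A
  by (rule A_cring)

lemma f_closed: "r \<in> carrier R \<Longrightarrow> f r \<in> carrier A"
  using ring_hom_closed[OF f_hom] .

lemma \<sigma>_closed: "a \<in> carrier A \<Longrightarrow> \<sigma> a \<in> carrier R"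
  using ring_hom_closed[OF \<sigma>_hom] .

lemma A_one: "\<one>\<^bsub>A\<^esub> \<in> carrier A"
  using one_degree A_parts by blast

lemma F_diff: "x \<in> carrier F \<Longrightarrow> y \<in> carrier F \<Longrightarrow> x - y \<in> carrier F"
  using keys_diff[of x y] by auto

lemma relations_carrier: "tensor_relations R A f M \<subseteq> carrier F"
  by (auto simp: tensor_relations_def f_closed simp del: carrier_free_Abelian_group_iff intro!: F_diff)

lemma tensor_relations_cases:
  assumes "z \<in> tensor_relations R A f M"
  obtains (1) m m' a where "m \<in> carrier M" "m' \<in> carrier M" "a \<in> carrier A"
      "z = frag_of (m \<oplus>\<^bsub>M\<^esub> m', a) - frag_of (m, a) - frag_of (m', a)"
    | (2) m a a' where "m \<in> carrier M" "a \<in> carrier A" "a' \<in> carrier A"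
      "z = frag_of (m, a \<oplus>\<^bsub>A\<^esub> a') - frag_of (m, a) - frag_of (m, a')"
    | (3) r m a where "r \<in> carrier R" "m \<in> carrier M" "a \<in> carrier A"
      "z = frag_of (r \<odot>\<^bsub>M\<^esub> m, a) - frag_of (m, f r \<otimes>\<^bsub>A\<^esub> a)"
  using assms unfolding tensor_relations_def
  by (elim UnE CollectE exE conjE) (rule that, assumption, assumption, assumption, assumption)+

lemma K_subgroup: "subgroup K F"
  unfolding K_def by (rule group.generate_is_subgroup[OF _ relations_carrier]) simp

lemma K_normal: "normal K F"
  by (rule comm_group.subgroup_imp_normal[OF abelian_free_Abelian_group K_subgroup])

lemma K_carrier: "x \<in> K \<Longrightarrow> x \<in> carrier F"
  using subgroup.subset[OF K_subgroup] by blast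

lemma K_zero: "0 \<in> K"
  using subgroup.one_closed[OF K_subgroup] by simp

lemma K_add: "x \<in> K \<Longrightarrow> y \<in> K \<Longrightarrow> x + y \<in> K"
  using subgroup.m_closed[OF K_subgroup] by simp

lemma K_neg: "x \<in> K \<Longrightarrow> - x \<in> K"
  using subgroup.m_inv_closed[OF K_subgroup, of x] K_carrier[of x] by simp

lemma K_diff: "x \<in> K \<Longrightarrow> y \<in> K \<Longrightarrow> x - y \<in> K"
  using K_add[of x "- y"] K_neg by simp

lemma K_add_left:
  "m \<in> carrier M \<Longrightarrow> m' \<in> carrier M \<Longrightarrow> a \<in> carrier A \<Longrightarrow>
    frag_of (m \<oplus>\<^bsub>M\<^esub> m', a) - frag_of (m, a) - frag_of (m', a) \<in> K"
  unfolding K_def by (rule generate.incl) (auto simp: tensor_relations_def)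

lemma K_add_right:
  "m \<in> carrier M \<Longrightarrow> a \<in> carrier A \<Longrightarrow> a' \<in> carrier A \<Longrightarrow>
    frag_of (m, a \<oplus>\<^bsub>A\<^esub> a') - frag_of (m, a) - frag_of (m, a') \<in> K"
  unfolding K_def by (rule generate.incl) (auto simp: tensor_relations_def)

lemma K_balance:
  "r \<in> carrier R \<Longrightarrow> m \<in> carrier M \<Longrightarrow> a \<in> carrier A \<Longrightarrow>
    frag_of (r \<odot>\<^bsub>M\<^esub> m, a) - frag_of (m, f r \<otimes>\<^bsub>A\<^esub> a) \<in> K"
  unfolding K_def by (rule generate.incl) (auto simp: tensor_relations_def)

text \<open>Each tensor $m \otimes a$ equals $\sigma(a)m \otimes 1$, because \<open>f\<close> maps \<open>\<sigma> a\<close> to $a$.\<close>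

lemma K_scalar:
  assumes "m \<in> carrier M" "a \<in> carrier A"
  shows "frag_of (\<sigma> a \<odot>\<^bsub>M\<^esub> m, \<one>\<^bsub>A\<^esub>) - frag_of (m, a) \<in> K"
proof -
  have "f (\<sigma> a) \<otimes>\<^bsub>A\<^esub> \<one>\<^bsub>A\<^esub> = a"
    using f_\<sigma> assms by simp
  then show ?thesis using K_balance[of "\<sigma> a" m "\<one>\<^bsub>A\<^esub>"] assms \<sigma>_closed A_one by simp
qed

lemma coset_eq: "x - y \<in> K \<Longrightarrow> K #>\<^bsub>F\<^esub> x = K #>\<^bsub>F\<^esub> y"
proof -
  have sub: "K #>\<^bsub>F\<^esub> x \<subseteq> K #>\<^bsub>F\<^esub> y" if "x - y \<in> K" for x y
  proof
    fix z assume "z \<in> K #>\<^bsub>F\<^esub> x"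
    then obtain k where "k \<in> K" "z = k + x" by (auto simp: r_coset_def)
    then show "z \<in> K #>\<^bsub>F\<^esub> y"
      using K_add[OF _ that, of k] by (auto simp: r_coset_def intro!: bexI[of _ "k + (x - y)"])
  qed
  assume "x - y \<in> K"
  then show ?thesis using sub[of x y] sub[of y x] K_neg[of "x - y"] by auto
qed

lemma coset_eqD: "K #>\<^bsub>F\<^esub> x = K #>\<^bsub>F\<^esub> y \<Longrightarrow> x - y \<in> K"
proof -
  assume eq: "K #>\<^bsub>F\<^esub> x = K #>\<^bsub>F\<^esub> y"
  have "x \<in> K #>\<^bsub>F\<^esub> x" using K_zero by (auto simp: r_coset_def)
  then have "x \<in> K #>\<^bsub>F\<^esub> y" unfolding eq .
  then obtain k where "k \<in> K" "x = k + y" by (auto simp: r_coset_def)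
  then show ?thesis by simp
qed

lemma coset_zero: "K #>\<^bsub>F\<^esub> 0 = K"
  by (auto simp: r_coset_def)

definition tensor_one :: "'m \<Rightarrow> (('m \<times> 'c) \<Rightarrow>\<^sub>0 int) set" where
  "tensor_one m = K #>\<^bsub>F\<^esub> frag_of (m, \<one>\<^bsub>A\<^esub>)"

lemma tensor_one_eq_K_iff: "tensor_one m = K \<longleftrightarrow> frag_of (m, \<one>\<^bsub>A\<^esub>) \<in> K"
  using coset_eq[of "frag_of (m, \<one>\<^bsub>A\<^esub>)" 0] coset_eqD[of "frag_of (m, \<one>\<^bsub>A\<^esub>)" 0] coset_zero
  by (auto simp: tensor_one_def)

lemma null_add:
  assumes "m \<in> carrier M" "m' \<in> carrier M" "frag_of (m, \<one>\<^bsub>A\<^esub>) \<in> K" "frag_of (m', \<one>\<^bsub>A\<^esub>) \<in> K"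
  shows "frag_of (m \<oplus>\<^bsub>M\<^esub> m', \<one>\<^bsub>A\<^esub>) \<in> K"
  using K_add[OF K_add[OF K_add_left[OF assms(1,2) A_one] assms(3)] assms(4)] by simp

lemma null_zero: "frag_of (\<zero>\<^bsub>M\<^esub>, \<one>\<^bsub>A\<^esub>) \<in> K"
  using K_neg[OF K_add_left[of "\<zero>\<^bsub>M\<^esub>" "\<zero>\<^bsub>M\<^esub>" "\<one>\<^bsub>A\<^esub>"]] A_one by simp

lemma null_neg:
  assumes "m \<in> carrier M" "frag_of (m, \<one>\<^bsub>A\<^esub>) \<in> K"
  shows "frag_of (\<ominus>\<^bsub>M\<^esub> m, \<one>\<^bsub>A\<^esub>) \<in> K"
proof -
  have "frag_of (\<zero>\<^bsub>M\<^esub>, \<one>\<^bsub>A\<^esub>) - frag_of (\<ominus>\<^bsub>M\<^esub> m, \<one>\<^bsub>A\<^esub>) - frag_of (m, \<one>\<^bsub>A\<^esub>) \<in> K"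
    using K_add_left[of "\<ominus>\<^bsub>M\<^esub> m" m "\<one>\<^bsub>A\<^esub>"] A_one assms by (simp add: M.l_neg)
  from K_add[OF K_neg[OF this] K_diff[OF null_zero assms(2)]] show ?thesis by simp
qed

abbreviation scale where "scale b \<equiv> frag_extend (\<lambda>(m, a). frag_of (m, b \<otimes>\<^bsub>A\<^esub> a))"

lemma scale_in_K:
  assumes b: "b \<in> carrier A" and x: "x \<in> K"
  shows "scale b x \<in> K"
proof -
  have rel: "scale b h \<in> K" if "h \<in> tensor_relations R A f M" for h
    using that
  proof (cases rule: tensor_relations_cases)
    case (1 m m' a)
    then show ?thesis using K_add_left[of m m' "b \<otimes>\<^bsub>A\<^esub> a"] b by (simp add: frag_extend_diff)
  next
    case (2 m a a')
    then show ?thesis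
      using K_add_right[of m "b \<otimes>\<^bsub>A\<^esub> a" "b \<otimes>\<^bsub>A\<^esub> a'"] b by (simp add: frag_extend_diff A.r_distr)
  next
    case (3 r m a)
    then show ?thesis
      using K_balance[of r m "b \<otimes>\<^bsub>A\<^esub> a"] b
      by (simp add: frag_extend_diff A.m_lcomm f_closed)
  qed
  from x show ?thesis
    unfolding K_def
  proof (induction rule: generate.induct)
    case one
    then show ?case using K_zero by (simp add: K_def)
  next
    case (incl h)
    then show ?case using rel by (simp add: K_def)
  next
    case (inv h)
    then have "inv\<^bsub>F\<^esub> h = - h" using relations_carrier by auto
    then show ?case using K_neg[OF rel[OF inv]] by (simp add: K_def frag_extend_minus)
  next
    case (eng h1 h2)
    then show ?case using K_add by (simp add: K_def frag_extend_add)
  qed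
qed

text \<open>The elements all of whose components become zero in the tensor product. The kernel of
  $m \mapsto m \otimes 1$ is homogeneous as soon as it is contained in this set. For this it suffices
  that the set is a submodule and contains the elements $(r - \sigma(f(r)))m$, which is checked on
  homogeneous $r$ and $m$.\<close>

definition homogeneously_null :: "'m set" where
  "homogeneously_null = {u \<in> carrier M. \<forall>k. frag_of (component M k u, \<one>\<^bsub>A\<^esub>) \<in> K}"

lemma homogeneously_null_add:
  "u \<in> homogeneously_null \<Longrightarrow> v \<in> homogeneously_null \<Longrightarrow> u \<oplus>\<^bsub>M\<^esub> v \<in> homogeneously_null"
  by (auto simp: homogeneously_null_def component_add null_add)

lemma homogeneously_null_neg: "u \<in> homogeneously_null \<Longrightarrow> \<ominus>\<^bsub>M\<^esub> u \<in> homogeneously_null"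
  by (auto simp: homogeneously_null_def component_neg null_neg)

lemma homogeneously_null_zero: "\<zero>\<^bsub>M\<^esub> \<in> homogeneously_null"
  by (auto simp: homogeneously_null_def null_zero)

lemma homogeneously_null_smult:
  assumes u: "u \<in> homogeneously_null" and r: "r \<in> carrier R"
  shows "r \<odot>\<^bsub>M\<^esub> u \<in> homogeneously_null"
proof -
  have uC: "u \<in> carrier M" using u by (simp add: homogeneously_null_def)
  have "carrier R \<subseteq> {r \<in> carrier R. r \<odot>\<^bsub>M\<^esub> u \<in> homogeneously_null}"
  proof (rule homogeneous_generate, safe)
    fix i r assume ri: "r \<in> D i"
    then show r: "r \<in> carrier R" using degree_parts by blast
    have "frag_of (component M k (r \<odot>\<^bsub>M\<^esub> u), \<one>\<^bsub>A\<^esub>) \<in> K" for k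
    proof -
      let ?v = "component M (k - i) u"
      have c: "component M k (r \<odot>\<^bsub>M\<^esub> u) = r \<odot>\<^bsub>M\<^esub> ?v"
        using component_smult[OF ri uC, of "k - i"] by simp
      have "frag_of (?v, \<one>\<^bsub>A\<^esub>) \<in> K" using u by (simp add: homogeneously_null_def)
      from scale_in_K[OF f_closed[OF r] this]
      have "frag_of (?v, f r \<otimes>\<^bsub>A\<^esub> \<one>\<^bsub>A\<^esub>) \<in> K" by simp
      from K_add[OF K_balance[OF r _ A_one] this, of ?v] show ?thesis using uC c by simp
    qed
    then show "r \<odot>\<^bsub>M\<^esub> u \<in> homogeneously_null" using r uC by (simp add: homogeneously_null_def)
  next
    fix a b assume "a \<in> carrier R" "b \<in> carrier R" "a \<odot>\<^bsub>M\<^esub> u \<in> homogeneously_null" "b \<odot>\<^bsub>M\<^esub> u \<in> homogeneously_null"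
    then show "(a \<oplus> b) \<odot>\<^bsub>M\<^esub> u \<in> homogeneously_null"
      using uC by (simp add: smult_l_distr homogeneously_null_add)
  qed auto
  then show ?thesis using r by blast
qed

lemma defect_homogeneously_null:
  assumes r: "r \<in> carrier R" and u: "u \<in> carrier M"
  shows "(r \<ominus> \<sigma> (f r)) \<odot>\<^bsub>M\<^esub> u \<in> homogeneously_null"
proof -
  have "carrier R \<subseteq> {r \<in> carrier R. (r \<ominus> \<sigma> (f r)) \<odot>\<^bsub>M\<^esub> u \<in> homogeneously_null}"
  proof (rule homogeneous_generate, safe)
    fix i r assume ri: "r \<in> D i"
    then show r: "r \<in> carrier R" using degree_parts by blast
    have \<sigma>r: "\<sigma> (f r) \<in> D i" using ri f_degree \<sigma>_degree by blast
    have \<sigma>C: "\<sigma> (f r) \<in> carrier R" using r f_closed \<sigma>_closed by blast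
    from u show "(r \<ominus> \<sigma> (f r)) \<odot>\<^bsub>M\<^esub> u \<in> homogeneously_null"
    proof (induction rule: homogeneous_induct)
      case (homogeneous j v)
      have vC: "v \<in> carrier M" using homogeneous part_closed by blast
      let ?s = "\<sigma> (f r) \<odot>\<^bsub>M\<^esub> v"
      have e: "(r \<ominus> \<sigma> (f r)) \<odot>\<^bsub>M\<^esub> v = r \<odot>\<^bsub>M\<^esub> v \<oplus>\<^bsub>M\<^esub> \<ominus>\<^bsub>M\<^esub> ?s"
        using r \<sigma>C vC by (simp add: a_minus_def smult_l_distr smult_l_minus)
      have part: "r \<odot>\<^bsub>M\<^esub> v \<oplus>\<^bsub>M\<^esub> \<ominus>\<^bsub>M\<^esub> ?s \<in> mpart M (i + j)"
        using smult_in_part[OF ri homogeneous] smult_in_part[OF \<sigma>r homogeneous]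
        by (simp add: add_in_part neg_in_part)
      have "f r \<otimes>\<^bsub>A\<^esub> \<one>\<^bsub>A\<^esub> = f r" "f (\<sigma> (f r)) = f r"
        using f_closed[OF r] f_\<sigma> by simp_all
      with K_diff[OF K_balance[OF r vC A_one] K_balance[OF \<sigma>C vC A_one]]
      have 1: "frag_of (r \<odot>\<^bsub>M\<^esub> v, \<one>\<^bsub>A\<^esub>) - frag_of (?s, \<one>\<^bsub>A\<^esub>) \<in> K" by simp
      have "frag_of (\<zero>\<^bsub>M\<^esub>, \<one>\<^bsub>A\<^esub>) - frag_of (?s, \<one>\<^bsub>A\<^esub>) - frag_of (\<ominus>\<^bsub>M\<^esub> ?s, \<one>\<^bsub>A\<^esub>) \<in> K"
        using K_add_left[of ?s "\<ominus>\<^bsub>M\<^esub> ?s" "\<one>\<^bsub>A\<^esub>"] A_one \<sigma>C vC by (simp add: M.r_neg)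
      from K_diff[OF null_zero this]
      have 2: "frag_of (?s, \<one>\<^bsub>A\<^esub>) + frag_of (\<ominus>\<^bsub>M\<^esub> ?s, \<one>\<^bsub>A\<^esub>) \<in> K" by (simp add: algebra_simps)
      have 3: "frag_of (r \<odot>\<^bsub>M\<^esub> v \<oplus>\<^bsub>M\<^esub> \<ominus>\<^bsub>M\<^esub> ?s, \<one>\<^bsub>A\<^esub>) - frag_of (r \<odot>\<^bsub>M\<^esub> v, \<one>\<^bsub>A\<^esub>) - frag_of (\<ominus>\<^bsub>M\<^esub> ?s, \<one>\<^bsub>A\<^esub>) \<in> K"
        using K_add_left[of "r \<odot>\<^bsub>M\<^esub> v" "\<ominus>\<^bsub>M\<^esub> ?s" "\<one>\<^bsub>A\<^esub>"] A_one \<sigma>C vC r by simp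
      have null: "frag_of (r \<odot>\<^bsub>M\<^esub> v \<oplus>\<^bsub>M\<^esub> \<ominus>\<^bsub>M\<^esub> ?s, \<one>\<^bsub>A\<^esub>) \<in> K"
        using K_add[OF K_add[OF 1 2] 3] by (simp add: algebra_simps)
      then show ?case
        unfolding e homogeneously_null_def
        using component_homogeneous[OF part] part_closed[OF part] null_zero by auto
    next
      case (add v w)
      then show ?case using r \<sigma>C by (simp add: smult_r_distr homogeneously_null_add)
    qed
  next
    fix a b assume a: "a \<in> carrier R" "(a \<ominus> \<sigma> (f a)) \<odot>\<^bsub>M\<^esub> u \<in> homogeneously_null"
      and b: "b \<in> carrier R" "(b \<ominus> \<sigma> (f b)) \<odot>\<^bsub>M\<^esub> u \<in> homogeneously_null"
    have \<sigma>: "\<sigma> (f a) \<in> carrier R" "\<sigma> (f b) \<in> carrier R" using a b f_closed \<sigma>_closed by auto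
    have "\<sigma> (f (a \<oplus> b)) = \<sigma> (f a) \<oplus> \<sigma> (f b)"
      using a b f_closed by (simp add: ring_hom_add[OF f_hom] ring_hom_add[OF \<sigma>_hom])
    then have "(a \<oplus> b) \<ominus> \<sigma> (f (a \<oplus> b)) = (a \<ominus> \<sigma> (f a)) \<oplus> (b \<ominus> \<sigma> (f b))"
      using a b \<sigma> by (simp add: a_minus_def R.minus_add R.a_ac)
    then show "((a \<oplus> b) \<ominus> \<sigma> (f (a \<oplus> b))) \<odot>\<^bsub>M\<^esub> u \<in> homogeneously_null"
      using a b \<sigma> u by (simp add: smult_l_distr homogeneously_null_add)
  qed auto
  then show ?thesis using r by blast
qed

text \<open>By the universal property of the free abelian group there is an additive map with
  $(m, a) \mapsto \sigma(a) m$. It kills the two additivity relations and sends the third kind to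
  $\sigma(a)(r - \sigma(f(r)))m$, so it maps the whole subgroup of relations to homogeneously null
  elements. It returns $u$ on $u \otimes 1$.\<close>

lemma null_imp_homogeneously_null:
  assumes u: "u \<in> carrier M" and null: "frag_of (u, \<one>\<^bsub>A\<^esub>) \<in> K"
  shows "u \<in> homogeneously_null"
proof -
  have "(\<lambda>(m, a). \<sigma> a \<odot>\<^bsub>M\<^esub> m) ` (carrier M \<times> carrier A) \<subseteq> carrier (add_monoid M)"
    using \<sigma>_closed by auto
  then obtain h where hom: "h \<in> hom F (add_monoid M)"
    and "\<And>x. x \<in> carrier M \<times> carrier A \<Longrightarrow> h (frag_of x) = (\<lambda>(m, a). \<sigma> a \<odot>\<^bsub>M\<^esub> m) x"
    by (rule comm_group.free_Abelian_group_universal[OF M.a_comm_group]) (rule that)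
  then have h: "h (frag_of (m, a)) = \<sigma> a \<odot>\<^bsub>M\<^esub> m" if "m \<in> carrier M" "a \<in> carrier A" for m a
    using that by simp
  interpret H: group_hom F "add_monoid M" h
    using hom M.a_group by (simp add: group_hom_def group_hom_axioms_def)
  have add: "h (x + y) = h x \<oplus>\<^bsub>M\<^esub> h y" if "x \<in> carrier F" "y \<in> carrier F" for x y
    using H.hom_mult[OF that] by simp
  have neg: "h (- x) = \<ominus>\<^bsub>M\<^esub> h x" if "x \<in> carrier F" for x
    using H.hom_inv[OF that] that by (simp add: a_inv_def)
  have diff: "h (x - y) = h x \<ominus>\<^bsub>M\<^esub> h y" if "x \<in> carrier F" "y \<in> carrier F" for x y
    using add[of x "- y"] neg[of y] that by (simp add: a_minus_def)
  have rel: "h z \<in> homogeneously_null" if z: "z \<in> tensor_relations R A f M" for z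
  proof -
    from z show ?thesis
    proof (cases rule: tensor_relations_cases)
      case 1
      then have "h z = \<zero>\<^bsub>M\<^esub>"
        using \<sigma>_closed
        by (simp add: diff F_diff h smult_r_distr a_minus_def M.a_ac M.r_neg M.r_neg1 del: carrier_free_Abelian_group_iff)
      then show ?thesis using homogeneously_null_zero by simp
    next
      case 2
      then have "h z = \<zero>\<^bsub>M\<^esub>"
        using \<sigma>_closed
        by (simp add: diff F_diff h ring_hom_add[OF \<sigma>_hom] smult_l_distr a_minus_def M.a_ac M.r_neg M.r_neg1
            del: carrier_free_Abelian_group_iff)
      then show ?thesis using homogeneously_null_zero by simp
    next
      case (3 r m a)
      have fr: "f r \<in> carrier A" "\<sigma> (f r) \<in> carrier R" using 3 f_closed \<sigma>_closed by auto
      have "h z = \<sigma> a \<odot>\<^bsub>M\<^esub> (r \<odot>\<^bsub>M\<^esub> m) \<ominus>\<^bsub>M\<^esub> \<sigma> (f r \<otimes>\<^bsub>A\<^esub> a) \<odot>\<^bsub>M\<^esub> m"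
        using 3 fr by (simp add: diff h del: carrier_free_Abelian_group_iff)
      also have "\<sigma> (f r \<otimes>\<^bsub>A\<^esub> a) = \<sigma> a \<otimes> \<sigma> (f r)"
        using 3 fr \<sigma>_closed by (simp add: ring_hom_mult[OF \<sigma>_hom] R.m_comm)
      also have "\<sigma> a \<odot>\<^bsub>M\<^esub> (r \<odot>\<^bsub>M\<^esub> m) \<ominus>\<^bsub>M\<^esub> (\<sigma> a \<otimes> \<sigma> (f r)) \<odot>\<^bsub>M\<^esub> m
          = \<sigma> a \<odot>\<^bsub>M\<^esub> ((r \<ominus> \<sigma> (f r)) \<odot>\<^bsub>M\<^esub> m)"
        using 3 fr \<sigma>_closed
        by (simp add: a_minus_def smult_assoc1 smult_l_distr smult_r_distr smult_l_minus smult_r_minus)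
      finally show ?thesis
        using homogeneously_null_smult[OF defect_homogeneously_null] 3 \<sigma>_closed by simp
    qed
  qed
  have "h z \<in> homogeneously_null" if "z \<in> K" for z
    using that unfolding K_def
  proof (induction rule: generate.induct)
    case one
    then show ?case using H.hom_one homogeneously_null_zero by simp
  next
    case (incl z)
    then show ?case by (rule rel)
  next
    case (inv z)
    then have "z \<in> carrier F" using relations_carrier by blast
    then show ?case using neg[of z] homogeneously_null_neg[OF rel[OF inv]] by simp
  next
    case (eng y z)
    then have "y \<in> carrier F" "z \<in> carrier F" using K_carrier by (auto simp: K_def)
    then show ?case using add[of y z] eng homogeneously_null_add by simp
  qed
  from this[OF null] show ?thesis using h[OF u A_one] u by (simp add: ring_hom_one[OF \<sigma>_hom])
qed

lemma tensor_one_add: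
  assumes "u \<in> carrier M" "v \<in> carrier M"
  shows "tensor_one (u \<oplus>\<^bsub>M\<^esub> v) = tensor_one u <#>\<^bsub>F\<^esub> tensor_one v"
proof -
  have "tensor_one u <#>\<^bsub>F\<^esub> tensor_one v = K #>\<^bsub>F\<^esub> (frag_of (u, \<one>\<^bsub>A\<^esub>) + frag_of (v, \<one>\<^bsub>A\<^esub>))"
    unfolding tensor_one_def using normal.rcos_sum[OF K_normal, of "frag_of (u, \<one>\<^bsub>A\<^esub>)" "frag_of (v, \<one>\<^bsub>A\<^esub>)"] assms A_one
    by simp
  also have "\<dots> = tensor_one (u \<oplus>\<^bsub>M\<^esub> v)"
    unfolding tensor_one_def using K_neg[OF K_add_left[OF assms A_one]]
    by (intro coset_eq) (simp add: algebra_simps)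
  finally show ?thesis by simp
qed

lemma base_change_sel:
  "carrier (base_change R A f M) = rcosets\<^bsub>F\<^esub> K"
  "\<zero>\<^bsub>base_change R A f M\<^esub> = K"
  "X \<oplus>\<^bsub>base_change R A f M\<^esub> Y = X <#>\<^bsub>F\<^esub> Y"
  "b \<odot>\<^bsub>base_change R A f M\<^esub> X = (\<Union>z\<in>X. K #>\<^bsub>F\<^esub> scale b z)"
  "mpart (base_change R A f M) k = generate (F Mod K) {K #>\<^bsub>F\<^esub> frag_of (m, a) | m a i j.
                  m \<in> mpart M i \<and> a \<in> rpart A j \<and> i + j = k}"
  by (simp_all add: base_change_def Let_def K_def FactGroup_def)

lemma tensor_one_surj: "tensor_one ` carrier M = carrier (base_change R A f M)"
proof
  show "tensor_one ` carrier M \<subseteq> carrier (base_change R A f M)"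
    using A_one unfolding base_change_sel tensor_one_def RCOSETS_def
    by (auto simp del: carrier_free_Abelian_group_iff
        intro!: bexI[of _ "frag_of (m, \<one>\<^bsub>A\<^esub>)" for m])
  show "carrier (base_change R A f M) \<subseteq> tensor_one ` carrier M"
  proof
    fix X assume "X \<in> carrier (base_change R A f M)"
    then obtain z where z: "Poly_Mapping.keys z \<subseteq> carrier M \<times> carrier A" and X: "X = K #>\<^bsub>F\<^esub> z"
      by (auto simp: base_change_sel RCOSETS_def)
    have "\<exists>m\<in>carrier M. frag_of (m, \<one>\<^bsub>A\<^esub>) - z \<in> K"
      using z
    proof (induction z rule: free_Abelian_group_induct[consumes 1, case_names zero diff generator])
      case zero
      then show ?case using null_zero by auto
    next
      case (diff x y)
      then obtain m m' where m: "m \<in> carrier M" "frag_of (m, \<one>\<^bsub>A\<^esub>) - x \<in> K"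
        and m': "m' \<in> carrier M" "frag_of (m', \<one>\<^bsub>A\<^esub>) - y \<in> K" by blast
      let ?n = "\<ominus>\<^bsub>M\<^esub> m'"
      have "frag_of (\<zero>\<^bsub>M\<^esub>, \<one>\<^bsub>A\<^esub>) - frag_of (m', \<one>\<^bsub>A\<^esub>) - frag_of (?n, \<one>\<^bsub>A\<^esub>) \<in> K"
        using K_add_left[of m' ?n "\<one>\<^bsub>A\<^esub>"] A_one m' by (simp add: M.r_neg)
      from K_diff[OF null_zero this]
      have n: "frag_of (m', \<one>\<^bsub>A\<^esub>) + frag_of (?n, \<one>\<^bsub>A\<^esub>) \<in> K" by (simp add: algebra_simps)
      have "frag_of (m \<oplus>\<^bsub>M\<^esub> ?n, \<one>\<^bsub>A\<^esub>) - frag_of (m, \<one>\<^bsub>A\<^esub>) - frag_of (?n, \<one>\<^bsub>A\<^esub>) \<in> K"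
        using K_add_left m m' A_one by simp
      from K_add[OF this K_diff[OF K_add[OF m(2) n] m'(2)]]
      have "frag_of (m \<oplus>\<^bsub>M\<^esub> ?n, \<one>\<^bsub>A\<^esub>) - (x - y) \<in> K" by (simp add: algebra_simps)
      then show ?case using m m' by blast
    next
      case (generator p)
      then obtain m a where "p = (m, a)" "m \<in> carrier M" "a \<in> carrier A" by auto
      then show ?case using K_scalar[of m a] \<sigma>_closed by (intro bexI[of _ "\<sigma> a \<odot>\<^bsub>M\<^esub> m"]) auto
    qed
    then obtain m where "m \<in> carrier M" "frag_of (m, \<one>\<^bsub>A\<^esub>) - z \<in> K" by blast
    then show "X \<in> tensor_one ` carrier M" using coset_eq unfolding X tensor_one_def by blast
  qed
qed

lemma tensor_one_smult:
  assumes a: "a \<in> carrier A" and u: "u \<in> carrier M"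
  shows "tensor_one (\<sigma> a \<odot>\<^bsub>M\<^esub> u) = a \<odot>\<^bsub>base_change R A f M\<^esub> tensor_one u"
proof -
  have "K #>\<^bsub>F\<^esub> scale a z = tensor_one (\<sigma> a \<odot>\<^bsub>M\<^esub> u)" if "z \<in> tensor_one u" for z
  proof -
    from that obtain k where k: "k \<in> K" "z = k + frag_of (u, \<one>\<^bsub>A\<^esub>)"
      by (auto simp: tensor_one_def r_coset_def)
    have "a \<otimes>\<^bsub>A\<^esub> \<one>\<^bsub>A\<^esub> = a" using a by simp
    then have "scale a z = scale a k + frag_of (u, a)" by (simp add: k frag_extend_add)
    then show ?thesis
      unfolding tensor_one_def using K_diff[OF scale_in_K[OF a k(1)] K_scalar[OF u a]]
      by (intro coset_eq) (simp add: algebra_simps)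
  qed
  moreover have "frag_of (u, \<one>\<^bsub>A\<^esub>) \<in> tensor_one u"
    using K_zero by (auto simp: tensor_one_def r_coset_def)
  ultimately show ?thesis unfolding base_change_sel by blast
qed

lemma tensor_one_parts: "mpart (base_change R A f M) k = tensor_one ` mpart M k"
proof
  have grp: "group (F Mod K)"
    by (rule normal.factorgroup_is_group[OF K_normal])
  have add: "tensor_one u \<otimes>\<^bsub>F Mod K\<^esub> tensor_one v = tensor_one (u \<oplus>\<^bsub>M\<^esub> v)"
    if "u \<in> carrier M" "v \<in> carrier M" for u v
    using tensor_one_add[OF that] by (simp add: FactGroup_def)
  have one: "tensor_one \<zero>\<^bsub>M\<^esub> = \<one>\<^bsub>F Mod K\<^esub>"
    using null_zero tensor_one_eq_K_iff by (simp add: FactGroup_def)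
  have car: "tensor_one u \<in> carrier (F Mod K)" if "u \<in> carrier M" for u
    using tensor_one_surj that by (auto simp: base_change_sel FactGroup_def)
  have sub: "subgroup (tensor_one ` mpart M k) (F Mod K)"
  proof (rule group.subgroupI[OF grp])
    show "tensor_one ` mpart M k \<subseteq> carrier (F Mod K)" using car part_closed by blast
    show "tensor_one ` mpart M k \<noteq> {}" using zero_in_part by blast
    fix X Y assume "X \<in> tensor_one ` mpart M k"
    then obtain u where u: "u \<in> mpart M k" "X = tensor_one u" by blast
    have uC: "u \<in> carrier M" using u part_closed by blast
    have "inv\<^bsub>F Mod K\<^esub> X = tensor_one (\<ominus>\<^bsub>M\<^esub> u)"
      using group.inv_equality[OF grp, of "tensor_one (\<ominus>\<^bsub>M\<^esub> u)" X] u uC car add one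
      by (simp add: M.l_neg)
    then show "inv\<^bsub>F Mod K\<^esub> X \<in> tensor_one ` mpart M k" using neg_in_part u by blast
    assume "Y \<in> tensor_one ` mpart M k"
    then obtain v where v: "v \<in> mpart M k" "Y = tensor_one v" by blast
    then show "X \<otimes>\<^bsub>F Mod K\<^esub> Y \<in> tensor_one ` mpart M k"
      using add[OF uC part_closed[OF v(1)]] add_in_part[OF u(1) v(1)] u by auto
  qed
  show "mpart (base_change R A f M) k \<subseteq> tensor_one ` mpart M k"
    unfolding base_change_sel
  proof (rule group.generate_subgroup_incl[OF grp _ sub], safe)
    fix m a i j assume m: "m \<in> mpart M i" and a: "a \<in> rpart A j"
    have "K #>\<^bsub>F\<^esub> frag_of (m, a) = tensor_one (\<sigma> a \<odot>\<^bsub>M\<^esub> m)"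
      unfolding tensor_one_def
      using coset_eq[OF K_scalar[of m a]] part_closed[OF m] a A_parts by blast
    moreover have "\<sigma> a \<odot>\<^bsub>M\<^esub> m \<in> mpart M (i + j)"
      using smult_in_part[OF \<sigma>_degree[OF a] m] by (simp add: add.commute)
    ultimately show "K #>\<^bsub>F\<^esub> frag_of (m, a) \<in> tensor_one ` mpart M (i + j)" by blast
  qed
  show "tensor_one ` mpart M k \<subseteq> mpart (base_change R A f M) k"
    unfolding base_change_sel tensor_one_def
    using one_degree by (force intro!: generate.incl)
qed

theorem graded_module_base_change: "graded_module A (rpart A) (base_change R A f M)"
proof (rule graded_module_image[OF A_cring \<sigma>_hom \<sigma>_degree tensor_one_surj])
  fix u v a k
  show "tensor_one \<zero>\<^bsub>M\<^esub> = \<zero>\<^bsub>base_change R A f M\<^esub>"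
    using null_zero tensor_one_eq_K_iff by (simp add: base_change_sel)
  show "rpart A k \<subseteq> carrier A" by (rule A_parts)
  show "mpart (base_change R A f M) k = tensor_one ` mpart M k" by (rule tensor_one_parts)
  assume u: "u \<in> carrier M"
  show "tensor_one (\<sigma> a \<odot>\<^bsub>M\<^esub> u) = a \<odot>\<^bsub>base_change R A f M\<^esub> tensor_one u" if "a \<in> carrier A"
    using that u by (rule tensor_one_smult)
  show "tensor_one (u \<oplus>\<^bsub>M\<^esub> v) = tensor_one u \<oplus>\<^bsub>base_change R A f M\<^esub> tensor_one v" if "v \<in> carrier M"
    using tensor_one_add[OF u that] by (simp add: base_change_sel)
  show "tensor_one (component M k u) = \<zero>\<^bsub>base_change R A f M\<^esub>"
    if "tensor_one u = \<zero>\<^bsub>base_change R A f M\<^esub>"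
    using that null_imp_homogeneously_null[OF u]
    by (simp add: base_change_sel tensor_one_eq_K_iff homogeneously_null_def)
qed

end

section \<open>The symmetric algebra and its map to the polynomial ring\<close>

lemma sym_alg_sel [simp]:
  "carrier (sym_alg S) = sym_carrier S" "x \<otimes>\<^bsub>sym_alg S\<^esub> y = x * y" "\<one>\<^bsub>sym_alg S\<^esub> = 1"
  "\<zero>\<^bsub>sym_alg S\<^esub> = 0" "x \<oplus>\<^bsub>sym_alg S\<^esub> y = x + y"
  by (simp_all add: sym_alg_def)

definition monomial_degree :: "('w \<Rightarrow>\<^sub>0 nat) \<Rightarrow> nat" where
  "monomial_degree m = (\<Sum>s\<in>Poly_Mapping.keys m. Poly_Mapping.lookup m s)"

lemma monomial_degree_add: "monomial_degree (a + b) = monomial_degree a + monomial_degree b"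
  unfolding monomial_degree_def by (rule setsum_keys_plus_distrib) auto

lemma monomial_degree_zero [simp]: "monomial_degree 0 = 0"
  by (simp add: monomial_degree_def)

lemma rpart_sym_alg:
  "p \<in> rpart (sym_alg S) k \<longleftrightarrow>
    p \<in> sym_carrier S \<and> (\<forall>m\<in>Poly_Mapping.keys p. 2 * int (monomial_degree m) = k)"
  by (simp add: sym_alg_def monomial_degree_def)

lemma rpart_sym_alg_closed: "rpart (sym_alg S) k \<subseteq> sym_carrier S"
  by (auto simp: rpart_sym_alg)

lemma rpart_sym_alg_negative: "k < 0 \<Longrightarrow> p \<in> rpart (sym_alg S) k \<Longrightarrow> p = 0"
  by (auto simp: rpart_sym_alg simp flip: keys_eq_empty)

lemma sym_carrier_add: "p \<in> sym_carrier S \<Longrightarrow> q \<in> sym_carrier S \<Longrightarrow> p + q \<in> sym_carrier S"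
  using keys_add[of p q] by (auto simp: sym_carrier_def)

lemma keys_add_nat: "Poly_Mapping.keys (a + b) = Poly_Mapping.keys a \<union> Poly_Mapping.keys (b :: 'w \<Rightarrow>\<^sub>0 nat)"
  by (auto simp: in_keys_iff lookup_add)

lemma sym_carrier_mult:
  assumes "p \<in> sym_carrier S" "q \<in> sym_carrier S"
  shows "p * q \<in> sym_carrier S"
proof -
  have "Poly_Mapping.keys m \<subseteq> S" if m: "m \<in> Poly_Mapping.keys (p * q)" for m
  proof -
    obtain a b where "m = a + b" "a \<in> Poly_Mapping.keys p" "b \<in> Poly_Mapping.keys q"
      using subsetD[OF keys_mult m] by blast
    then show ?thesis using assms by (auto simp: sym_carrier_def keys_add_nat)
  qed
  then show ?thesis by (simp add: sym_carrier_def)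
qed

lemma rpart_sym_alg_mult:
  assumes "p \<in> rpart (sym_alg S) i" "q \<in> rpart (sym_alg S) j"
  shows "p * q \<in> rpart (sym_alg S) (i + j)"
proof -
  have "2 * int (monomial_degree m) = i + j" if m: "m \<in> Poly_Mapping.keys (p * q)" for m
  proof -
    obtain a b where ab: "m = a + b" and "a \<in> Poly_Mapping.keys p" "b \<in> Poly_Mapping.keys q"
      using subsetD[OF keys_mult m] by blast
    then have "2 * int (monomial_degree a) = i" "2 * int (monomial_degree b) = j"
      using assms by (auto simp: rpart_sym_alg)
    then show ?thesis by (simp add: ab monomial_degree_add)
  qed
  then show ?thesis using assms by (auto simp: rpart_sym_alg sym_carrier_mult)
qed

lemma sym_const_in_rpart: "sym_const c \<in> rpart (sym_alg S) 0"
  by (auto simp: rpart_sym_alg sym_const_def sym_carrier_def split: if_splits)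

lemma sym_const_closed: "sym_const c \<in> sym_carrier S"
  using sym_const_in_rpart rpart_sym_alg_closed by blast

lemma sym_vec_in_rpart: "sym_vec S v \<in> rpart (sym_alg S) 2"
proof -
  have "\<exists>s\<in>S. m = Poly_Mapping.single s 1" if "m \<in> Poly_Mapping.keys (sym_vec S v)" for m
    using subsetD[OF keys_sum that[unfolded sym_vec_def]] by (auto split: if_splits)
  then show ?thesis by (fastforce simp: rpart_sym_alg sym_carrier_def monomial_degree_def)
qed

lemma sym_alg_generated_by_homogeneous:
  assumes hom: "\<And>i. rpart (sym_alg S) i \<subseteq> X" and add: "\<And>a b. \<lbrakk>a \<in> X; b \<in> X\<rbrakk> \<Longrightarrow> a + b \<in> X"
  shows "sym_carrier S \<subseteq> X"
proof
  fix p assume p: "p \<in> sym_carrier S"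
  let ?t = "\<lambda>m. Poly_Mapping.single m (Poly_Mapping.lookup p m)"
  have "(\<Sum>m\<in>F. ?t m) \<in> X" if "finite F" "F \<subseteq> Poly_Mapping.keys p" for F
    using that
  proof induction
    case empty
    have "0 \<in> rpart (sym_alg S) 0" by (simp add: rpart_sym_alg sym_carrier_def)
    then show ?case using hom by auto
  next
    case (insert m F)
    then have "?t m \<in> rpart (sym_alg S) (2 * int (monomial_degree m))"
      using p by (auto simp: rpart_sym_alg sym_carrier_def split: if_splits)
    then show ?case using insert add hom by auto
  qed
  moreover have "(\<Sum>m\<in>Poly_Mapping.keys p. ?t m) = p"
    by (rule poly_mapping_eqI) (auto simp: lookup_sum lookup_single when_def in_keys_iff sum.delta)
  ultimately show "p \<in> X" by (metis finite_keys order_refl)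
qed

definition eval_at :: "(('w \<Rightarrow>\<^sub>0 nat) \<Rightarrow>\<^sub>0 real) \<Rightarrow> real poly \<Rightarrow> (('w \<Rightarrow>\<^sub>0 nat) \<Rightarrow>\<^sub>0 real)" where
  "eval_at v p = poly (map_poly sym_const p) v"

lemma eval_at_0 [simp]: "eval_at v 0 = 0"
  by (simp add: eval_at_def)

lemma eval_at_pCons: "eval_at v (pCons a p) = sym_const a + v * eval_at v p"
  by (simp add: eval_at_def map_poly_pCons sym_const_def)

lemma sym_const_hom:
  "sym_const (a + b) = sym_const a + sym_const b" "sym_const (a * b) = sym_const a * sym_const b"
  "sym_const 1 = 1" "sym_const 0 = 0"
  by (simp_all add: sym_const_def single_add mult_single)

lemma eval_at_add: "eval_at v (p + q) = eval_at v p + eval_at v q"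
  by (induction p q rule: poly_induct2) (simp_all add: eval_at_pCons sym_const_hom algebra_simps)

lemma eval_at_smult: "eval_at v (Polynomial.smult a p) = sym_const a * eval_at v p"
  by (induction p) (simp_all add: eval_at_pCons sym_const_hom algebra_simps)

lemma eval_at_mult: "eval_at v (p * q) = eval_at v p * eval_at v q"
  by (induction p) (simp_all add: eval_at_pCons eval_at_add eval_at_smult sym_const_hom algebra_simps)

lemma eval_at_1: "eval_at v 1 = 1"
  by (simp add: one_pCons eval_at_pCons sym_const_hom)

lemma eval_at_closed:
  assumes v: "v \<in> sym_carrier S"
  shows "eval_at v p \<in> sym_carrier S"
proof (induction p)
  case 0
  then show ?case by (simp add: sym_carrier_def)
next
  case (pCons a p)
  then show ?case
    using v by (simp add: eval_at_pCons sym_carrier_add sym_carrier_mult sym_const_closed)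
qed

lemma rpart_RT_pCons:
  assumes "pCons a p \<in> rpart RT k"
  shows "p \<in> rpart RT (k - 2)" "a = 0 \<or> k = 0"
proof -
  have *: "Polynomial.coeff (pCons a p) i \<noteq> 0 \<Longrightarrow> 2 * int i = k" for i
    using assms by (simp add: rpart_RT)
  show "p \<in> rpart RT (k - 2)" using *[of "Suc i" for i] by (force simp: rpart_RT)
  show "a = 0 \<or> k = 0" using *[of 0] by auto
qed

lemma eval_at_degree:
  assumes v: "v \<in> rpart (sym_alg S) 2" and p: "p \<in> rpart RT k"
  shows "eval_at v p \<in> rpart (sym_alg S) k"
  using p
proof (induction p arbitrary: k)
  case 0
  then show ?case by (simp add: rpart_sym_alg sym_carrier_def)
next
  case (pCons a p)
  have "v * eval_at v p \<in> rpart (sym_alg S) (2 + (k - 2))"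
    using rpart_sym_alg_mult[OF v pCons.IH] rpart_RT_pCons[OF pCons.prems] by blast
  moreover have "sym_const a \<in> rpart (sym_alg S) k"
    using rpart_RT_pCons(2)[OF pCons.prems]
  proof
    assume "a = 0"
    then show ?thesis by (simp add: sym_const_hom rpart_sym_alg sym_carrier_def)
  qed (simp add: sym_const_in_rpart)
  moreover have "a + b \<in> rpart (sym_alg S) k"
    if "a \<in> rpart (sym_alg S) k" "b \<in> rpart (sym_alg S) k" for a b
    using that keys_add[of a b] by (auto simp: rpart_sym_alg sym_carrier_add)
  ultimately show ?case by (simp add: eval_at_pCons)
qed

text \<open>Some element maps to $T$, and its homogeneous parts of degree other than $2$ do not contribute
  to the coefficient of $T$, so they can be dropped.\<close>

lemma exists_degree_two_lift:
  assumes \<rho>: "graded_alg_hom S \<rho>" and surj: "\<rho> ` carrier (sym_alg S) = carrier RT"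
  shows "\<exists>v \<in> rpart (sym_alg S) 2. \<rho> v = T_pow 1"
proof -
  have hom: "\<rho> \<in> ring_hom (sym_alg S) RT" using \<rho> by (simp add: graded_alg_hom_def)
  have add: "\<rho> (a + b) = \<rho> a + \<rho> b" if "a \<in> sym_carrier S" "b \<in> sym_carrier S" for a b
    using ring_hom_add[OF hom] that by simp
  have deg: "\<rho> r \<in> rpart RT i" if "r \<in> rpart (sym_alg S) i" for r i
    using \<rho> that unfolding graded_alg_hom_def by blast
  obtain w where w: "w \<in> sym_carrier S" "\<rho> w = T_pow 1" using surj by (metis RT_sel(1) UNIV_I imageE sym_alg_sel(1))
  let ?c = "\<lambda>r. Polynomial.coeff (\<rho> r) 1"
  have "sym_carrier S \<subseteq> {r \<in> sym_carrier S. \<exists>v \<in> rpart (sym_alg S) 2. ?c v = ?c r}"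
  proof (rule sym_alg_generated_by_homogeneous, safe)
    fix i r assume r: "r \<in> rpart (sym_alg S) i"
    then show "r \<in> sym_carrier S" using rpart_sym_alg_closed by blast
    show "\<exists>v \<in> rpart (sym_alg S) 2. ?c v = ?c r"
    proof (cases "i = 2")
      case False
      then have "?c r = 0" using deg[OF r] by (auto simp: rpart_RT)
      moreover have "0 \<in> rpart (sym_alg S) 2" by (simp add: rpart_sym_alg sym_carrier_def)
      moreover have "\<rho> 0 = 0" using add[of 0 0] by (simp add: sym_carrier_def)
      ultimately show ?thesis by (intro bexI[of _ 0]) auto
    qed (use r in blast)
  next
    fix a b v v' assume *: "a \<in> sym_carrier S" "b \<in> sym_carrier S"
      "v \<in> rpart (sym_alg S) 2" "?c v = ?c a" "v' \<in> rpart (sym_alg S) 2" "?c v' = ?c b"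
    have "v + v' \<in> rpart (sym_alg S) 2"
      using * keys_add[of v v'] by (auto simp: rpart_sym_alg sym_carrier_add)
    moreover have "?c (v + v') = ?c (a + b)" using * by (simp add: add rpart_sym_alg)
    ultimately show "\<exists>v \<in> rpart (sym_alg S) 2. ?c v = ?c (a + b)" by blast
  qed (rule sym_carrier_add)
  then obtain v where v: "v \<in> rpart (sym_alg S) 2" "?c v = ?c w" using w by blast
  have "Polynomial.coeff (\<rho> v) i = Polynomial.coeff (T_pow 1) i" for i
    using v(2) deg[OF v(1)] unfolding w by (cases "i = 1") (auto simp: rpart_RT T_pow_def)
  then have "\<rho> v = T_pow 1" by (rule poly_eqI)
  then show ?thesis using v by blast
qed

text \<open>Hence $T \mapsto v$ splits \<open>\<rho>\<close>, as a homomorphism of graded rings when $v$ has degree $2$.\<close>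

lemma eval_at_section:
  assumes \<rho>: "graded_alg_hom S \<rho>" and v: "v \<in> rpart (sym_alg S) 2" "\<rho> v = T_pow 1"
  shows "\<rho> (eval_at v p) = p"
proof -
  have hom: "\<rho> \<in> ring_hom (sym_alg S) RT" and c: "\<And>c. \<rho> (sym_const c) = [:c:]"
    using \<rho> by (simp_all add: graded_alg_hom_def)
  have vC: "v \<in> sym_carrier S" using v by (simp add: rpart_sym_alg)
  show ?thesis
  proof (induction p)
    case 0
    then show ?case using c[of 0] by (simp add: sym_const_hom)
  next
    case (pCons a p)
    have "\<rho> (eval_at v (pCons a p)) = \<rho> (sym_const a) + \<rho> v * \<rho> (eval_at v p)"
      unfolding eval_at_pCons
      using ring_hom_add[OF hom, of "sym_const a" "v * eval_at v p"]
        ring_hom_mult[OF hom, of v "eval_at v p"]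
      by (simp add: vC sym_const_closed eval_at_closed sym_carrier_mult)
    then show ?case using pCons by (simp add: c v(2) T_pow_def monom_Suc)
  qed
qed

lemma extend_to_RT_graded_module:
  assumes M: "graded_module (sym_alg S) (rpart (sym_alg S)) M"
    and \<rho>: "graded_alg_hom S \<rho>" and surj: "\<rho> ` carrier (sym_alg S) = carrier RT"
  shows "graded_module RT (rpart RT) (extend_to_RT S \<rho> M)"
    and "mpart M k \<subseteq> {\<zero>\<^bsub>M\<^esub>} \<Longrightarrow> mpart (extend_to_RT S \<rho> M) k \<subseteq> {\<zero>\<^bsub>extend_to_RT S \<rho> M\<^esub>}"
proof -
  obtain v where v: "v \<in> rpart (sym_alg S) 2" "\<rho> v = T_pow 1"
    using exists_degree_two_lift[OF \<rho> surj] by blast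
  have vC: "v \<in> sym_carrier S" using v by (simp add: rpart_sym_alg)
  have "graded_section (sym_alg S) (rpart (sym_alg S)) M RT \<rho> (eval_at v)"
  proof (rule graded_section.intro[OF graded_modI[OF M]], goal_cases)
    case (1 i)
    then show ?case using rpart_sym_alg_closed by auto
  next
    case 2
    show ?case
    proof (rule graded_section_axioms.intro)
      show "cring RT" by (rule cring_RT)
      show "\<rho> \<in> ring_hom (sym_alg S) RT" using \<rho> by (simp add: graded_alg_hom_def)
      show "eval_at v \<in> ring_hom RT (sym_alg S)"
        by (rule ring_hom_memI) (simp_all add: eval_at_closed[OF vC] eval_at_add eval_at_mult eval_at_1)
      show "\<rho> (eval_at v a) = a" for a by (rule eval_at_section[OF \<rho> v])
      show "\<rho> r \<in> rpart RT i" if "r \<in> rpart (sym_alg S) i" for r i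
        using \<rho> that unfolding graded_alg_hom_def by blast
      show "eval_at v a \<in> rpart (sym_alg S) i" if "a \<in> rpart RT i" for a i
        by (rule eval_at_degree[OF v(1) that])
      show "rpart RT i \<subseteq> carrier RT" for i by simp
      show "\<one>\<^bsub>RT\<^esub> \<in> rpart RT 0" using const_in_rpart[of 1] by (simp add: one_pCons)
      show "carrier (sym_alg S) \<subseteq> X"
        if "\<And>i. rpart (sym_alg S) i \<subseteq> X" "\<And>a b. a \<in> X \<Longrightarrow> b \<in> X \<Longrightarrow> a \<oplus>\<^bsub>sym_alg S\<^esub> b \<in> X" for X
        using sym_alg_generated_by_homogeneous[of S X] that by simp
    qed
  qed
  then interpret graded_section "sym_alg S" "rpart (sym_alg S)" M RT \<rho> "eval_at v" .
  show "graded_module RT (rpart RT) (extend_to_RT S \<rho> M)"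
    unfolding extend_to_RT_def by (rule graded_module_base_change)
  have "tensor_one \<zero>\<^bsub>M\<^esub> = \<zero>\<^bsub>base_change (sym_alg S) RT \<rho> M\<^esub>"
    using null_zero tensor_one_eq_K_iff by (simp add: base_change_sel)
  then show "mpart (extend_to_RT S \<rho> M) k \<subseteq> {\<zero>\<^bsub>extend_to_RT S \<rho> M\<^esub>}" if "mpart M k \<subseteq> {\<zero>\<^bsub>M\<^esub>}"
    using that unfolding extend_to_RT_def tensor_one_parts by auto
qed

section \<open>The modules on the edges out of a vertex\<close>

context graded_mod
begin

lemma smult_image_subgroup:
  assumes r: "r \<in> carrier R"
  shows "abelian_subgroup (smult_image r M) M"
proof (rule abelian_subgroupI3[OF _ M.abelian_group_axioms], rule additive_subgroupI,
    rule group.subgroupI[OF M.a_group])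
  show "smult_image r M \<subseteq> carrier (add_monoid M)" using r by (auto simp: smult_image_def)
  show "smult_image r M \<noteq> {}" by (auto simp: smult_image_def)
  fix a b assume "a \<in> smult_image r M" "b \<in> smult_image r M"
  then obtain u v where u: "u \<in> carrier M" "a = r \<odot>\<^bsub>M\<^esub> u" and v: "v \<in> carrier M" "b = r \<odot>\<^bsub>M\<^esub> v"
    by (auto simp: smult_image_def)
  have "\<ominus>\<^bsub>M\<^esub> a = r \<odot>\<^bsub>M\<^esub> (\<ominus>\<^bsub>M\<^esub> u)" using r u by (simp add: smult_r_minus)
  then show "inv\<^bsub>add_monoid M\<^esub> a \<in> smult_image r M"
    using u(1) by (auto simp: smult_image_def a_inv_def[symmetric])
  have "a \<oplus>\<^bsub>M\<^esub> b = r \<odot>\<^bsub>M\<^esub> (u \<oplus>\<^bsub>M\<^esub> v)" using r u v by (simp add: smult_r_distr)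
  then show "a \<otimes>\<^bsub>add_monoid M\<^esub> b \<in> smult_image r M"
    using u(1) v(1) by (auto simp: smult_image_def)
qed

lemma component_smult_image:
  assumes r: "r \<in> D i" and u: "u \<in> smult_image r M"
  shows "component M k u \<in> smult_image r M"
proof -
  obtain v where v: "v \<in> carrier M" "u = r \<odot>\<^bsub>M\<^esub> v" using u by (auto simp: smult_image_def)
  have "component M k u = r \<odot>\<^bsub>M\<^esub> component M (k - i) v"
    using component_smult[OF r v(1), of "k - i"] v(2) by simp
  then show ?thesis using v(1) by (auto simp: smult_image_def)
qed

text \<open>A component of $u$ is mapped to the class of an element of its own degree. If the sum of these
  classes is homogeneous of degree $k$, then the elements of all other degrees lie in $rM$, because
  $rM$ is homogeneous. The zero class is homogeneous of every degree, so this includes that the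
  kernel of \<open>g\<close> is homogeneous.\<close>

lemma graded_hom_to_quotient_homogeneous:
  fixes P :: "('a, 'p) gmodule"
  assumes P: "graded_mod R D P" and r: "r \<in> D i"
    and g: "graded_hom R P (graded_quot M (smult_image r M)) g"
  shows "g \<zero>\<^bsub>P\<^esub> = smult_image r M"
    and "\<lbrakk>u \<in> carrier P; g u \<in> mpart (graded_quot M (smult_image r M)) k; j \<noteq> k\<rbrakk> \<Longrightarrow>
      g (component P j u) = smult_image r M"
proof -
  interpret P: graded_mod R D P by (rule P)
  let ?N = "smult_image r M"
  have rR: "r \<in> carrier R" using r degree_parts by blast
  interpret N: abelian_subgroup ?N M by (rule smult_image_subgroup[OF rR])
  have N_iff: "?N +>\<^bsub>M\<^esub> a = ?N \<longleftrightarrow> a \<in> ?N" if "a \<in> carrier M" for a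
    using N.a_rcos_const N.a_rcos_self[OF that] by metis
  have add: "g (u \<oplus>\<^bsub>P\<^esub> v) = g u <+>\<^bsub>M\<^esub> g v" if "u \<in> carrier P" "v \<in> carrier P" for u v
    using g that by (simp add: graded_hom_def graded_quot_def)
  have parts: "\<exists>a\<in>mpart M k. g u = ?N +>\<^bsub>M\<^esub> a" if "u \<in> mpart P k" for u k
  proof -
    have "g u \<in> mpart (graded_quot M ?N) k" using g that unfolding graded_hom_def by blast
    then show ?thesis by (auto simp: graded_quot_def)
  qed
  show zero: "g \<zero>\<^bsub>P\<^esub> = ?N"
  proof -
    obtain a where a: "a \<in> mpart M 0" "g \<zero>\<^bsub>P\<^esub> = ?N +>\<^bsub>M\<^esub> a" using parts[OF P.zero_in_part] by blast
    have aC: "a \<in> carrier M" using a part_closed by blast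
    have "?N +>\<^bsub>M\<^esub> (a \<oplus>\<^bsub>M\<^esub> a) = ?N +>\<^bsub>M\<^esub> a"
      using add[of "\<zero>\<^bsub>P\<^esub>" "\<zero>\<^bsub>P\<^esub>"] N.a_rcos_sum[OF aC aC] a(2) by simp
    then have "a \<oplus>\<^bsub>M\<^esub> a \<in> ?N +>\<^bsub>M\<^esub> a" using N.a_rcos_self[of "a \<oplus>\<^bsub>M\<^esub> a"] aC by simp
    from N.a_rcos_module_imp[OF aC this] have "a \<in> ?N" using aC by (simp add: M.a_assoc M.r_neg)
    then show ?thesis using N_iff[OF aC] a(2) by simp
  qed
  assume u: "u \<in> carrier P" and gu: "g u \<in> mpart (graded_quot M ?N) k" and jk: "j \<noteq> k"
  let ?A = "{l. component P l u \<noteq> \<zero>\<^bsub>P\<^esub>}"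
  have fin: "finite ?A" by (rule P.finite_support_component[OF u])
  have "\<exists>a\<in>mpart M l. g (component P l u) = ?N +>\<^bsub>M\<^esub> a \<and> (l \<notin> ?A \<longrightarrow> a = \<zero>\<^bsub>M\<^esub>)" for l
  proof (cases "l \<in> ?A")
    case True
    then show ?thesis using parts[OF P.component_in_part[OF u]] by blast
  next
    case False
    then show ?thesis using zero N_iff[of "\<zero>\<^bsub>M\<^esub>"] N.zero_closed zero_in_part[of l] by (intro bexI[of _ "\<zero>\<^bsub>M\<^esub>"]) auto
  qed
  then obtain a where a: "\<And>l. a l \<in> mpart M l" "\<And>l. g (component P l u) = ?N +>\<^bsub>M\<^esub> a l"
    "\<And>l. l \<notin> ?A \<Longrightarrow> a l = \<zero>\<^bsub>M\<^esub>" by metis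
  have aC: "a l \<in> carrier M" for l using a(1) part_closed by blast
  have sum: "g (\<Oplus>\<^bsub>P\<^esub>l\<in>B. component P l u) = ?N +>\<^bsub>M\<^esub> (\<Oplus>\<^bsub>M\<^esub>l\<in>B. a l)" if "finite B" for B
    using that
  proof induction
    case empty
    then show ?case using zero N_iff[of "\<zero>\<^bsub>M\<^esub>"] N.zero_closed by simp
  next
    case (insert l B)
    then show ?case using u aC a(2) by (simp add: Pi_def add N.a_rcos_sum)
  qed
  let ?s = "\<Oplus>\<^bsub>M\<^esub>l\<in>?A. a l"
  have sC: "?s \<in> carrier M" using aC by simp
  have comp_s: "component M l ?s = a l" for l
    by (rule component_unique[OF a(1) fin]) (use a(3) in auto)
  obtain b where b: "b \<in> mpart M k" "g u = ?N +>\<^bsub>M\<^esub> b" using gu by (auto simp: graded_quot_def)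
  have bC: "b \<in> carrier M" using b part_closed by blast
  have "?N +>\<^bsub>M\<^esub> ?s = ?N +>\<^bsub>M\<^esub> b" using sum[OF fin] P.sum_components[OF u] b(2) by simp
  then have "?s \<in> ?N +>\<^bsub>M\<^esub> b" using N.a_rcos_self[OF sC] by simp
  from N.a_rcos_module_imp[OF bC this] have "?s \<oplus>\<^bsub>M\<^esub> \<ominus>\<^bsub>M\<^esub> b \<in> ?N" .
  from component_smult_image[OF r this, of j]
  have "a j \<oplus>\<^bsub>M\<^esub> \<ominus>\<^bsub>M\<^esub> component M j b \<in> ?N"
    using sC bC by (simp add: component_add component_neg comp_s)
  moreover have "component M j b = \<zero>\<^bsub>M\<^esub>" using component_homogeneous[OF b(1), of j] jk by simp
  moreover have "\<ominus>\<^bsub>M\<^esub> \<zero>\<^bsub>M\<^esub> = \<zero>\<^bsub>M\<^esub>" by (rule M.minus_equality) simp_all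
  ultimately have "a j \<in> ?N" using aC by simp
  then show "g (component P j u) = ?N" using a(2) N_iff[OF aC] by simp
qed

end

text \<open>The module $B^{\delta y}$ is the image of its projective cover $B^y$ under the maps to the edge
  modules, and their kernels are homogeneous, so it inherits the grading of $B^y$. It is also contained in
  the sum of the edge modules, so it vanishes in a degree where these vanish.\<close>

lemma delta_module_graded:
  fixes B :: "('w, 'm) bruhat_sheaf" and W :: "('w, 'b) monoid_scheme" and S :: "'w set"
  defines "R \<equiv> sym_alg S" and "D \<equiv> rpart (sym_alg S)"
  assumes stalks: "\<And>z. z \<in> carrier W \<Longrightarrow> graded_module R D (stalk B z)"
    and edges: "\<And>E. E \<in> edges_from W S y \<Longrightarrow>
      emod B E = graded_quot (stalk B (snd E)) (smult_image (edge_label W S \<alpha> E) (stalk B (snd E))) \<and>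
      graded_hom R (stalk B y) (emod B E) (rest B y E)"
    and y: "y \<in> carrier W"
    and cover: "projective_cover R D (stalk B y) (delta_module W S B y)
      (\<lambda>m. \<lambda>E\<in>edges_from W S y. rest B y E m)"
  shows "graded_module R D (delta_module W S B y)"
    and "(\<And>E. E \<in> edges_from W S y \<Longrightarrow> mpart (stalk B (snd E)) k \<subseteq> {\<zero>\<^bsub>stalk B (snd E)\<^esub>}) \<Longrightarrow>
      mpart (delta_module W S B y) k \<subseteq> {\<zero>\<^bsub>delta_module W S B y\<^esub>}"
proof -
  let ?Es = "edges_from W S y"
  let ?P = "stalk B y"
  let ?Q = "delta_module W S B y"
  let ?N = "\<lambda>E. smult_image (edge_label W S \<alpha> E) (stalk B (snd E))"
  define p where "p = (\<lambda>m. \<lambda>E\<in>?Es. rest B y E m)"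
  have Dsub: "D i \<subseteq> carrier R" for i by (simp add: D_def R_def rpart_sym_alg_closed)
  have gm: "graded_mod R D (stalk B z)" if "z \<in> carrier W" for z
    by (rule graded_modI[OF stalks[OF that] Dsub])
  interpret P: graded_mod R D ?P by (rule gm[OF y])
  have p_hom: "graded_hom R ?P ?Q p" and p_surj: "p ` carrier ?P = carrier ?Q"
    using cover by (simp_all add: projective_cover_def p_def)
  have E: "snd E \<in> carrier W" "edge_label W S \<alpha> E \<in> D 2" if "E \<in> ?Es" for E
    using that sym_vec_in_rpart by (auto simp: edges_from_def bruhat_edges_def edge_label_def D_def)
  have quot: "rest B y E \<zero>\<^bsub>?P\<^esub> = ?N E"
    "\<And>u k j. \<lbrakk>u \<in> carrier ?P; rest B y E u \<in> mpart (emod B E) k; j \<noteq> k\<rbrakk> \<Longrightarrow>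
      rest B y E (component ?P j u) = ?N E" if e: "E \<in> ?Es" for E
  proof -
    have hom: "graded_hom R ?P (graded_quot (stalk B (snd E)) (?N E)) (rest B y E)"
      using edges[OF e] by metis
    note q = graded_mod.graded_hom_to_quotient_homogeneous[OF gm[OF E(1)[OF e]] P.graded_mod_axioms E(2)[OF e] hom]
    show "rest B y E \<zero>\<^bsub>?P\<^esub> = ?N E" by (rule q(1))
    show "rest B y E (component ?P j u) = ?N E"
      if "u \<in> carrier ?P" "rest B y E u \<in> mpart (emod B E) k" "j \<noteq> k" for u k j
      using q(2)[OF that(1) _ that(3)] that(2) edges[OF e] by metis
  qed
  have zeroQ: "\<zero>\<^bsub>?Q\<^esub> = (\<lambda>E\<in>?Es. ?N E)"
    using edges by (auto simp: delta_module_def restrict_module_def direct_sum_def Let_def graded_quot_def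
        intro!: restrict_ext)
  have partQ: "f E \<in> mpart (emod B E) k" if "f \<in> mpart ?Q k" "E \<in> ?Es" for f k E
    using that by (auto simp: delta_module_def restrict_module_def direct_sum_def Let_def)
  have p_zero: "p \<zero>\<^bsub>?P\<^esub> = \<zero>\<^bsub>?Q\<^esub>"
    unfolding zeroQ p_def using quot(1) by (intro restrict_ext) simp
  have p_add: "p (u \<oplus>\<^bsub>?P\<^esub> v) = p u \<oplus>\<^bsub>?Q\<^esub> p v" if "u \<in> carrier ?P" "v \<in> carrier ?P" for u v
    using p_hom that by (simp add: graded_hom_def)
  have p_comp: "p (component ?P j u) = \<zero>\<^bsub>?Q\<^esub>"
    if u: "u \<in> carrier ?P" "\<And>E. E \<in> ?Es \<Longrightarrow> rest B y E u \<in> mpart (emod B E) k" and "j \<noteq> k" for u j k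
    unfolding zeroQ p_def using quot(2)[OF _ u(1) u(2) \<open>j \<noteq> k\<close>] by (intro restrict_ext) simp
  interpret Q: abelian_group ?Q
    by (rule image_abelian_group[OF P.M.abelian_group_axioms p_surj p_add p_zero])
  have pC: "p u \<in> carrier ?Q" if "u \<in> carrier ?P" for u using that p_surj by blast
  have parts: "mpart ?Q k = p ` mpart ?P k" for k
  proof
    show "p ` mpart ?P k \<subseteq> mpart ?Q k" using p_hom by (simp add: graded_hom_def)
    show "mpart ?Q k \<subseteq> p ` mpart ?P k"
    proof
      fix f assume f: "f \<in> mpart ?Q k"
      then have "f \<in> carrier ?Q" by (simp add: delta_module_def restrict_module_def)
      then obtain u where u: "u \<in> carrier ?P" "f = p u" using p_surj by blast
      have "rest B y E u \<in> mpart (emod B E) k" if "E \<in> ?Es" for E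
        using partQ[OF f that] that by (simp add: u(2) p_def)
      from p_comp[OF u(1) this] have other: "p (component ?P j u) = \<zero>\<^bsub>?Q\<^esub>" if "j \<noteq> k" for j
        using that by blast
      have sum: "p (\<Oplus>\<^bsub>?P\<^esub>j\<in>A. component ?P j u) = p (if k \<in> A then component ?P k u else \<zero>\<^bsub>?P\<^esub>)"
        if "finite A" for A
        using that
      proof induction
        case (insert j A)
        have "p (\<Oplus>\<^bsub>?P\<^esub>j\<in>insert j A. component ?P j u)
            = p (component ?P j u) \<oplus>\<^bsub>?Q\<^esub> p (\<Oplus>\<^bsub>?P\<^esub>j\<in>A. component ?P j u)"
          using insert u(1) by (simp add: Pi_def p_add)
        then show ?case
          using insert other[of j] u(1) pC p_zero by (cases "j = k") auto
      qed simp
      let ?A = "{j. component ?P j u \<noteq> \<zero>\<^bsub>?P\<^esub>}"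
      have "p u = p (component ?P k u)"
        using sum[OF P.finite_support_component[OF u(1)]] P.sum_components[OF u(1)] by auto
      then show "f \<in> p ` mpart ?P k" using u P.component_in_part by blast
    qed
  qed
  show "graded_module R D ?Q"
  proof (rule P.graded_module_image[where \<sigma> = "\<lambda>a. a" and \<psi> = p, OF P.R.cring_axioms _ _ p_surj p_add p_zero _ Dsub parts])
    show "(\<lambda>a. a) \<in> ring_hom R R" by (rule ring_hom_memI) auto
    show "p (a \<odot>\<^bsub>?P\<^esub> u) = a \<odot>\<^bsub>?Q\<^esub> p u" if "a \<in> carrier R" "u \<in> carrier ?P" for a u
      using p_hom that by (simp add: graded_hom_def)
    show "p (component ?P k u) = \<zero>\<^bsub>?Q\<^esub>" if u: "u \<in> carrier ?P" "p u = \<zero>\<^bsub>?Q\<^esub>" for u k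
    proof (rule p_comp[where k = "k + 1", OF u(1)])
      fix E assume e: "E \<in> ?Es"
      have "rest B y E u = ?N E" using fun_cong[OF u(2), of E] e by (simp add: p_def zeroQ)
      moreover have "rest B y E \<zero>\<^bsub>?P\<^esub> \<in> mpart (emod B E) (k + 1)"
        using edges[OF e] P.zero_in_part unfolding graded_hom_def by blast
      ultimately show "rest B y E u \<in> mpart (emod B E) (k + 1)" using quot(1)[OF e] by simp
    qed simp
  qed simp
  show "mpart ?Q k \<subseteq> {\<zero>\<^bsub>?Q\<^esub>}"
    if triv: "\<And>E. E \<in> ?Es \<Longrightarrow> mpart (stalk B (snd E)) k \<subseteq> {\<zero>\<^bsub>stalk B (snd E)\<^esub>}"
  proof
    fix f assume f: "f \<in> mpart ?Q k"
    then obtain u where u: "f = p u" using parts by blast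
    have "f E = ?N E" if e: "E \<in> ?Es" for E
    proof -
      interpret G: graded_mod R D "stalk B (snd E)" by (rule gm[OF E(1)[OF e]])
      interpret N: abelian_subgroup "?N E" "stalk B (snd E)"
        by (rule G.smult_image_subgroup) (use E(2)[OF e] Dsub in blast)
      have "f E \<in> (\<lambda>m. ?N E +>\<^bsub>stalk B (snd E)\<^esub> m) ` mpart (stalk B (snd E)) k"
        using partQ[OF f e] edges[OF e] by (simp add: graded_quot_def)
      then show ?thesis using triv[OF e] N.a_rcos_const[OF N.zero_closed] by auto
    qed
    then show "f \<in> {\<zero>\<^bsub>?Q\<^esub>}" unfolding zeroQ u p_def by (auto intro!: restrict_ext)
  qed
qed

section \<open>Degrees of the stalks\<close>

definition positive_ideal :: "'w set \<Rightarrow> (('w \<Rightarrow>\<^sub>0 nat) \<Rightarrow>\<^sub>0 real) set" where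
  "positive_ideal S = {p \<in> sym_carrier S. 0 \<notin> Poly_Mapping.keys p}"

lemma positive_ideal_add: "p \<in> positive_ideal S \<Longrightarrow> q \<in> positive_ideal S \<Longrightarrow> p + q \<in> positive_ideal S"
  using keys_add[of p q] by (auto simp: positive_ideal_def sym_carrier_add)

lemma positive_ideal_mult:
  assumes "p \<in> positive_ideal S" "q \<in> sym_carrier S"
  shows "p * q \<in> positive_ideal S"
proof -
  have "0 \<notin> Poly_Mapping.keys (p * q)"
  proof
    assume "0 \<in> Poly_Mapping.keys (p * q)"
    from subsetD[OF keys_mult this] obtain a b where ab: "0 = a + b" "a \<in> Poly_Mapping.keys p" by blast
    then have "Poly_Mapping.keys a \<union> Poly_Mapping.keys b = {}" using keys_add_nat[of a b] by simp
    then have "a = 0" by simp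
    then show False using ab(2) assms(1) by (simp add: positive_ideal_def)
  qed
  then show ?thesis using assms by (simp add: positive_ideal_def sym_carrier_mult)
qed

lemma rpart_positive_ideal: "0 < k \<Longrightarrow> rpart (sym_alg S) k \<subseteq> positive_ideal S"
  by (force simp: rpart_sym_alg positive_ideal_def)

lemma one_notin_positive_ideal: "1 \<notin> positive_ideal S"
  by (simp add: positive_ideal_def)

text \<open>The elements whose coordinates lie in the augmentation ideal $S_{>0}$ form a submodule, which
  contains $S_{>0} \cdot P$. A basis element has a coordinate $1$, which is not in this ideal.\<close>

lemma basis_not_in_positive_part:
  fixes P :: "(('w \<Rightarrow>\<^sub>0 nat) \<Rightarrow>\<^sub>0 real, 'm, 'x) gmodule_scheme"
  assumes P: "module (sym_alg S) P" and X: "X \<subseteq> carrier P"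
    and basis: "\<forall>x\<in>carrier P. \<exists>!c. (\<forall>b\<in>X. c b \<in> carrier (sym_alg S)) \<and>
      (\<forall>b. b \<notin> X \<longrightarrow> c b = \<zero>\<^bsub>sym_alg S\<^esub>) \<and> finite {b. c b \<noteq> \<zero>\<^bsub>sym_alg S\<^esub>} \<and>
      x = (\<Oplus>\<^bsub>P\<^esub>b\<in>{b. c b \<noteq> \<zero>\<^bsub>sym_alg S\<^esub>}. c b \<odot>\<^bsub>P\<^esub> b)"
    and b: "b \<in> X"
  shows "b \<notin> positive_part_span (sym_alg S) (rpart (sym_alg S)) P"
proof
  interpret P: module "sym_alg S" P by (rule P)
  define C where "C x c \<longleftrightarrow> (\<forall>b\<in>X. c b \<in> sym_carrier S) \<and> (\<forall>b. b \<notin> X \<longrightarrow> c b = 0) \<and>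
      finite {b. c b \<noteq> 0} \<and> x = (\<Oplus>\<^bsub>P\<^esub>b\<in>{b. c b \<noteq> 0}. c b \<odot>\<^bsub>P\<^esub> b)" for x c
  have ex1: "\<exists>!c. C x c" if "x \<in> carrier P" for x
    using bspec[OF basis that] by (simp add: C_def)
  have zeroC: "0 \<in> sym_carrier S" by (simp add: sym_carrier_def)
  have cC: "c d \<in> sym_carrier S" if "C x c" for x c d
    using that zeroC by (cases "d \<in> X") (auto simp: C_def)
  have sm: "r \<odot>\<^bsub>P\<^esub> u \<in> carrier P" if "r \<in> sym_carrier S" "u \<in> carrier P" for r u
    using P.smult_closed[of r u] that by simp
  have z: "0 \<odot>\<^bsub>P\<^esub> u = \<zero>\<^bsub>P\<^esub>" if "u \<in> carrier P" for u using P.smult_l_null[of u] that by simp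
  \<comment> \<open>The support may be enlarged to any finite subset of the basis.\<close>
  have CI: "C x c"
    if c: "\<And>b. c b \<in> sym_carrier S" and F: "finite F" "F \<subseteq> X" "\<And>b. b \<notin> F \<Longrightarrow> c b = 0"
      and x: "x = (\<Oplus>\<^bsub>P\<^esub>b\<in>F. c b \<odot>\<^bsub>P\<^esub> b)" for x c F
  proof -
    have sub: "{b. c b \<noteq> 0} \<subseteq> F" using F(3) by blast
    have "(\<Oplus>\<^bsub>P\<^esub>b\<in>F. c b \<odot>\<^bsub>P\<^esub> b) = (\<Oplus>\<^bsub>P\<^esub>b\<in>{b. c b \<noteq> 0}. c b \<odot>\<^bsub>P\<^esub> b)"
      by (rule P.M.add.finprod_mono_neutral_cong_right) (use F sub c X z sm in auto)
    then show ?thesis using c F sub x finite_subset[OF sub F(1)] unfolding C_def by auto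
  qed
  have CF: "x = (\<Oplus>\<^bsub>P\<^esub>b\<in>F. c b \<odot>\<^bsub>P\<^esub> b)"
    if c: "C x c" and F: "finite F" "F \<subseteq> X" "{b. c b \<noteq> 0} \<subseteq> F" for x c F
  proof -
    have "(\<Oplus>\<^bsub>P\<^esub>b\<in>F. c b \<odot>\<^bsub>P\<^esub> b) = (\<Oplus>\<^bsub>P\<^esub>b\<in>{b. c b \<noteq> 0}. c b \<odot>\<^bsub>P\<^esub> b)"
      by (rule P.M.add.finprod_mono_neutral_cong_right) (use F cC[OF c] X z sm in auto)
    then show ?thesis using c by (simp add: C_def)
  qed
  define H where "H = {x \<in> carrier P. \<exists>c. C x c \<and> (\<forall>b. c b \<in> positive_ideal S)}"
  have addH: "x \<oplus>\<^bsub>P\<^esub> y \<in> H" if xH: "x \<in> H" and yH: "y \<in> H" for x y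
  proof -
    obtain c where c: "C x c" "\<And>b. c b \<in> positive_ideal S" and xC: "x \<in> carrier P"
      using xH by (auto simp: H_def)
    obtain c' where c': "C y c'" "\<And>b. c' b \<in> positive_ideal S" and yC: "y \<in> carrier P"
      using yH by (auto simp: H_def)
    let ?F = "{b. c b \<noteq> 0} \<union> {b. c' b \<noteq> 0}"
    have F: "finite ?F" "?F \<subseteq> X" using c(1) c'(1) by (auto simp: C_def)
    have xs: "x = (\<Oplus>\<^bsub>P\<^esub>b\<in>?F. c b \<odot>\<^bsub>P\<^esub> b)" and ys: "y = (\<Oplus>\<^bsub>P\<^esub>b\<in>?F. c' b \<odot>\<^bsub>P\<^esub> b)"
      using CF[OF c(1) F] CF[OF c'(1) F] by auto
    have "x \<oplus>\<^bsub>P\<^esub> y = (\<Oplus>\<^bsub>P\<^esub>b\<in>?F. c b \<odot>\<^bsub>P\<^esub> b \<oplus>\<^bsub>P\<^esub> c' b \<odot>\<^bsub>P\<^esub> b)"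
      unfolding xs ys using sm cC[OF c(1)] cC[OF c'(1)] F(2) X
      by (intro P.M.finsum_addf[symmetric]) auto
    also have "\<dots> = (\<Oplus>\<^bsub>P\<^esub>b\<in>?F. (c b + c' b) \<odot>\<^bsub>P\<^esub> b)"
    proof (rule P.M.finsum_cong'[OF HOL.refl])
      fix b assume "b \<in> ?F"
      then have bC: "b \<in> carrier P" using F(2) X by blast
      show "c b \<odot>\<^bsub>P\<^esub> b \<oplus>\<^bsub>P\<^esub> c' b \<odot>\<^bsub>P\<^esub> b = (c b + c' b) \<odot>\<^bsub>P\<^esub> b"
        using P.smult_l_distr[of "c b" "c' b" b] cC[OF c(1)] cC[OF c'(1)] bC by simp
    qed (use sm cC[OF c(1)] cC[OF c'(1)] F(2) X in \<open>auto simp: sym_carrier_add\<close>)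
    finally have "C (x \<oplus>\<^bsub>P\<^esub> y) (\<lambda>b. c b + c' b)"
      by (intro CI[OF _ F]) (use cC[OF c(1)] cC[OF c'(1)] in \<open>auto simp: sym_carrier_add\<close>)
    then show ?thesis
      using xC yC positive_ideal_add[OF c(2) c'(2)]
      unfolding H_def by (auto intro!: exI[of _ "\<lambda>b. c b + c' b"])
  qed
  have smult: "\<exists>c'. C (r \<odot>\<^bsub>P\<^esub> x) c' \<and> (\<forall>b. c' b = r * c b)"
    if r: "r \<in> sym_carrier S" and c: "C x c" for r x c
  proof -
    let ?F = "{b. c b \<noteq> 0}"
    have F: "finite ?F" "?F \<subseteq> X" using c by (auto simp: C_def)
    have xs: "x = (\<Oplus>\<^bsub>P\<^esub>b\<in>?F. c b \<odot>\<^bsub>P\<^esub> b)" using c by (simp add: C_def)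
    have "r \<odot>\<^bsub>P\<^esub> x = (\<Oplus>\<^bsub>P\<^esub>b\<in>?F. r \<odot>\<^bsub>P\<^esub> (c b \<odot>\<^bsub>P\<^esub> b))"
      unfolding xs using F sm cC[OF c] X r by (intro P.finsum_smult_ldistr) auto
    also have "\<dots> = (\<Oplus>\<^bsub>P\<^esub>b\<in>?F. (r * c b) \<odot>\<^bsub>P\<^esub> b)"
    proof (rule P.M.finsum_cong'[OF HOL.refl])
      fix b assume "b \<in> ?F"
      then have bC: "b \<in> carrier P" using F(2) X by blast
      show "r \<odot>\<^bsub>P\<^esub> (c b \<odot>\<^bsub>P\<^esub> b) = (r * c b) \<odot>\<^bsub>P\<^esub> b"
        using P.smult_assoc1[of r "c b" b] r cC[OF c] bC by simp
    qed (use sm cC[OF c] F(2) X r in \<open>auto simp: sym_carrier_mult\<close>)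
    finally have "C (r \<odot>\<^bsub>P\<^esub> x) (\<lambda>b. r * c b)"
      by (intro CI[OF _ F]) (use cC[OF c] r in \<open>auto simp: sym_carrier_mult\<close>)
    then show ?thesis by (intro exI[of _ "\<lambda>b. r * c b"]) simp
  qed
  have zeroH: "\<zero>\<^bsub>P\<^esub> \<in> H"
  proof -
    have "C \<zero>\<^bsub>P\<^esub> (\<lambda>_. 0)" using zeroC by (simp add: C_def)
    moreover have "0 \<in> positive_ideal S" using zeroC by (simp add: positive_ideal_def)
    ultimately show ?thesis unfolding H_def by auto
  qed
  have smH: "r \<odot>\<^bsub>P\<^esub> x \<in> H" if r: "r \<in> sym_carrier S" and xH: "x \<in> H" for r x
  proof -
    obtain c where c: "C x c" "\<And>b. c b \<in> positive_ideal S" and xC: "x \<in> carrier P"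
      using xH by (auto simp: H_def)
    obtain c' where c': "C (r \<odot>\<^bsub>P\<^esub> x) c'" "\<And>b. c' b = r * c b" using smult[OF r c(1)] by blast
    have "c' b \<in> positive_ideal S" for b
      using positive_ideal_mult[OF c(2) r, of b] by (simp add: c'(2) mult.commute)
    then show ?thesis using c'(1) sm[OF r xC] by (auto simp: H_def)
  qed
  have genH: "r \<odot>\<^bsub>P\<^esub> m \<in> H" if k: "0 < k" and r: "r \<in> rpart (sym_alg S) k" and m: "m \<in> carrier P" for r m k
  proof -
    have rp: "r \<in> positive_ideal S" and rC: "r \<in> sym_carrier S"
      using subsetD[OF rpart_positive_ideal[OF k] r] subsetD[OF rpart_sym_alg_closed r] by auto
    obtain c where c: "C m c" using ex1[OF m] by blast
    obtain c' where c': "C (r \<odot>\<^bsub>P\<^esub> m) c'" "\<And>b. c' b = r * c b" using smult[OF rC c] by blast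
    have "c' b \<in> positive_ideal S" for b
      using positive_ideal_mult[OF rp cC[OF c], of b] by (simp add: c'(2))
    then show ?thesis using c'(1) sm[OF rC m] by (auto simp: H_def)
  qed
  have "submodule H (sym_alg S) P"
  proof (rule P.submoduleI)
    show "H \<subseteq> carrier P" by (auto simp: H_def)
    show "\<ominus>\<^bsub>P\<^esub> a \<in> H" if a: "a \<in> H" for a
    proof -
      have aC: "a \<in> carrier P" using a by (simp add: H_def)
      have m1: "- 1 \<in> sym_carrier S" by (simp add: sym_carrier_def)
      have "(- 1) \<odot>\<^bsub>P\<^esub> a \<oplus>\<^bsub>P\<^esub> a = (- 1 + 1) \<odot>\<^bsub>P\<^esub> a"
        using P.smult_l_distr[of "- 1" 1 a] P.smult_one[OF aC] P.R.one_closed aC m1 by simp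
      then have "(- 1) \<odot>\<^bsub>P\<^esub> a \<oplus>\<^bsub>P\<^esub> a = \<zero>\<^bsub>P\<^esub>" using z[OF aC] by simp
      then have "\<ominus>\<^bsub>P\<^esub> a = (- 1) \<odot>\<^bsub>P\<^esub> a" using sm[OF m1 aC] aC by (simp add: P.M.minus_equality)
      then show ?thesis using smH[OF m1 a] by simp
    qed
  qed (use zeroH addH smH in auto)
  then have "positive_part_span (sym_alg S) (rpart (sym_alg S)) P \<subseteq> H"
    unfolding positive_part_span_def mod_span_def using genH by blast
  moreover assume "b \<in> positive_part_span (sym_alg S) (rpart (sym_alg S)) P"
  ultimately have "b \<in> H" by blast
  then obtain c where c: "C b c" "\<And>d. c d \<in> positive_ideal S" and bC: "b \<in> carrier P"
    unfolding H_def by blast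
  have "C b (\<lambda>d. if d = b then 1 else 0)"
    by (rule CI[where F = "{b}"]) (use b bC P.smult_one[OF bC] P.R.one_closed zeroC in auto)
  then have "c = (\<lambda>d. if d = b then 1 else 0)" using ex1[OF bC] c(1) by blast
  then show False using c(2)[of b] one_notin_positive_ideal[of S] by simp
qed

text \<open>A homogeneous basis element of negative degree would be mapped to zero, and hence lie in
  $S_{>0} \cdot P$, since the kernel of the cover is contained there. So the basis lies in
  degrees $\ge 0$, and so does the module, since the ring does. Minimality of the cover is
  essential: a free module with a superfluous generator could start in any degree.\<close>

lemma projective_cover_nonnegative:
  fixes P :: "(('w \<Rightarrow>\<^sub>0 nat) \<Rightarrow>\<^sub>0 real, 'm) gmodule"
  assumes cover: "projective_cover (sym_alg S) (rpart (sym_alg S)) P Q p"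
    and Q: "\<And>k. k < 0 \<Longrightarrow> mpart Q k \<subseteq> {\<zero>\<^bsub>Q\<^esub>}" and k: "k < 0"
  shows "mpart P k \<subseteq> {\<zero>\<^bsub>P\<^esub>}"
proof -
  have "graded_module (sym_alg S) (rpart (sym_alg S)) P"
    using cover by (simp add: projective_cover_def graded_free_def)
  then interpret P: graded_mod "sym_alg S" "rpart (sym_alg S)" P
    by (rule graded_modI) (simp add: rpart_sym_alg_closed)
  obtain X where X: "X \<subseteq> (\<Union>k. mpart P k)"
    and basis: "\<forall>x\<in>carrier P. \<exists>!c. (\<forall>b\<in>X. c b \<in> carrier (sym_alg S)) \<and>
      (\<forall>b. b \<notin> X \<longrightarrow> c b = \<zero>\<^bsub>sym_alg S\<^esub>) \<and> finite {b. c b \<noteq> \<zero>\<^bsub>sym_alg S\<^esub>} \<and>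
      x = (\<Oplus>\<^bsub>P\<^esub>b\<in>{b. c b \<noteq> \<zero>\<^bsub>sym_alg S\<^esub>}. c b \<odot>\<^bsub>P\<^esub> b)"
    using cover unfolding projective_cover_def graded_free_def by blast
  have p_parts: "p ` mpart P k \<subseteq> mpart Q k" for k
    using cover by (simp add: projective_cover_def graded_hom_def)
  have XC: "X \<subseteq> carrier P" using X P.part_closed by blast
  have X_degree: "\<exists>j\<ge>0. b \<in> mpart P j" if b: "b \<in> X" for b
  proof -
    obtain j where j: "b \<in> mpart P j" using X b by blast
    have "0 \<le> j"
    proof (rule ccontr)
      assume "\<not> 0 \<le> j"
      then have "p b = \<zero>\<^bsub>Q\<^esub>"
        using p_parts[of j] Q[of j] j by auto
      then have "b \<in> a_kernel P Q p" using XC b by (auto simp: a_kernel_def')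
      then have "b \<in> positive_part_span (sym_alg S) (rpart (sym_alg S)) P"
        using cover by (auto simp: projective_cover_def)
      then show False
        using basis_not_in_positive_part[OF P.module_axioms XC basis b] by contradiction
    qed
    then show ?thesis using j by blast
  qed
  define G where "G = {x \<in> carrier P. \<forall>j<0. component P j x = \<zero>\<^bsub>P\<^esub>}"
  have G_add: "x \<oplus>\<^bsub>P\<^esub> y \<in> G" if "x \<in> G" "y \<in> G" for x y
    using that by (auto simp: G_def P.component_add)
  have G_zero: "\<zero>\<^bsub>P\<^esub> \<in> G" by (simp add: G_def)
  have G_part: "mpart P j \<subseteq> G" if "0 \<le> j" for j
    using that P.component_homogeneous P.part_closed by (auto simp: G_def)
  have G_smult: "r \<odot>\<^bsub>P\<^esub> b \<in> G" if r: "r \<in> sym_carrier S" and b: "b \<in> X" for r b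
  proof -
    obtain j where j: "0 \<le> j" "b \<in> mpart P j" using X_degree[OF b] by blast
    have bC: "b \<in> carrier P" using XC b by blast
    have "sym_carrier S \<subseteq> {r \<in> sym_carrier S. r \<odot>\<^bsub>P\<^esub> b \<in> G}"
    proof (rule sym_alg_generated_by_homogeneous, safe)
      fix i r assume r: "r \<in> rpart (sym_alg S) i"
      then show "r \<in> sym_carrier S" using rpart_sym_alg_closed by blast
      show "r \<odot>\<^bsub>P\<^esub> b \<in> G"
      proof (cases "i < 0")
        case True
        then show ?thesis using rpart_sym_alg_negative[OF True r] P.smult_l_null[OF bC] G_zero by simp
      next
        case False
        then show ?thesis using P.smult_in_part[OF r j(2)] G_part[of "i + j"] j(1) by auto
      qed
    next
      fix a c assume "a \<in> sym_carrier S" "c \<in> sym_carrier S" "a \<odot>\<^bsub>P\<^esub> b \<in> G" "c \<odot>\<^bsub>P\<^esub> b \<in> G"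
      then show "(a + c) \<odot>\<^bsub>P\<^esub> b \<in> G" using P.smult_l_distr[of a c b] bC G_add by simp
    qed (rule sym_carrier_add)
    then show ?thesis using r by blast
  qed
  show ?thesis
  proof
    fix u assume u: "u \<in> mpart P k"
    have uC: "u \<in> carrier P" using u P.part_closed by blast
    obtain c where c: "\<forall>b\<in>X. c b \<in> sym_carrier S" "\<forall>b. b \<notin> X \<longrightarrow> c b = 0" "finite {b. c b \<noteq> 0}"
      "u = (\<Oplus>\<^bsub>P\<^esub>b\<in>{b. c b \<noteq> 0}. c b \<odot>\<^bsub>P\<^esub> b)"
      using bspec[OF basis uC] by auto
    have "(\<Oplus>\<^bsub>P\<^esub>b\<in>F. c b \<odot>\<^bsub>P\<^esub> b) \<in> G" if "finite F" "F \<subseteq> X" for F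
      using that
    proof induction
      case empty
      then show ?case using G_zero by simp
    next
      case (insert b F)
      have "c d \<odot>\<^bsub>P\<^esub> d \<in> carrier P" if "d \<in> X" for d using G_smult[of "c d" d] c(1) that by (simp add: G_def)
      then have "(\<Oplus>\<^bsub>P\<^esub>d\<in>insert b F. c d \<odot>\<^bsub>P\<^esub> d) = c b \<odot>\<^bsub>P\<^esub> b \<oplus>\<^bsub>P\<^esub> (\<Oplus>\<^bsub>P\<^esub>d\<in>F. c d \<odot>\<^bsub>P\<^esub> d)"
        using insert by (intro P.M.finsum_insert) auto
      then show ?case using insert G_add G_smult c(1) by simp
    qed
    moreover have "{b. c b \<noteq> 0} \<subseteq> X" using c(2) by blast
    ultimately have "u \<in> G" using c(3,4) by auto
    then show "u \<in> {\<zero>\<^bsub>P\<^esub>}" using P.component_homogeneous[OF u, of k] k by (simp add: G_def)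
  qed
qed

lemma bruhat_less_length: "bruhat_less W S y x \<Longrightarrow> cox_length W S y < cox_length W S x"
  unfolding bruhat_less_def
  by (induction rule: tranclp_induct) (auto simp: bruhat_step_def)

lemma ic_sheaf_facts:
  fixes W :: "('w, 'b) monoid_scheme" and B :: "('w, 'm) bruhat_sheaf"
  assumes B: "ic_sheaf W S \<alpha> x B"
  shows "\<And>y. y \<in> carrier W \<Longrightarrow> graded_module (sym_alg S) (rpart (sym_alg S)) (stalk B y)"
    and "\<And>y. \<lbrakk>y \<in> carrier W; \<not> bruhat_le W S y x\<rbrakk> \<Longrightarrow> carrier (stalk B y) = {\<zero>\<^bsub>stalk B y\<^esub>}"
    and "graded_iso (sym_alg S) (stalk B x) (regular_module (sym_alg S))"
    and "\<And>E y. E \<in> edges_from W S y \<Longrightarrow>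
      emod B E = graded_quot (stalk B (snd E)) (smult_image (edge_label W S \<alpha> E) (stalk B (snd E))) \<and>
      graded_hom (sym_alg S) (stalk B y) (emod B E) (rest B y E)"
    and "\<And>y. \<lbrakk>y \<in> carrier W; bruhat_less W S y x\<rbrakk> \<Longrightarrow>
      projective_cover (sym_alg S) (rpart (sym_alg S)) (stalk B y) (delta_module W S B y)
        (\<lambda>m. \<lambda>E\<in>edges_from W S y. rest B y E m)"
  using B unfolding ic_sheaf_def Let_def edges_from_def by blast+

text \<open>Descending induction in the Bruhat order, following the construction of the sheaf: the stalk at $x$
  is the symmetric algebra, and below $x$ the bound passes from the stalks above $y$ to
  $B^{\delta y}$ and from there to its projective cover.\<close>

lemma stalk_nonnegative:
  fixes W :: "('w, 'b) monoid_scheme" and B :: "('w, 'm) bruhat_sheaf"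
  assumes B: "ic_sheaf W S \<alpha> x B" and "y \<in> carrier W" and "k < 0"
  shows "mpart (stalk B y) k \<subseteq> {\<zero>\<^bsub>stalk B y\<^esub>}"
  using assms(2,3)
proof (induction "cox_length W S x - cox_length W S y" arbitrary: y k rule: less_induct)
  case less
  note facts = ic_sheaf_facts[OF B]
  interpret P: graded_mod "sym_alg S" "rpart (sym_alg S)" "stalk B y"
    by (rule graded_modI[OF facts(1)[OF less.prems(1)]]) (simp add: rpart_sym_alg_closed)
  consider "\<not> bruhat_le W S y x" | "y = x" | "bruhat_less W S y x"
    unfolding bruhat_le_def by blast
  then show ?case
  proof cases
    case 1
    then show ?thesis using facts(2)[OF less.prems(1)] P.part_closed by blast
  next
    case 2
    obtain h where h: "graded_hom (sym_alg S) (stalk B x) (regular_module (sym_alg S)) h \<and>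
        bij_betw h (carrier (stalk B x)) (carrier (regular_module (sym_alg S))) \<and>
        (\<forall>k. h ` mpart (stalk B x) k = mpart (regular_module (sym_alg S)) k)"
      using facts(3) unfolding graded_iso_def by (elim exE)
    then have inj: "inj_on h (carrier (stalk B y))"
      and parts: "h ` mpart (stalk B y) k = mpart (regular_module (sym_alg S)) k"
      by (simp_all add: 2 bij_betw_def)
    have h0: "h u = 0" if u: "u \<in> mpart (stalk B y) k" for u
    proof -
      have "h u \<in> rpart (sym_alg S) k" using parts u by (auto simp: regular_module_def)
      then show ?thesis by (rule rpart_sym_alg_negative[OF less.prems(2)])
    qed
    show ?thesis
    proof
      fix u assume u: "u \<in> mpart (stalk B y) k"
      have "u = \<zero>\<^bsub>stalk B y\<^esub>"
        using inj_onD[OF inj, of u "\<zero>\<^bsub>stalk B y\<^esub>"] h0[OF u] h0[OF P.zero_in_part] P.part_closed[OF u]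
        by simp
      then show "u \<in> {\<zero>\<^bsub>stalk B y\<^esub>}" by simp
    qed
  next
    case 3
    have "mpart (delta_module W S B y) j \<subseteq> {\<zero>\<^bsub>delta_module W S B y\<^esub>}" if j: "j < 0" for j
    proof (rule delta_module_graded(2)[OF facts(1) facts(4) less.prems(1) facts(5)[OF less.prems(1) 3]])
      fix E assume "E \<in> edges_from W S y"
      then have "snd E \<in> carrier W" "bruhat_less W S y (snd E)"
        by (auto simp: edges_from_def bruhat_edges_def)
      then show "mpart (stalk B (snd E)) j \<subseteq> {\<zero>\<^bsub>stalk B (snd E)\<^esub>}"
        using less.hyps[of "snd E" j] bruhat_less_length[of W S y "snd E"] bruhat_less_length[OF 3] j
        by (simp add: diff_less_mono2)
    qed
    then show ?thesis
      using projective_cover_nonnegative[OF facts(5)[OF less.prems(1) 3] _ less.prems(2)] by blast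
  qed
qed

lemma delta_extension_graded:
  fixes W :: "('w, 'b) monoid_scheme" and B :: "('w, 'm) bruhat_sheaf"
  assumes B: "ic_sheaf W S \<alpha> x B" and y: "y \<in> carrier W" "bruhat_less W S y x"
    and \<rho>: "graded_alg_hom S \<rho>" "\<rho> ` carrier (sym_alg S) = carrier RT"
  defines "A \<equiv> extend_to_RT S \<rho> (delta_module W S B y)"
  shows "graded_module RT (rpart RT) A" and "k < 0 \<Longrightarrow> mpart A k \<subseteq> {\<zero>\<^bsub>A\<^esub>}"
proof -
  note facts = ic_sheaf_facts[OF B]
  note delta = delta_module_graded[OF facts(1) facts(4) y(1) facts(5)[OF y]]
  have graded: "graded_module (sym_alg S) (rpart (sym_alg S)) (delta_module W S B y)"
    by (rule delta(1))
  show "graded_module RT (rpart RT) A"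
    unfolding A_def by (rule extend_to_RT_graded_module(1)[OF graded \<rho>])
  assume k: "k < 0"
  have "mpart (delta_module W S B y) k \<subseteq> {\<zero>\<^bsub>delta_module W S B y\<^esub>}"
  proof (rule delta(2))
    fix E assume "E \<in> edges_from W S y"
    then have "snd E \<in> carrier W" by (auto simp: edges_from_def bruhat_edges_def)
    then show "mpart (stalk B (snd E)) k \<subseteq> {\<zero>\<^bsub>stalk B (snd E)\<^esub>}"
      by (rule stalk_nonnegative[OF B _ k])
  qed
  then show "mpart A k \<subseteq> {\<zero>\<^bsub>A\<^esub>}"
    unfolding A_def by (rule extend_to_RT_graded_module(2)[OF graded \<rho>])
qed

section \<open>Hard Lefschetz and sums of strings\<close>

theorem lefschetz_iff_sum_of_strings:
  fixes A :: "(real poly, 'e) gmodule"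
  assumes A: "graded_module RT (rpart RT) A" and below: "\<And>k. k < 0 \<Longrightarrow> mpart A k \<subseteq> {\<zero>\<^bsub>A\<^esub>}"
  shows "(\<forall>m::nat. m \<ge> 1 \<longrightarrow>
      bij_betw (\<lambda>u. T_pow m \<odot>\<^bsub>A\<^esub> u) (mpart A (d - int m)) (mpart A (d + int m))) \<longleftrightarrow>
    is_sum_of_strings d A"
proof
  assume lef: "\<forall>m::nat. m \<ge> 1 \<longrightarrow>
      bij_betw (\<lambda>u. T_pow m \<odot>\<^bsub>A\<^esub> u) (mpart A (d - int m)) (mpart A (d + int m))"
  have "graded_mod RT (rpart RT) A" by (rule graded_modI[OF A]) simp
  then have "lefschetz_mod A d"
    using below lef by (simp add: lefschetz_mod_def lefschetz_mod_axioms_def)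
  then show "is_sum_of_strings d A" by (rule lefschetz_mod.is_sum_of_strings)
qed (use sum_of_strings_lefschetz[OF A] in blast)

theorem proposition6p7:
  fixes W :: "('w, 'b) monoid_scheme"
    and S :: "'w set"
    and \<alpha> :: "'w \<Rightarrow> 'w \<Rightarrow> real"
    and \<B> :: "'w \<Rightarrow> ('w, 'm) bruhat_sheaf"
    and \<rho> :: "(('w \<Rightarrow>\<^sub>0 nat) \<Rightarrow>\<^sub>0 real) \<Rightarrow> real poly"
  defines "d \<equiv> \<lambda>x y. int (cox_length W S x) - int (cox_length W S y)"
    and "M\<^sub>T \<equiv> \<lambda>x y. extend_to_RT S \<rho> (delta_module W S (\<B> x) y)"
  assumes "coxeter_system W S" and "finite S"
    and "\<And>t. t \<in> reflections W S \<Longrightarrow> is_root_of W S t (\<alpha> t)"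
    and "\<And>x. x \<in> carrier W \<Longrightarrow> ic_sheaf W S \<alpha> x (\<B> x)"
    and "graded_alg_hom S \<rho>" and "\<rho> ` carrier (sym_alg S) = carrier RT"
    and "\<And>t. t \<in> reflections W S \<Longrightarrow> \<rho> (sym_vec S (\<alpha> t)) \<noteq> 0"
    and "\<And>x y. \<lbrakk>x \<in> carrier W; y \<in> carrier W; bruhat_less W S y x\<rbrakk> \<Longrightarrow>
           generated_in_degrees_le (sym_alg S) (stalk (\<B> x) y) (d x y)"
  shows
    "(\<forall>x\<in>carrier W. \<forall>y\<in>carrier W. bruhat_less W S y x \<longrightarrow>
        (\<forall>m::nat. m \<ge> 1 \<longrightarrow>
           bij_betw (\<lambda>u. T_pow m \<odot>\<^bsub>M\<^sub>T x y\<^esub> u)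
             (mpart (M\<^sub>T x y) (d x y - int m)) (mpart (M\<^sub>T x y) (d x y + int m)))) \<longleftrightarrow>
     (\<forall>x\<in>carrier W. \<forall>y\<in>carrier W. bruhat_less W S y x \<longrightarrow>
        is_sum_of_strings (d x y) (M\<^sub>T x y))"
proof -
  have "(\<forall>m::nat. m \<ge> 1 \<longrightarrow>
      bij_betw (\<lambda>u. T_pow m \<odot>\<^bsub>M\<^sub>T x y\<^esub> u)
        (mpart (M\<^sub>T x y) (d x y - int m)) (mpart (M\<^sub>T x y) (d x y + int m))) \<longleftrightarrow>
    is_sum_of_strings (d x y) (M\<^sub>T x y)"
    if x: "x \<in> carrier W" and y: "y \<in> carrier W" and less: "bruhat_less W S y x" for x y
    unfolding M\<^sub>T_def
    by (rule lefschetz_iff_sum_of_strings)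
      (rule delta_extension_graded[OF assms(6)[OF x] y less assms(7,8)], assumption?)+
  then show ?thesis by blast
qed

end
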